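(* Consider the real system $\dot x^1=P_0+P_1+P_2,\ \dot x^2=Q_0+Q_1+Q_2$ of degree at most two (notation in the context), and suppose that $\mu=H=G=0$, $F\neq 0$ (there is one simple real singular point). For the existence of a center of the system it is necessary and sufficient that one of the following two sequences of conditions holds: (i) $\tilde N\neq 0,\ C_3=C_{10}=0,\ C_{11}<0$; (ii) $\tilde N=0,\ J_2=0,\ J_1>0$.
   Context: System. $\dfrac{dx^j}{dt}=a^j+a^j_\alpha x^\alpha+a^j_{\alpha\beta}x^\alpha x^\beta$ $(j=1,2)$ with real coefficients, $a^j_{\alpha\beta}=a^j_{\beta\alpha}$; repeated upper/lower indices are summed over $\{1,2\}$; $x=(x^1,x^2)$. Put $P_0=a^1$, $P_1=a^1_\alpha x^\alpha$, $P_2=a^1_{\alpha\beta}x^\alpha x^\beta$, $Q_0=a^2$, $Q_1=a^2_\alpha x^\alpha$, $Q_2=a^2_{\alpha\beta}x^\alpha x^\beta$. Also $\varepsilon^{11}=\varepsilon^{22}=\varepsilon_{11}=\varepsilon_{22}=0$, $\varepsilon^{12}=\varepsilon_{12}=1$, $\varepsilon^{21}=\varepsilon_{21}=-1$. A center is a singular (equilibrium) point, anywhere in the real plane, with a neighbourhood in which all other orbits are closed curves surrounding it. Transvectant. For forms $f,\varphi$ in $x^1,x^2$ of degrees $r,\rho$ and $k\le\min(r,\rho)$, $$(f,\varphi)^{(k)}=\frac{(r-k)!(\rho-k)!}{r!\rho!}\sum_{h=0}^k(-1)^h\binom kh\frac{\partial^kf}{\partial(x^1)^{k-h}\partial(x^2)^h}\,\frac{\partial^k\varphi}{\partial(x^1)^h\partial(x^2)^{k-h}}.$$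 Convention. A form in $x$ whose coefficients are polynomials in the coefficients of the system equals zero iff all its coefficients vanish. Basic forms. $\hat B=[2a^na^h_{u\alpha}-a^n_ua^h_\alpha]a^l_ra^k_{p\beta}a^m_{qs}a^g_{v\gamma}x^\alpha x^\beta x^\gamma\varepsilon_{kl}\varepsilon_{mn}\varepsilon_{gh}\varepsilon^{pq}\varepsilon^{rs}\varepsilon^{uv}$; $\hat C=a^p_{\alpha\beta}x^qx^\alpha x^\beta\varepsilon_{pq}$; $\hat D=[2a^pa^r_{\alpha\gamma}-a^p_\alpha a^r_\gamma]a^u_{\beta\varkappa}x^qx^sx^v\varepsilon_{pq}\varepsilon_{rs}\varepsilon_{uv}\varepsilon^{\alpha\beta}\varepsilon^{\gamma\varkappa}$; $\hat F=[a^m_sa^n_\beta a^k_{pr}-2a^k_ra^n_\beta a^m_{ps}+a^k_pa^m_ra^n_{s\beta}-4a^ma^k_{pr}a^n_{s\beta}]a^l_{q\alpha}x^\alpha x^\beta\varepsilon_{kl}\varepsilon_{mn}\varepsilon^{pq}\varepsilon^{rs}$; $\hat G=a^\alpha_{\alpha\beta}x^\beta$; $\hat H=\frac12a^p_{r\alpha}a^q_{s\beta}x^\alpha x^\beta\varepsilon_{pq}\varepsilon^{rs}$; $\hat K=\frac12a^p_{mu}a^r_{nv}x^qx^s\varepsilon_{pq}\varepsilon_{rs}\varepsilon^{mn}\varepsilon^{uv}$; $\tilde N=\hat K$. Invariants. $A_2=(\hat C,\hat D)^{(3)}$; $A_{17}=(((\hat D,\hat D)^{(2)},\hat G)^{(1)},\hat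 G)^{(1)}$; $A_{18}=((\hat D,\hat F)^{(2)},\hat G)^{(1)}$; $A_{19}=((\hat D,\hat D)^{(2)},\hat H)^{(2)}$; $A_{21}=((\hat D,\hat D)^{(2)},\hat K)^{(2)}$; $A_{26}=(\hat B,\hat D)^{(3)}$. $C_3=A_2$; $C_{10}=A_{26}$; $C_{11}=A_2^2-10A_{17}-2A_{18}-6A_{19}+6A_{21}$. $I_1=a^\alpha_\alpha$; $I_2=a^\alpha_\beta a^\beta_\alpha$; $I_{17}=a^\alpha a^\beta_{\alpha\beta}$; $I_{20}=a^\alpha a^\beta a^\gamma a^\delta_{\alpha\beta}\varepsilon_{\delta\gamma}$; $J_2=I_1(I_2-I_1^2)+4I_1I_{17}-4I_{20}$. Further quantities. Let $J_1=\det\begin{pmatrix}\partial P_1/\partial x^1&\partial P_1/\partial x^2\\ \partial Q_1/\partial x^1&\partial Q_1/\partial x^2\end{pmatrix}$; $B_1=x^\alpha a^\beta_qa^\gamma_{p\alpha}\varepsilon_{\beta\gamma}\varepsilon^{pq}$; $B_2=P_0Q_1-P_1Q_0$; $B_3=\hat H=\frac14\left(\frac{\partial P_2}{\partial x^1}\frac{\partial Q_2}{\partial x^2}-\frac{\partial P_2}{\partial x^2}\frac{\partial Q_2}{\partial x^1}\right)$; $B_4=P_0Q_2-P_2Q_0$; $B_5=P_1Q_2-P_2Q_1$. Then $\mu=-2(B_3,B_3)^{(2)}$; $H=2(B_3,B_1)^{(1)}$; $G=\frac12\left[4(B_1,B_5)^{(1)}-3(B_5,B_5)^{(2)}+8(B_3,B_4)^{(1)}\right]$;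 $F=J_1B_5+2B_1B_4+4B_2B_3$ (the unhatted $H,G,F$ are different from $\hat H,\hat G,\hat F$).
   Formalization: In J_2 the invariant I_20, printed as a^αa^βa^γa^δ_{αβ}ε_{δγ}, is corrected to a^αa^β_αa^γ_{βγ}; with the printed formula the criterion fails, e.g. for x'=2x−y+x², y'=1+x, which has a center but J_2=−4. *)

theory Defs
  imports "HOL-Analysis.Analysis" "HOL-Computational_Algebra.Polynomial"
begin

text \<open>A form in \<open>x\<^sup>1, x\<^sup>2\<close> is a real polynomial in two variables: the inner polynomial
  variable is \<open>x\<^sup>1\<close>, the outer one \<open>x\<^sup>2\<close>. So \<open>f = 0\<close> says that all coefficients of \<open>f\<close>
  vanish. Tensor indices range over the two-element type \<open>2\<close>, whose elements are \<open>1\<close> and \<open>2\<close>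
  (where \<open>2 = 0\<close>).\<close>

type_synonym form = "real poly poly"

definition cst :: "real \<Rightarrow> form" where
  "cst r = [:[:r:]:]"

definition X :: "2 \<Rightarrow> form" where
  "X i = (if i = 1 then [:[:0, 1:]:] else [:0, 1:])"

definition d1 :: "form \<Rightarrow> form" where
  "d1 = map_poly pderiv"

definition d2 :: "form \<Rightarrow> form" where
  "d2 = pderiv"

text \<open>The degrees \<open>r\<close>, \<open>\<rho>\<close> of the two forms are explicit arguments because the zero form does
  not determine its degree.\<close>

definition transvectant :: "nat \<Rightarrow> nat \<Rightarrow> nat \<Rightarrow> form \<Rightarrow> form \<Rightarrow> form" where
  "transvectant r \<rho> k f g =
     cst (fact (r - k) * fact (\<rho> - k) / (fact r * fact \<rho>)) *
     (\<Sum>h = 0..k. cst ((-1) ^ h * real (k choose h)) *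
        (d1 ^^ (k - h)) ((d2 ^^ h) f) * (d1 ^^ h) ((d2 ^^ (k - h)) g))"

text \<open>The real number represented by a form of degree 0.\<close>

definition scalar :: "form \<Rightarrow> real" where
  "scalar f = coeff (coeff f 0) 0"

definition contract :: "(2 \<Rightarrow> 'a::comm_monoid_add) \<Rightarrow> 'a"  (binder "\<Sigma>" 10) where
  "(\<Sigma> i. f i) = (\<Sum>i\<in>UNIV. f i)"

definition eps :: "2 \<Rightarrow> 2 \<Rightarrow> real"  ("\<epsilon>") where
  "\<epsilon> i j = (if i = 1 \<and> j = 2 then 1 else if i = 2 \<and> j = 1 then -1 else 0)"

text \<open>The coefficients are indexed upper index first: \<open>a0 $ j\<close>, \<open>a1 $ j $ \<alpha>\<close> and
  \<open>a2 $ j $ \<alpha> $ \<beta>\<close> are the constant, linear and quadratic ones in the \<open>j\<close>-th equation.\<close>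

context
  fixes a0 :: "real ^ 2" and a1 :: "real ^ 2 ^ 2" and a2 :: "real ^ 2 ^ 2 ^ 2"
begin

definition vector_field :: "real ^ 2 \<Rightarrow> real ^ 2" where
  "vector_field x = (\<chi> j. a0 $ j + (\<Sigma> \<alpha>. a1 $ j $ \<alpha> * x $ \<alpha>)
                             + (\<Sigma> \<alpha> \<beta>. a2 $ j $ \<alpha> $ \<beta> * x $ \<alpha> * x $ \<beta>))"

definition P0 :: form where "P0 = cst (a0 $ 1)"
definition P1 :: form where "P1 = (\<Sigma> \<alpha>. cst (a1 $ 1 $ \<alpha>) * X \<alpha>)"
definition P2 :: form where "P2 = (\<Sigma> \<alpha> \<beta>. cst (a2 $ 1 $ \<alpha> $ \<beta>) * X \<alpha> * X \<beta>)"
definition Q0 :: form where "Q0 = cst (a0 $ 2)"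
definition Q1 :: form where "Q1 = (\<Sigma> \<alpha>. cst (a1 $ 2 $ \<alpha>) * X \<alpha>)"
definition Q2 :: form where "Q2 = (\<Sigma> \<alpha> \<beta>. cst (a2 $ 2 $ \<alpha> $ \<beta>) * X \<alpha> * X \<beta>)"

definition B_hat :: form where
  "B_hat = (\<Sigma> n h u \<alpha> l r k p \<beta> m q s g v \<gamma>.
     cst ((2 * a0 $ n * a2 $ h $ u $ \<alpha> - a1 $ n $ u * a1 $ h $ \<alpha>)
          * a1 $ l $ r * a2 $ k $ p $ \<beta> * a2 $ m $ q $ s * a2 $ g $ v $ \<gamma>
          * \<epsilon> k l * \<epsilon> m n * \<epsilon> g h * \<epsilon> p q * \<epsilon> r s * \<epsilon> u v)
     * X \<alpha> * X \<beta> * X \<gamma>)"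

definition C_hat :: form where
  "C_hat = (\<Sigma> p \<alpha> \<beta> q. cst (a2 $ p $ \<alpha> $ \<beta> * \<epsilon> p q) * X q * X \<alpha> * X \<beta>)"

definition D_hat :: form where
  "D_hat = (\<Sigma> p r \<alpha> \<gamma> u \<beta> \<kappa> q s v.
     cst ((2 * a0 $ p * a2 $ r $ \<alpha> $ \<gamma> - a1 $ p $ \<alpha> * a1 $ r $ \<gamma>) * a2 $ u $ \<beta> $ \<kappa>
          * \<epsilon> p q * \<epsilon> r s * \<epsilon> u v * \<epsilon> \<alpha> \<beta> * \<epsilon> \<gamma> \<kappa>)
     * X q * X s * X v)"

definition F_hat :: form where
  "F_hat = (\<Sigma> m n k l p q r s \<alpha> \<beta>.
     cst ((a1 $ m $ s * a1 $ n $ \<beta> * a2 $ k $ p $ r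
           - 2 * a1 $ k $ r * a1 $ n $ \<beta> * a2 $ m $ p $ s
           + a1 $ k $ p * a1 $ m $ r * a2 $ n $ s $ \<beta>
           - 4 * a0 $ m * a2 $ k $ p $ r * a2 $ n $ s $ \<beta>)
          * a2 $ l $ q $ \<alpha> * \<epsilon> k l * \<epsilon> m n * \<epsilon> p q * \<epsilon> r s)
     * X \<alpha> * X \<beta>)"

definition G_hat :: form where
  "G_hat = (\<Sigma> \<alpha> \<beta>. cst (a2 $ \<alpha> $ \<alpha> $ \<beta>) * X \<beta>)"

definition H_hat :: form where
  "H_hat = (\<Sigma> p q r s \<alpha> \<beta>.
     cst (1/2 * a2 $ p $ r $ \<alpha> * a2 $ q $ s $ \<beta> * \<epsilon> p q * \<epsilon> r s) * X \<alpha> * X \<beta>)"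

definition K_hat :: form where
  "K_hat = (\<Sigma> p m u r n v q s.
     cst (1/2 * a2 $ p $ m $ u * a2 $ r $ n $ v * \<epsilon> p q * \<epsilon> r s * \<epsilon> m n * \<epsilon> u v) * X q * X s)"

definition N_tilde :: form where
  "N_tilde = K_hat"

definition A2 :: real where
  "A2 = scalar (transvectant 3 3 3 C_hat D_hat)"

definition A17 :: real where
  "A17 = scalar (transvectant 1 1 1
           (transvectant 2 1 1 (transvectant 3 3 2 D_hat D_hat) G_hat) G_hat)"

definition A18 :: real where
  "A18 = scalar (transvectant 1 1 1 (transvectant 3 2 2 D_hat F_hat) G_hat)"

definition A19 :: real where
  "A19 = scalar (transvectant 2 2 2 (transvectant 3 3 2 D_hat D_hat) H_hat)"

definition A21 :: real where
  "A21 = scalar (transvectant 2 2 2 (transvectant 3 3 2 D_hat D_hat) K_hat)"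

definition A26 :: real where
  "A26 = scalar (transvectant 3 3 3 B_hat D_hat)"

definition C3 :: real where "C3 = A2"
definition C10 :: real where "C10 = A26"
definition C11 :: real where "C11 = A2\<^sup>2 - 10 * A17 - 2 * A18 - 6 * A19 + 6 * A21"

definition I1 :: real where "I1 = (\<Sigma> \<alpha>. a1 $ \<alpha> $ \<alpha>)"
definition I2 :: real where "I2 = (\<Sigma> \<alpha> \<beta>. a1 $ \<alpha> $ \<beta> * a1 $ \<beta> $ \<alpha>)"
definition I17 :: real where "I17 = (\<Sigma> \<alpha> \<beta>. a0 $ \<alpha> * a2 $ \<beta> $ \<alpha> $ \<beta>)"

text \<open>\<open>I20\<close> is \<open>a\<^sup>\<alpha> a\<^sup>\<beta>\<^sub>\<alpha> a\<^sup>\<gamma>\<^sub>\<beta>\<^sub>\<gamma>\<close>. The expression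
  \<open>a\<^sup>\<alpha> a\<^sup>\<beta> a\<^sup>\<gamma> a\<^sup>\<delta>\<^sub>\<alpha>\<^sub>\<beta> \<epsilon>\<^sub>\<delta>\<^sub>\<gamma>\<close> printed under this name in the source is a misprint: with it \<open>J2\<close>
  would not be homogeneous and the criterion would fail, e.g. for
  \<open>x' = 2x - y + x\<^sup>2\<close>, \<open>y' = 1 + x\<close>. This system has a center at \<open>(-1, -1)\<close> (a translation gives
  \<open>x' = -y + x\<^sup>2\<close>, \<open>y' = x\<close>, which is reversible) and satisfies the hypotheses with
  \<open>N_tilde = 0\<close>, but \<open>J2\<close> would be \<open>-4\<close>. Both versions of \<open>J2\<close> agree if \<open>a0 = 0\<close>.\<close>

definition I20 :: real where
  "I20 = (\<Sigma> \<alpha> \<beta> \<gamma>. a0 $ \<alpha> * a1 $ \<beta> $ \<alpha> * a2 $ \<gamma> $ \<beta> $ \<gamma>)"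

definition J1 :: real where
  "J1 = scalar (det (vector [vector [d1 P1, d2 P1], vector [d1 Q1, d2 Q1]] :: form ^ 2 ^ 2))"

definition J2 :: real where
  "J2 = I1 * (I2 - I1\<^sup>2) + 4 * I1 * I17 - 4 * I20"

definition B1 :: form where
  "B1 = (\<Sigma> \<alpha> \<beta> \<gamma> p q. cst (a1 $ \<beta> $ q * a2 $ \<gamma> $ p $ \<alpha> * \<epsilon> \<beta> \<gamma> * \<epsilon> p q) * X \<alpha>)"

definition B2 :: form where "B2 = P0 * Q1 - P1 * Q0"
definition B3 :: form where "B3 = H_hat"
definition B4 :: form where "B4 = P0 * Q2 - P2 * Q0"
definition B5 :: form where "B5 = P1 * Q2 - P2 * Q1"

definition comitant_mu :: real where
  "comitant_mu = scalar (- 2 * transvectant 2 2 2 B3 B3)"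

definition comitant_H :: form where
  "comitant_H = 2 * transvectant 2 1 1 B3 B1"

definition comitant_G :: form where
  "comitant_G = cst (1/2) * (4 * transvectant 1 3 1 B1 B5 - 3 * transvectant 3 3 2 B5 B5
                              + 8 * transvectant 2 2 1 B3 B4)"

definition comitant_F :: form where
  "comitant_F = cst J1 * B5 + 2 * B1 * B4 + 4 * B2 * B3"

end

definition closed_orbit :: "(real ^ 2 \<Rightarrow> real ^ 2) \<Rightarrow> (real ^ 2) set \<Rightarrow> bool" where
  "closed_orbit f S \<longleftrightarrow>
     (\<exists>\<phi> T. (\<forall>t. (\<phi> has_vector_derivative f (\<phi> t)) (at t)) \<and>
            T > 0 \<and> (\<forall>t. \<phi> (t + T) = \<phi> t) \<and> (\<exists>t. \<phi> t \<noteq> \<phi> 0) \<and> S = range \<phi>)"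

definition is_center :: "(real ^ 2 \<Rightarrow> real ^ 2) \<Rightarrow> real ^ 2 \<Rightarrow> bool" where
  "is_center f z \<longleftrightarrow>
     f z = 0 \<and>
     (\<exists>U. open U \<and> z \<in> U \<and> (\<forall>p \<in> U - {z}. \<exists>S. closed_orbit f S \<and> p \<in> S \<and> z \<in> inside S))"

lemma contract_2: "(\<Sigma> i. f i) = f 1 + f 2"
  by (simp add: contract_def sum_2)

lemma B3_jacobian:
  assumes "\<And>j \<alpha> \<beta>. a2 $ j $ \<alpha> $ \<beta> = a2 $ j $ \<beta> $ \<alpha>"
  shows "B3 a2 = cst (1/4) * (d1 (P2 a2) * d2 (Q2 a2) - d2 (P2 a2) * d1 (Q2 a2))"
  unfolding B3_def H_hat_def P2_def Q2_def contract_2 d1_def d2_def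
  by (simp add: X_def cst_def eps_def assms[of _ 2 1] pderiv_pCons map_poly_pCons algebra_simps)

end

theory Submission
  imports Defs
begin

text \<open>The form \<open>B3\<close> is a quarter of the Jacobian of the quadratic parts, and \<open>\<mu>\<close> is its discriminant.

  If \<open>B3 \<noteq> 0\<close>, then \<open>\<mu> = 0\<close> means that \<open>P2\<close>, \<open>Q2\<close> have exactly one common linear factor \<open>\<xi>\<close>, and
  \<open>H = G = 0\<close>, \<open>F \<noteq> 0\<close> bring the system, with \<open>X = \<xi>(x - z)\<close>, \<open>Y = \<eta>(x - z)\<close> at its singular point \<open>z\<close>, to
  \<open>g X (X + S) + h (t X + Y (X + S))\<close> with independent vectors \<open>g\<close>, \<open>h\<close> and \<open>S, t \<noteq> 0\<close>. After division by
  \<open>X + S\<close> this is a Lienard system whose damping is not even, so there is no center; on the other side,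
  \<open>C3\<close> is a nonzero multiple of \<open>\<xi>(h)\<^sup>2\<close>, and \<open>\<xi>(h) = 0\<close> forces \<open>C11 = 0\<close>.

  If \<open>B3 = 0\<close>, then the quadratic part is a fixed vector \<open>w\<close> times a quadratic form \<open>R\<close>. With \<open>A\<close> the linear
  part at the singular point \<open>z\<close> and \<open>l\<close> the linear form \<open>u \<mapsto> w \<times> A u\<close>, the condition \<open>G = 0\<close> becomes
  \<open>R = l m\<close>. In the coordinates \<open>y = w \<times> (x - z)\<close>, \<open>v = l(x - z)\<close> the system is
  \<open>y' = v\<close>, \<open>v' = \<tau> v - d y + v (\<alpha> y + \<beta> v)\<close>, with \<open>\<tau>\<close>, \<open>d\<close> the trace and determinant of \<open>A\<close>,
  \<open>\<alpha> = l \<times> m\<close> and \<open>\<beta> = m(w)\<close>. It has a center iff \<open>\<tau> = 0\<close>, \<open>d > 0\<close> and \<open>\<alpha> \<beta> = 0\<close>: both cases with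
  \<open>\<alpha> \<beta> = 0\<close> have separable first integrals, and otherwise a Lyapunov function excludes a center. Up to
  nonzero factors, \<open>N_tilde\<close> is \<open>\<alpha>\<^sup>2 y\<^sup>2\<close> and \<open>C3\<close> is \<open>\<alpha> \<beta> d l(w)\<close>; if \<open>\<beta> = 0\<close>, then \<open>C10\<close> and \<open>C11\<close> are \<open>\<tau> d\<close>
  and \<open>- d\<close>, the latter with the positive factor \<open>k\<^sup>4 l(w)\<^sup>6 / 4\<close> where \<open>m(u) = k (w \<times> u)\<close>; if \<open>\<alpha> = 0\<close>, then \<open>J1 = d\<close> and \<open>J2 = - 2 \<tau> d\<close>.\<close>

section \<open>Binary forms\<close>

text \<open>The lists run over the powers of x2: \<open>quad a b c\<close> is a x1^2 + b x1 x2 + c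
  x2^2, and \<open>cub\<close> is ordered in the same way, without binomial coefficients. The hatted
  forms and comitants have degree at most three, so identities between them become real
  arithmetic.\<close>

definition lin :: "real \<Rightarrow> real \<Rightarrow> form" where
  "lin a b = [:[:0, a:], [:b:]:]"
definition quad :: "real \<Rightarrow> real \<Rightarrow> real \<Rightarrow> form" where
  "quad a b c = [:[:0, 0, a:], [:0, b:], [:c:]:]"
definition cub :: "real \<Rightarrow> real \<Rightarrow> real \<Rightarrow> real \<Rightarrow> form" where
  "cub a b c d = [:[:0, 0, 0, a:], [:0, 0, b:], [:0, c:], [:d:]:]"

lemmas form_defs = cst_def lin_def quad_def cub_def

lemma form_add:
  "cst a + cst a' = cst (a + a')"
  "lin a b + lin a' b' = lin (a + a') (b + b')"
  "quad a b c + quad a' b' c' = quad (a + a') (b + b') (c + c')"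
  "cub a b c d + cub a' b' c' d' = cub (a + a') (b + b') (c + c') (d + d')"
  by (simp_all add: form_defs)

lemma form_diff:
  "cst a - cst a' = cst (a - a')"
  "lin a b - lin a' b' = lin (a - a') (b - b')"
  "quad a b c - quad a' b' c' = quad (a - a') (b - b') (c - c')"
  "cub a b c d - cub a' b' c' d' = cub (a - a') (b - b') (c - c') (d - d')"
  by (simp_all add: form_defs)

lemma form_uminus:
  "- cst a = cst (- a)"
  "- lin a b = lin (- a) (- b)"
  "- quad a b c = quad (- a) (- b) (- c)"
  "- cub a b c d = cub (- a) (- b) (- c) (- d)"
  by (simp_all add: form_defs)

lemma form_mult:
  "cst r * cst a = cst (r * a)"
  "cst r * lin a b = lin (r * a) (r * b)"
  "cst r * quad a b c = quad (r * a) (r * b) (r * c)"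
  "cst r * cub a b c d = cub (r * a) (r * b) (r * c) (r * d)"
  "lin a b * cst r = lin (a * r) (b * r)"
  "lin a b * lin a' b' = quad (a * a') (a * b' + b * a') (b * b')"
  "lin a' b' * quad a b c = cub (a' * a) (a' * b + b' * a) (a' * c + b' * b) (b' * c)"
  "quad a b c * cst r = quad (a * r) (b * r) (c * r)"
  "quad a b c * lin a' b' = cub (a * a') (b * a' + a * b') (c * a' + b * b') (c * b')"
  by (simp_all add: form_defs algebra_simps)

lemma form_numeral: "numeral k = cst (numeral k)"
  by (simp add: cst_def numeral_poly)

lemma form_inject:
  "cst a = cst a' \<longleftrightarrow> a = a'"
  "lin a b = lin a' b' \<longleftrightarrow> a = a' \<and> b = b'"
  "quad a b c = quad a' b' c' \<longleftrightarrow> a = a' \<and> b = b' \<and> c = c'"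
  "cub a b c d = cub a' b' c' d' \<longleftrightarrow> a = a' \<and> b = b' \<and> c = c' \<and> d = d'"
  by (auto simp: form_defs)

lemma form_eq_0:
  "cst a = 0 \<longleftrightarrow> a = 0"
  "lin a b = 0 \<longleftrightarrow> a = 0 \<and> b = 0"
  "quad a b c = 0 \<longleftrightarrow> a = 0 \<and> b = 0 \<and> c = 0"
  "cub a b c d = 0 \<longleftrightarrow> a = 0 \<and> b = 0 \<and> c = 0 \<and> d = 0"
  by (auto simp: form_defs)

lemma form_X: "X 1 = lin 1 0" "X 2 = lin 0 1"
  by (simp_all add: X_def lin_def)

lemma scalar_cst: "scalar (cst a) = a"
  by (simp add: scalar_def cst_def)

lemma form_d1:
  "d1 (cst a) = cst 0" "d1 (lin a b) = cst a" "d1 (quad a b c) = lin (2 * a) b"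
  "d1 (cub a b c d) = quad (3 * a) (2 * b) c"
  by (simp_all add: form_defs d1_def map_poly_pCons pderiv_pCons)

lemma form_d2:
  "d2 (cst a) = cst 0" "d2 (lin a b) = cst b" "d2 (quad a b c) = lin b (2 * c)"
  "d2 (cub a b c d) = quad b (2 * c) (3 * d)"
  by (simp_all add: form_defs d2_def pderiv_pCons)

lemma form_monomial:
  "cst a * X 1 = lin a 0" "cst a * X 2 = lin 0 a"
  "lin a b * X 1 = quad a b 0" "lin a b * X 2 = quad 0 a b"
  "quad a b c * X 1 = cub a b c 0" "quad a b c * X 2 = cub 0 a b c"
  by (simp_all add: form_X form_mult)

section \<open>Transvectants in terms of coefficients\<close>

lemma transvectant_111: "transvectant 1 1 1 (lin a b) (lin c d) = cst (a * d - b * c)"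
  by (simp add: transvectant_def form_d1 form_d2 form_mult form_add)

lemma transvectant_211:
  "transvectant 2 1 1 (quad a b c) (lin p q) = lin (a * q - b * p / 2) (b * q / 2 - c * p)"
  by (simp add: transvectant_def form_d1 form_d2 form_mult form_add form_inject fact_numeral field_simps)

lemma transvectant_221:
  "transvectant 2 2 1 (quad a b c) (quad p q r) =
     quad ((a * q - b * p) / 2) (a * r - c * p) ((b * r - c * q) / 2)"
  by (simp add: transvectant_def form_d1 form_d2 form_mult form_add form_inject fact_numeral field_simps)

lemma transvectant_131:
  "transvectant 1 3 1 (lin a b) (cub p q r s) =
     quad ((a * q - 3 * b * p) / 3) (2 * (a * r - b * q) / 3) ((3 * a * s - b * r) / 3)"
  by (simp add: transvectant_def form_d1 form_d2 form_mult form_add form_inject fact_numeral field_simps)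

lemma transvectant_222:
  "transvectant 2 2 2 (quad a b c) (quad p q r) = cst (a * r - b * q / 2 + c * p)"
  by (simp add: transvectant_def eval_nat_numeral form_d1 form_d2 form_mult form_add form_inject field_simps)

lemma transvectant_322:
  "transvectant 3 2 2 (cub a b c d) (quad p q r) =
     lin (a * r - b * q / 3 + c * p / 3) (b * r / 3 - c * q / 3 + d * p)"
  by (simp add: transvectant_def eval_nat_numeral form_d1 form_d2 form_mult form_add form_inject field_simps)

lemma transvectant_332:
  "transvectant 3 3 2 (cub a b c d) (cub p q r s) =
     quad (a * r / 3 - 2 * b * q / 9 + c * p / 3) (a * s - b * r / 9 - c * q / 9 + d * p)
       (b * s / 3 - 2 * c * r / 9 + d * q / 3)"
  by (simp add: transvectant_def eval_nat_numeral form_d1 form_d2 form_mult form_add form_inject field_simps)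

lemma transvectant_333:
  "transvectant 3 3 3 (cub a b c d) (cub p q r s) = cst (a * s - b * r / 3 + c * q / 3 - d * p)"
  by (simp add: transvectant_def eval_nat_numeral form_d1 form_d2 form_mult form_add form_inject field_simps)

lemmas form_transvectant = transvectant_111 transvectant_211 transvectant_221 transvectant_131
  transvectant_222 transvectant_322 transvectant_332 transvectant_333

lemma eps_simps: "\<epsilon> 1 1 = 0" "\<epsilon> 1 2 = 1" "\<epsilon> 2 1 = -1" "\<epsilon> 2 2 = 0"
  by (simp_all add: eps_def)

text \<open>As a congruence rule this keeps the simplifier out of the body of a contraction. Contractions are then
  expanded from the outside, and the terms with a vanishing \<open>\<epsilon>\<close> disappear before they pile up.\<close>

lemma contract_weak_cong: "contract f = contract f"
  by (rule refl)

lemma cst_0: "cst 0 = 0" by (simp add: cst_def)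

lemmas contract_eval = contract_2 eps_simps mult_zero_left mult_zero_right mult_1_left mult_1_right
  mult_minus1_right minus_zero cst_0 add_0_left add_0_right

section \<open>The tensor contractions in coordinates\<close>

lemma C_hat_eq:
  assumes sym: "\<And>j \<alpha> \<beta>. a2 $ j $ \<alpha> $ \<beta> = a2 $ j $ \<beta> $ \<alpha>"
  shows "C_hat a2 = cub (- a2 $ 2 $ 1 $ 1) (a2 $ 1 $ 1 $ 1 - 2 * a2 $ 2 $ 1 $ 2)
       (2 * a2 $ 1 $ 1 $ 2 - a2 $ 2 $ 2 $ 2) (a2 $ 1 $ 2 $ 2)"
  by (simp only: C_hat_def contract_eval form_monomial form_add form_inject sym[of _ 2 1] cong:
      contract_weak_cong) simp

lemma G_hat_eq:
  "G_hat a2 = lin (a2 $ 1 $ 1 $ 1 + a2 $ 2 $ 2 $ 1) (a2 $ 1 $ 1 $ 2 + a2 $ 2 $ 2 $ 2)"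
  by (simp only: G_hat_def contract_eval form_monomial form_add form_inject cong: contract_weak_cong)

lemma H_hat_eq:
  assumes sym: "\<And>j \<alpha> \<beta>. a2 $ j $ \<alpha> $ \<beta> = a2 $ j $ \<beta> $ \<alpha>"
  shows "H_hat a2 = quad (a2 $ 1 $ 1 $ 1 * a2 $ 2 $ 1 $ 2 - a2 $ 1 $ 1 $ 2 * a2 $ 2 $ 1 $ 1)
      (a2 $ 1 $ 1 $ 1 * a2 $ 2 $ 2 $ 2 - a2 $ 1 $ 2 $ 2 * a2 $ 2 $ 1 $ 1)
      (a2 $ 1 $ 1 $ 2 * a2 $ 2 $ 2 $ 2 - a2 $ 1 $ 2 $ 2 * a2 $ 2 $ 1 $ 2)"
  by (simp only: H_hat_def contract_eval form_monomial form_add form_inject sym[of _ 2 1] cong: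
      contract_weak_cong) (simp add: field_simps)

text \<open>\<open>S11\<close>, \<open>S12\<close>, \<open>S22\<close> arise by contracting the
  upper index of the quadratic coefficients with \<open>\<epsilon>\<close> and x. The remaining two
  \<open>\<epsilon>\<close> of \<open>K_hat\<close> form the determinant of this symmetric matrix.
  In \<open>D_hat\<close> below they also form its adjugate, applied to the pair \<open>N1\<close>,
  \<open>N2\<close> built from the linear part.\<close>

lemma K_hat_eq:
  fixes S11 S12 S22 and a0 :: "real ^ 2" and a1 :: "real ^ 2 ^ 2" and a2 :: "real ^ 2 ^ 2 ^ 2"
  assumes sym: "\<And>j \<alpha> \<beta>. a2 $ j $ \<alpha> $ \<beta> = a2 $ j $ \<beta> $ \<alpha>"
  defines "S11 \<equiv> lin (- a2 $ 2 $ 1 $ 1) (a2 $ 1 $ 1 $ 1)"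
    and "S12 \<equiv> lin (- a2 $ 2 $ 1 $ 2) (a2 $ 1 $ 1 $ 2)"
    and "S22 \<equiv> lin (- a2 $ 2 $ 2 $ 2) (a2 $ 1 $ 2 $ 2)"
  shows "K_hat a2 = S11 * S22 - S12 * S12"
  unfolding S11_def S12_def S22_def
  by (simp only: K_hat_def contract_eval form_monomial form_add form_mult form_diff form_inject sym[of _ 2
      1] cong: contract_weak_cong) (simp add: field_simps)

lemma D_hat_eq:
  fixes S11 S12 S22 and a0 :: "real ^ 2" and a1 :: "real ^ 2 ^ 2" and a2 :: "real ^ 2 ^ 2 ^ 2"
  assumes sym: "\<And>j \<alpha> \<beta>. a2 $ j $ \<alpha> $ \<beta> = a2 $ j $ \<beta> $ \<alpha>"
  defines "S11 \<equiv> lin (- a2 $ 2 $ 1 $ 1) (a2 $ 1 $ 1 $ 1)"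
    and "S12 \<equiv> lin (- a2 $ 2 $ 1 $ 2) (a2 $ 1 $ 1 $ 2)"
    and "S22 \<equiv> lin (- a2 $ 2 $ 2 $ 2) (a2 $ 1 $ 2 $ 2)"
    and "N1 \<equiv> lin (- a1 $ 2 $ 1) (a1 $ 1 $ 1)"
    and "N2 \<equiv> lin (- a1 $ 2 $ 2) (a1 $ 1 $ 2)"
    and "M \<equiv> lin (- a0 $ 2) (a0 $ 1)"
  shows "D_hat a0 a1 a2 = cst 4 * (M * (S11 * S22 - S12 * S12))
    - (N1 * (N1 * S22) - cst 2 * (N1 * (N2 * S12)) + N2 * (N2 * S11))"
  unfolding S11_def S12_def S22_def N1_def N2_def M_def
  by (simp only: D_hat_def contract_eval form_monomial form_add form_mult form_diff form_inject sym[of _ 2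
      1] cong: contract_weak_cong) (intro conjI; algebra)

lemma B1_eq:
  assumes sym: "\<And>j \<alpha> \<beta>. a2 $ j $ \<alpha> $ \<beta> = a2 $ j $ \<beta> $ \<alpha>"
  shows "B1 a1 a2 = lin (a1 $ 1 $ 2 * a2 $ 2 $ 1 $ 1 - a1 $ 1 $ 1 * a2 $ 2 $ 1 $ 2 - a1 $ 2 $ 2 * a2 $ 1 $
      1 $ 1 + a1 $ 2 $ 1 * a2 $ 1 $ 1 $ 2)
     (a1 $ 1 $ 2 * a2 $ 2 $ 1 $ 2 - a1 $ 1 $ 1 * a2 $ 2 $ 2 $ 2 - a1 $ 2 $ 2 * a2 $ 1 $ 1 $ 2 + a1 $ 2 $ 1
         * a2 $ 1 $ 2 $ 2)"
  by (simp only: B1_def contract_eval form_monomial form_add form_mult form_diff form_inject sym[of _ 2 1]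
      cong: contract_weak_cong) (simp add: algebra_simps)

lemma P_eqs:
  assumes sym: "\<And>j \<alpha> \<beta>. a2 $ j $ \<alpha> $ \<beta> = a2 $ j $ \<beta> $ \<alpha>"
  shows "P0 a0 = cst (a0 $ 1)" "Q0 a0 = cst (a0 $ 2)"
    "P1 a1 = lin (a1 $ 1 $ 1) (a1 $ 1 $ 2)" "Q1 a1 = lin (a1 $ 2 $ 1) (a1 $ 2 $ 2)"
    "P2 a2 = quad (a2 $ 1 $ 1 $ 1) (2 * a2 $ 1 $ 1 $ 2) (a2 $ 1 $ 2 $ 2)"
    "Q2 a2 = quad (a2 $ 2 $ 1 $ 1) (2 * a2 $ 2 $ 1 $ 2) (a2 $ 2 $ 2 $ 2)"
  by (simp_all only: P0_def Q0_def P1_def Q1_def P2_def Q2_def contract_eval form_monomial form_add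
      form_mult form_diff form_inject sym[of _ 2 1] cong: contract_weak_cong) simp_all

lemma J1_eq: "J1 a1 = a1 $ 1 $ 1 * a1 $ 2 $ 2 - a1 $ 1 $ 2 * a1 $ 2 $ 1"
proof -
  have P: "P1 a1 = lin (a1 $ 1 $ 1) (a1 $ 1 $ 2)" "Q1 a1 = lin (a1 $ 2 $ 1) (a1 $ 2 $ 2)"
    by (simp_all add: P1_def Q1_def contract_2 form_monomial form_add)
  show ?thesis
    by (simp add: J1_def det_2 P form_d1 form_d2 form_mult form_diff scalar_cst)
qed

text \<open>The trace of the square of a matrix is the squared trace minus twice the determinant, so
  \<open>I2\<close> - \<open>I1\<close>^2 is -2 times the determinant. \<open>G1\<close> and
  \<open>G2\<close> are the coefficients of \<open>G_hat\<close>.\<close>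

lemma J2_eq: "J2 a0 a1 a2 = (let I = a1 $ 1 $ 1 + a1 $ 2 $ 2;
    G1 = a2 $ 1 $ 1 $ 1 + a2 $ 2 $ 1 $ 2; G2 = a2 $ 1 $ 2 $ 1 + a2 $ 2 $ 2 $ 2 in
    - 2 * I * (a1 $ 1 $ 1 * a1 $ 2 $ 2 - a1 $ 1 $ 2 * a1 $ 2 $ 1)
    + 4 * I * (a0 $ 1 * G1 + a0 $ 2 * G2) - 4 * (a0 $ 1 * (a1 $ 1 $ 1 * G1 + a1 $ 2 $ 1 * G2) +
     a0 $ 2 * (a1 $ 1 $ 2 * G1 + a1 $ 2 $ 2 * G2)))"
  unfolding J2_def I1_def I2_def I17_def I20_def contract_2 Let_def by algebra

section \<open>Quadratic parts of rank one\<close>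

text \<open>Every upper index of a quadratic coefficient carries the vector w. Contracting it with
  the linear part gives the form l = (l1, l2), and the term with \<open>a0\<close> dies because w x
  w = 0. What remains is a chain of contractions of l with the matrix (r s; s t).\<close>

lemma B_hat_rank_one:
  fixes a0 w :: "real ^ 2" and a1 :: "real ^ 2 ^ 2" and a2 :: "real ^ 2 ^ 2 ^ 2"
  assumes a2: "\<And>j. a2 $ j $ 1 $ 1 = w $ j * r" "\<And>j. a2 $ j $ 1 $ 2 = w $ j * s"
     "\<And>j. a2 $ j $ 2 $ 1 = w $ j * s" "\<And>j. a2 $ j $ 2 $ 2 = w $ j * t"
  and l: "l1 = w $ 1 * a1 $ 2 $ 1 - w $ 2 * a1 $ 1 $ 1" "l2 = w $ 1 * a1 $ 2 $ 2 - w $ 2 * a1 $ 1 $ 2"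
  shows "B_hat a0 a1 a2 = - (lin l1 l2 * (lin (l1 * s - l2 * r) (l1 * t - l2 * s) *
     (cst (l1 * t - l2 * s) * lin r s - cst (l1 * s - l2 * r) * lin s t)))"
  unfolding l
  by (simp only: B_hat_def contract_eval form_monomial form_add form_mult form_diff form_uminus form_inject
      a2 cong: contract_weak_cong) (intro conjI; algebra)
text \<open>The first and the last summand of \<open>F_hat\<close> contain w x w; only the two
  middle ones survive.\<close>

lemma F_hat_rank_one:
  fixes a0 w :: "real ^ 2" and a1 :: "real ^ 2 ^ 2" and a2 :: "real ^ 2 ^ 2 ^ 2"
  assumes a2: "\<And>j. a2 $ j $ 1 $ 1 = w $ j * r" "\<And>j. a2 $ j $ 1 $ 2 = w $ j * s"
     "\<And>j. a2 $ j $ 2 $ 1 = w $ j * s" "\<And>j. a2 $ j $ 2 $ 2 = w $ j * t"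
  and l: "l1 = w $ 1 * a1 $ 2 $ 1 - w $ 2 * a1 $ 1 $ 1" "l2 = w $ 1 * a1 $ 2 $ 2 - w $ 2 * a1 $ 1 $ 2"
  and c: "c1 = l1 * s - l2 * r" "c2 = l1 * t - l2 * s"
  shows "F_hat a0 a1 a2 = cst 2 * (lin l1 l2 * (cst c1 * lin s t - cst c2 * lin r s)) + lin c1 c2 * lin c1 c2"
  unfolding l c
  by (simp only: F_hat_def contract_eval form_monomial form_add form_mult form_diff form_uminus form_inject
      a2 cong: contract_weak_cong) (intro conjI; algebra)

text \<open>When the quadratic form is the product l m, contracting its matrix with l gives
  \<open>al / 2\<close> times l again, so \<open>B_hat\<close> and \<open>F_hat\<close> collapse to
  powers of \<open>L\<close>. \<open>K_hat\<close> is the determinant of that matrix times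
  \<open>Y\<close>^2, and \<open>H_hat\<close> is a Jacobian of proportional forms.\<close>

lemma invariants_rank_one:
  fixes a0 w l m :: "real ^ 2" and a1 :: "real ^ 2 ^ 2" and a2 :: "real ^ 2 ^ 2 ^ 2"
  assumes a2: "\<And>j \<alpha> \<beta>. a2 $ j $ \<alpha> $ \<beta> = w $ j * ((l $ \<alpha> * m $ \<beta>
      + l $ \<beta> * m $ \<alpha>) / 2)"
  and l: "\<And>\<alpha>. l $ \<alpha> = w $ 1 * a1 $ 2 $ \<alpha> - w $ 2 * a1 $ 1 $ \<alpha>"
  defines "al \<equiv> l $ 1 * m $ 2 - l $ 2 * m $ 1"
  and "L \<equiv> lin (l $ 1) (l $ 2)" and "Y \<equiv> lin (- w $ 2) (w $ 1)" and "M \<equiv> lin (m $ 1) (m $ 2)"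
  shows "B_hat a0 a1 a2 = cst (al ^ 3 / 8) * (L * (L * L))"
    and "F_hat a0 a1 a2 = cst (3 / 4 * al ^ 2) * (L * L)"
    and "C_hat a2 = Y * (L * M)"
    and "K_hat a2 = cst (- (al ^ 2) / 4) * (Y * Y)"
    and "G_hat a2 = cst (1 / 2) * (cst (l $ 1 * w $ 1 + l $ 2 * w $ 2) * M + cst (m $ 1 * w $ 1 + m $ 2 * w $ 2) * L)"
    and "H_hat a2 = quad 0 0 0"
proof -
  let ?r = "l $ 1 * m $ 1" and ?s = "(l $ 1 * m $ 2 + l $ 2 * m $ 1) / 2" and ?t = "l $ 2 * m $ 2"
  have a2': "\<And>j. a2 $ j $ 1 $ 1 = w $ j * ?r" "\<And>j. a2 $ j $ 1 $ 2 = w $ j * ?s"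
     "\<And>j. a2 $ j $ 2 $ 1 = w $ j * ?s" "\<And>j. a2 $ j $ 2 $ 2 = w $ j * ?t"
    by (simp_all add: a2 add.commute)
  have sym: "\<And>j \<alpha> \<beta>. a2 $ j $ \<alpha> $ \<beta> = a2 $ j $ \<beta> $ \<alpha>"
    by (simp add: a2 add.commute)
  note S = form_mult form_add form_diff form_uminus form_inject
  show "B_hat a0 a1 a2 = cst (al ^ 3 / 8) * (L * (L * L))"
  proof -
    have c: "l $ 1 * ?s - l $ 2 * ?r = al * l $ 1 / 2" "l $ 1 * ?t - l $ 2 * ?s = al * l $ 2 / 2"
      by (simp_all add: al_def field_simps)
    have e: "cst (al * l $ 2 / 2) * lin ?r ?s - cst (al * l $ 1 / 2) * lin ?s ?t = - (cst (al\<^sup>2 / 4) * L)"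
      by (simp add: al_def L_def form_mult form_diff form_uminus form_inject field_simps power2_eq_square)
    have f: "lin (al * l $ 1 / 2) (al * l $ 2 / 2) = cst (al / 2) * L"
      by (simp add: L_def form_mult form_inject)
    show ?thesis
      unfolding B_hat_rank_one[OF a2' l[of 1] l[of 2]] c e f L_def
      by (simp add: form_mult form_uminus form_inject power2_eq_square power3_eq_cube)
  qed
  show "F_hat a0 a1 a2 = cst (3 / 4 * al ^ 2) * (L * L)"
  proof -
    have c: "l $ 1 * ?s - l $ 2 * ?r = al * l $ 1 / 2" "l $ 1 * ?t - l $ 2 * ?s = al * l $ 2 / 2"
      by (simp_all add: al_def field_simps)
    have e: "cst (al * l $ 1 / 2) * lin ?s ?t - cst (al * l $ 2 / 2) * lin ?r ?s = cst (al\<^sup>2 / 4) * L"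
      by (simp add: al_def L_def form_mult form_diff form_uminus form_inject field_simps power2_eq_square)
    have f: "lin (al * l $ 1 / 2) (al * l $ 2 / 2) = cst (al / 2) * L"
      by (simp add: L_def form_mult form_inject)
    show ?thesis
      unfolding F_hat_rank_one[OF a2' l[of 1] l[of 2] refl refl] c e f L_def
      by (simp add: form_mult form_add form_inject power2_eq_square)
  qed
  show "C_hat a2 = Y * (L * M)"
    unfolding C_hat_eq[OF sym] Y_def L_def M_def a2'
    apply (simp only: S)
    by (intro conjI; simp add: field_simps)
  show "K_hat a2 = cst (- (al ^ 2) / 4) * (Y * Y)"
    unfolding K_hat_eq[OF sym] Y_def L_def al_def a2'
    apply (simp only: S)
    by (intro conjI; simp add: field_simps power2_eq_square)
  show "G_hat a2 = cst (1 / 2) * (cst (l $ 1 * w $ 1 + l $ 2 * w $ 2) * M + cst (m $ 1 * w $ 1 + m $ 2 * w $ 2) * L)"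
    unfolding G_hat_eq M_def L_def a2'
    apply (simp only: S)
    by (intro conjI; simp add: field_simps)
  show "H_hat a2 = quad 0 0 0"
    unfolding H_hat_eq[OF sym] a2'
    by (simp only: S) simp
qed

text \<open>The assumptions say that the system is A (x - z) plus its quadratic part at x - z, so
  the claim is the translation invariance of \<open>D_hat\<close>. The identity \<open>ring\<close>
  states it for arbitrary \<open>S11\<close>, \<open>S12\<close>, \<open>S22\<close>,
  \<open>N1\<close>, \<open>N2\<close>.\<close>

lemma D_hat_translate:
  fixes z a0 :: "real ^ 2" and A a1 :: "real ^ 2 ^ 2" and a2 :: "real ^ 2 ^ 2 ^ 2"
  assumes sym: "\<And>j \<alpha> \<beta>. a2 $ j $ \<alpha> $ \<beta> = a2 $ j $ \<beta> $ \<alpha>"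
  and a1: "\<And>j \<alpha>. a1 $ j $ \<alpha> = A $ j $ \<alpha> - 2 * (a2 $ j $ \<alpha> $ 1 * z $ 1 + a2
      $ j $ \<alpha> $ 2 * z $ 2)"
  and a0: "\<And>j. a0 $ j = a2 $ j $ 1 $ 1 * (z $ 1)\<^sup>2 + 2 * a2 $ j $ 1 $ 2 * z $ 1 * z $ 2 + a2 $ j
      $ 2 $ 2 * (z $ 2)\<^sup>2
     - (A $ j $ 1 * z $ 1 + A $ j $ 2 * z $ 2)"
  shows "D_hat a0 a1 a2 = D_hat 0 A a2"
proof -
  have ring: "4 * ((S11 * (z1 * z1) + 2 * (S12 * (z1 * z2)) + S22 * (z2 * z2) - (N1 * z1 + N2 * z2)) * (S11
      * S22 - S12 * S12))
     - ((N1 - 2 * (S11 * z1 + S12 * z2)) * ((N1 - 2 * (S11 * z1 + S12 * z2)) * S22)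
     - 2 * ((N1 - 2 * (S11 * z1 + S12 * z2)) * ((N2 - 2 * (S12 * z1 + S22 * z2)) * S12))
     + (N2 - 2 * (S12 * z1 + S22 * z2)) * ((N2 - 2 * (S12 * z1 + S22 * z2)) * S11))
     = - (N1 * (N1 * S22) - 2 * (N1 * (N2 * S12)) + N2 * (N2 * S11))" for S11 S12 S22 N1 N2 z1 z2 :: form
    by algebra
  let ?S = "\<lambda>i k. lin (- a2 $ 2 $ i $ k) (a2 $ 1 $ i $ k)" and ?N = "\<lambda>i. lin (- A $ 2 $ i)
      (A $ 1 $ i)"
  let ?z1 = "cst (z $ 1)" and ?z2 = "cst (z $ 2)"
  have N: "lin (- a1 $ 2 $ 1) (a1 $ 1 $ 1) = ?N 1 - 2 * (?S 1 1 * ?z1 + ?S 1 2 * ?z2)"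
     "lin (- a1 $ 2 $ 2) (a1 $ 1 $ 2) = ?N 2 - 2 * (?S 1 2 * ?z1 + ?S 2 2 * ?z2)"
    by (simp_all add: a1 form_numeral form_mult form_inject form_add form_diff algebra_simps sym[of _ 2 1])
  have M: "lin (- a0 $ 2) (a0 $ 1) = ?S 1 1 * (?z1 * ?z1) + 2 * (?S 1 2 * (?z1 * ?z2)) + ?S 2 2 * (?z2 * ?z2)
      - (?N 1 * ?z1 + ?N 2 * ?z2)"
    by (simp add: a0 form_numeral form_mult form_inject form_add form_diff algebra_simps power2_eq_square)
  have cst: "cst 4 = 4" "cst 2 = 2"
    by (simp_all add: form_numeral)
  show ?thesis
    unfolding D_hat_eq[OF sym] N M cst ring
    by (simp add: form_mult form_diff form_uminus form_inject form_eq_0)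
qed

text \<open>Without constant term only the adjugate part of \<open>D_hat\<close> is left, and it
  splits along the product l m. The factor belonging to l is d \<open>Y\<close>, because l is the
  composition of u -> w x u with A.\<close>

lemma D_hat_rank_one:
  fixes w l m :: "real ^ 2" and A :: "real ^ 2 ^ 2" and a2 :: "real ^ 2 ^ 2 ^ 2"
  assumes a2: "\<And>j \<alpha> \<beta>. a2 $ j $ \<alpha> $ \<beta> = w $ j * ((l $ \<alpha> * m $ \<beta>
      + l $ \<beta> * m $ \<alpha>) / 2)"
  and l: "\<And>\<alpha>. l $ \<alpha> = w $ 1 * A $ 2 $ \<alpha> - w $ 2 * A $ 1 $ \<alpha>"
  defines "d \<equiv> A $ 1 $ 1 * A $ 2 $ 2 - A $ 1 $ 2 * A $ 2 $ 1" and "Y \<equiv> lin (- w $ 2) (w $ 1)"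
  shows "D_hat 0 A a2 = - (cst d * (Y * (Y * lin (m $ 1 * A $ 2 $ 2 - m $ 2 * A $ 2 $ 1) (m $ 2 * A $ 1 $ 1
      - m $ 1 * A $ 1 $ 2))))"
proof -
  have sym: "\<And>j \<alpha> \<beta>. a2 $ j $ \<alpha> $ \<beta> = a2 $ j $ \<beta> $ \<alpha>"
    by (simp add: a2 add.commute)
  have S: "lin (- a2 $ 2 $ i $ k) (a2 $ 1 $ i $ k) = cst ((l $ i * m $ k + l $ k * m $ i) / 2) * Y" for i k
    by (simp add: a2 Y_def form_mult form_inject)
  let ?N = "\<lambda>i. lin (- A $ 2 $ i) (A $ 1 $ i)"
  have ring: "N1 * (N1 * (l2 * m2 * Y)) - 2 * (N1 * (N2 * (h * Y))) + N2 * (N2 * (l1 * m1 * Y))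
     = Y * ((l2 * N1 - l1 * N2) * (m2 * N1 - m1 * N2))" if "2 * h = l1 * m2 + l2 * m1"
    for N1 N2 l1 l2 m1 m2 h Y :: form
    using that by algebra
  have *: "N1 * (N1 * (cst ((l $ 2 * m $ 2 + l $ 2 * m $ 2) / 2) * Y)) - cst 2 * (N1 * (N2 * (cst ((l $ 1 *
      m $ 2 + l $ 2 * m $ 1) / 2) * Y)))
      + N2 * (N2 * (cst ((l $ 1 * m $ 1 + l $ 1 * m $ 1) / 2) * Y)) =
      Y * ((cst (l $ 2) * N1 - cst (l $ 1) * N2) * (cst (m $ 2) * N1 - cst (m $ 1) * N2))" for N1 N2
  proof -
    have c: "cst ((l $ 2 * m $ 2 + l $ 2 * m $ 2) / 2) = cst (l $ 2) * cst (m $ 2)"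
      "cst ((l $ 1 * m $ 1 + l $ 1 * m $ 1) / 2) = cst (l $ 1) * cst (m $ 1)"
      by (simp_all add: form_mult form_inject)
    have "2 * cst ((l $ 1 * m $ 2 + l $ 2 * m $ 1) / 2) = cst (l $ 1) * cst (m $ 2) + cst (l $ 2) * cst (m $ 1)"
      by (simp add: form_numeral form_mult form_add form_inject)
    from ring[OF this] show ?thesis unfolding c by (simp add: form_numeral)
  qed
  have l': "cst (l $ 2) * ?N 1 - cst (l $ 1) * ?N 2 = cst d * Y"
    unfolding l d_def Y_def by (simp add: form_mult form_diff form_uminus form_inject algebra_simps)
  have m': "cst (m $ 2) * ?N 1 - cst (m $ 1) * ?N 2 =
     lin (m $ 1 * A $ 2 $ 2 - m $ 2 * A $ 2 $ 1) (m $ 2 * A $ 1 $ 1 - m $ 1 * A $ 1 $ 2)"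
    by (simp add: form_mult form_diff form_uminus form_inject algebra_simps)
  have M: "lin (- (0::real^2) $ 2) ((0::real^2) $ 1) = 0" by (simp add: form_eq_0)
  show ?thesis
    unfolding D_hat_eq[OF sym] S M * l' m' by (simp add: mult.assoc mult.left_commute)
qed

section \<open>Invariants of the rank one normal form in terms of the linear part at the singular
  point\<close>

context
  fixes a0 z w l m :: "real ^ 2" and A a1 :: "real ^ 2 ^ 2" and a2 :: "real ^ 2 ^ 2 ^ 2"
  assumes a2: "\<And>j \<alpha> \<beta>. a2 $ j $ \<alpha> $ \<beta> = w $ j * ((l $ \<alpha> * m $ \<beta>
      + l $ \<beta> * m $ \<alpha>) / 2)"
  and l: "\<And>\<alpha>. l $ \<alpha> = w $ 1 * A $ 2 $ \<alpha> - w $ 2 * A $ 1 $ \<alpha>"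
  and a1: "\<And>j \<alpha>. a1 $ j $ \<alpha> = A $ j $ \<alpha> - 2 * (a2 $ j $ \<alpha> $ 1 * z $ 1 + a2
      $ j $ \<alpha> $ 2 * z $ 2)"
  and a0: "\<And>j. a0 $ j = a2 $ j $ 1 $ 1 * (z $ 1)\<^sup>2 + 2 * a2 $ j $ 1 $ 2 * z $ 1 * z $ 2 + a2 $ j
      $ 2 $ 2 * (z $ 2)\<^sup>2
     - (A $ j $ 1 * z $ 1 + A $ j $ 2 * z $ 2)"
begin

text \<open>The columns of \<open>a1\<close> - \<open>A\<close> are multiples of w, which w x u
  annihilates.\<close>

lemma l_translate: "l $ \<alpha> = w $ 1 * a1 $ 2 $ \<alpha> - w $ 2 * a1 $ 1 $ \<alpha>"
  unfolding a1 a2 l[of \<alpha>] by algebra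

lemmas forms_rank_one = invariants_rank_one[OF a2 l_translate]

lemma D_hat_translate_rank_one: "D_hat a0 a1 a2 = - (cst (A $ 1 $ 1 * A $ 2 $ 2 - A $ 1 $ 2 * A $ 2 $ 1) *
  (lin (- w $ 2) (w $ 1) * (lin (- w $ 2) (w $ 1) * lin (m $ 1 * A $ 2 $ 2 - m $ 2 * A $ 2 $ 1) (m $ 2 * A
      $ 1 $ 1 - m $ 1 * A $ 1 $ 2))))"
proof -
  have sym: "\<And>j \<alpha> \<beta>. a2 $ j $ \<alpha> $ \<beta> = a2 $ j $ \<beta> $ \<alpha>"
    by (simp add: a2 add.commute)
  show ?thesis using D_hat_translate[OF sym a1 a0] D_hat_rank_one[OF a2 l] by simp
qed

text \<open>\<open>D_hat\<close> contains the square of the form u -> w x u. The Hessian of a cubic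
  with a double factor is a multiple of the square of that factor.\<close>

lemma D_hat_hessian: "\<exists>c. transvectant 3 3 2 (D_hat a0 a1 a2) (D_hat a0 a1 a2) =
  quad (c * (w $ 2)\<^sup>2) (- 2 * c * w $ 1 * w $ 2) (c * (w $ 1)\<^sup>2)"
proof -
  define n1 where "n1 = m $ 1 * A $ 2 $ 2 - m $ 2 * A $ 2 $ 1"
  define n2 where "n2 = m $ 2 * A $ 1 $ 1 - m $ 1 * A $ 1 $ 2"
  define d where "d = A $ 1 $ 1 * A $ 2 $ 2 - A $ 1 $ 2 * A $ 2 $ 1"
  show ?thesis
    unfolding D_hat_translate_rank_one
    unfolding n1_def[symmetric] n2_def[symmetric] d_def[symmetric]
    apply (rule exI[of _ "- 2 / 9 * (d * (n1 * w $ 1 + n2 * w $ 2))\<^sup>2"])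
    apply (simp only: form_mult form_uminus form_transvectant form_inject)
    by (intro conjI; simp add: field_simps power2_eq_square)
qed

text \<open>The third transvectant of two products of three linear forms averages the products of
  brackets over all six pairings. Here the products are Y L M and -d Y Y n. Since the bracket of Y
  with itself is zero, Y must meet n, while L and M meet the two factors Y. Two pairings remain,
  whence the factor 1/3.\<close>

lemma C3_rank_one: "C3 a0 a1 a2 = - (1 / 3) * (l $ 1 * w $ 1 + l $ 2 * w $ 2) * (m $ 1 * w $ 1 + m $ 2 * w $ 2)
   * (A $ 1 $ 1 * A $ 2 $ 2 - A $ 1 $ 2 * A $ 2 $ 1) * (l $ 1 * m $ 2 - l $ 2 * m $ 1)"
proof -
  define n1 where "n1 = m $ 1 * A $ 2 $ 2 - m $ 2 * A $ 2 $ 1"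
  define n2 where "n2 = m $ 2 * A $ 1 $ 1 - m $ 1 * A $ 1 $ 2"
  define d where "d = A $ 1 $ 1 * A $ 2 $ 2 - A $ 1 $ 2 * A $ 2 $ 1"
  have n: "l $ 1 * m $ 2 - l $ 2 * m $ 1 = - (n1 * w $ 1 + n2 * w $ 2)"
    unfolding l n1_def n2_def by algebra
  show ?thesis
    unfolding C3_def A2_def D_hat_translate_rank_one forms_rank_one n
    unfolding n1_def[symmetric] n2_def[symmetric] d_def[symmetric]
    apply (simp only: form_mult form_uminus form_transvectant scalar_cst)
    apply (simp add: field_simps)
    done
qed

text \<open>\<open>B_hat\<close> is a multiple of L^3, so the brackets are those of L with Y, Y and
  n, the factors of \<open>D_hat\<close>. For m proportional to u -> w x u the bracket of L with n
  contains the trace of \<open>A\<close>.\<close>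

lemma C10_rank_one:
  assumes m: "m $ 1 = - k * w $ 2" "m $ 2 = k * w $ 1"
  shows "C10 a0 a1 a2 = - (k ^ 4 * (l $ 1 * w $ 1 + l $ 2 * w $ 2) ^ 6 * (A $ 1 $ 1 + A $ 2 $ 2)
     * (A $ 1 $ 1 * A $ 2 $ 2 - A $ 1 $ 2 * A $ 2 $ 1)) / 8"
proof -
  define d where "d = A $ 1 $ 1 * A $ 2 $ 2 - A $ 1 $ 2 * A $ 2 $ 1"
  define lw where "lw = l $ 1 * w $ 1 + l $ 2 * w $ 2"
  define n1 where "n1 = m $ 1 * A $ 2 $ 2 - m $ 2 * A $ 2 $ 1"
  define n2 where "n2 = m $ 2 * A $ 1 $ 1 - m $ 1 * A $ 1 $ 2"
  have al: "l $ 1 * m $ 2 - l $ 2 * m $ 1 = k * lw"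
    unfolding m lw_def by algebra
  have n: "l $ 1 * n2 - l $ 2 * n1 = k * (A $ 1 $ 1 + A $ 2 $ 2) * lw"
    unfolding n1_def n2_def m lw_def l by algebra
  have "C10 a0 a1 a2 = - ((k * lw) ^ 3) / 8 * d * lw\<^sup>2 * (l $ 1 * n2 - l $ 2 * n1)"
    unfolding C10_def A26_def D_hat_translate_rank_one forms_rank_one al
    unfolding n1_def[symmetric] n2_def[symmetric] d_def[symmetric]
    apply (simp only: form_mult form_uminus form_transvectant scalar_cst)
    apply (simp add: lw_def field_simps power2_eq_square)
    done
  then show ?thesis
    unfolding n d_def[symmetric] lw_def[symmetric] by (simp add: field_simps eval_nat_numeral)
qed

text \<open>Since m is proportional to Y, so is \<open>G_hat\<close>, while \<open>K_hat\<close> and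
  the Hessian of \<open>D_hat\<close> are multiples of Y^2 and \<open>H_hat\<close> is zero. Hence
  only \<open>A18\<close> contributes; \<open>A2\<close> vanishes by the formula for
  \<open>C3\<close>.\<close>

lemma C11_rank_one:
  assumes m: "m $ 1 = - k * w $ 2" "m $ 2 = k * w $ 1"
  shows "C11 a0 a1 a2 = - (k ^ 4 * (l $ 1 * w $ 1 + l $ 2 * w $ 2) ^ 6
     * (A $ 1 $ 1 * A $ 2 $ 2 - A $ 1 $ 2 * A $ 2 $ 1)) / 4"
proof -
  define d where "d = A $ 1 $ 1 * A $ 2 $ 2 - A $ 1 $ 2 * A $ 2 $ 1"
  define lw where "lw = l $ 1 * w $ 1 + l $ 2 * w $ 2"
  define n1 where "n1 = m $ 1 * A $ 2 $ 2 - m $ 2 * A $ 2 $ 1"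
  define n2 where "n2 = m $ 2 * A $ 1 $ 1 - m $ 1 * A $ 1 $ 2"
  have al: "l $ 1 * m $ 2 - l $ 2 * m $ 1 = k * lw"
    unfolding m lw_def by algebra
  have mw: "m $ 1 * w $ 1 + m $ 2 * w $ 2 = 0"
    unfolding m by algebra
  have n: "n1 * w $ 1 + n2 * w $ 2 = - k * lw"
    unfolding n1_def n2_def m lw_def l by algebra
  have G: "G_hat a2 = lin (- w $ 2 * (k * lw / 2)) (w $ 1 * (k * lw / 2))"
    unfolding forms_rank_one mw lw_def[symmetric] m by (simp add: form_mult form_add form_inject)
  have A2: "A2 a0 a1 a2 = 0"
    using C3_rank_one mw by (simp add: C3_def)
  obtain c where D_hat_hessian: "transvectant 3 3 2 (D_hat a0 a1 a2) (D_hat a0 a1 a2) =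
      quad (c * (w $ 2)\<^sup>2) (- 2 * c * w $ 1 * w $ 2) (c * (w $ 1)\<^sup>2)"
    using D_hat_hessian by blast
  have A19: "A19 a0 a1 a2 = 0"
    unfolding A19_def D_hat_hessian forms_rank_one
    by (simp add: form_transvectant scalar_cst)
  have A17: "A17 a0 a1 a2 = 0"
    unfolding A17_def D_hat_hessian G form_transvectant scalar_cst by (simp add: field_simps power2_eq_square)
  have A21: "A21 a0 a1 a2 = 0"
    unfolding A21_def D_hat_hessian forms_rank_one form_mult form_transvectant scalar_cst by (simp add:
        field_simps power2_eq_square)
  have "A18 a0 a1 a2 = - d * (3 / 4 * (k * lw)\<^sup>2) * (k * lw / 2) * lw\<^sup>2 * (n1 * w $ 1 + n2 * w $ 2) / 3"
    unfolding A18_def G forms_rank_one al D_hat_translate_rank_one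
    unfolding n1_def[symmetric] n2_def[symmetric] d_def[symmetric]
    apply (simp only: form_mult form_uminus form_transvectant scalar_cst)
    unfolding lw_def
    apply algebra
    done
  then have A18: "A18 a0 a1 a2 = d * k ^ 4 * lw ^ 6 / 8"
    unfolding n by (simp add: field_simps eval_nat_numeral)
  show ?thesis
    unfolding C11_def A2 A17 A18 A19 A21 d_def[symmetric] lw_def[symmetric] by simp
qed

text \<open>The assumption means that w is an eigenvector of \<open>A\<close>. Now
  \<open>G_hat\<close> is a multiple of Y and \<open>F_hat\<close> of Y^2; as Y^2 divides
  \<open>D_hat\<close>, the transvectant of \<open>D_hat\<close> and \<open>F_hat\<close> is again a
  multiple of Y, and \<open>A18\<close> vanishes with the other terms.\<close>

lemma C11_rank_one_eigenvector:
  assumes l': "l $ 1 = - k * w $ 2" "l $ 2 = k * w $ 1"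
  shows "C11 a0 a1 a2 = 0"
proof -
  define d where "d = A $ 1 $ 1 * A $ 2 $ 2 - A $ 1 $ 2 * A $ 2 $ 1"
  define n1 where "n1 = m $ 1 * A $ 2 $ 2 - m $ 2 * A $ 2 $ 1"
  define n2 where "n2 = m $ 2 * A $ 1 $ 1 - m $ 1 * A $ 1 $ 2"
  define mw where "mw = m $ 1 * w $ 1 + m $ 2 * w $ 2"
  have lw: "l $ 1 * w $ 1 + l $ 2 * w $ 2 = 0"
    unfolding l' by algebra
  have G: "G_hat a2 = lin (- w $ 2 * (k * mw / 2)) (w $ 1 * (k * mw / 2))"
    unfolding forms_rank_one lw mw_def[symmetric] l' by (simp add: form_mult form_add form_inject)
  have A2: "A2 a0 a1 a2 = 0"
    using C3_rank_one lw by (simp add: C3_def)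
  obtain c where D_hat_hessian: "transvectant 3 3 2 (D_hat a0 a1 a2) (D_hat a0 a1 a2) =
      quad (c * (w $ 2)\<^sup>2) (- 2 * c * w $ 1 * w $ 2) (c * (w $ 1)\<^sup>2)"
    using D_hat_hessian by blast
  have A19: "A19 a0 a1 a2 = 0"
    unfolding A19_def D_hat_hessian forms_rank_one
    by (simp add: form_transvectant scalar_cst)
  have A17: "A17 a0 a1 a2 = 0"
    unfolding A17_def D_hat_hessian G form_transvectant scalar_cst by (simp add: field_simps power2_eq_square)
  have A21: "A21 a0 a1 a2 = 0"
    unfolding A21_def D_hat_hessian forms_rank_one form_mult form_transvectant scalar_cst by (simp add:
        field_simps power2_eq_square)
  have A18: "A18 a0 a1 a2 = 0"
    unfolding A18_def G forms_rank_one D_hat_translate_rank_one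
    unfolding n1_def[symmetric] n2_def[symmetric] d_def[symmetric] l'
    apply (simp only: form_mult form_uminus form_transvectant scalar_cst)
    apply algebra
    done
  show ?thesis
    unfolding C11_def A2 A17 A18 A19 A21 by simp
qed

end

section \<open>Quadratic parts with a common linear factor\<close>

lemma F_hat_quad: "\<exists>a b c. F_hat a0 a1 a2 = quad a b c"
  by (simp only: F_hat_def contract_eval form_monomial form_add form_mult form_diff form_uminus form_inject
     cong: contract_weak_cong) blast

definition cross :: "real ^ 2 \<Rightarrow> real ^ 2 \<Rightarrow> real" where
  "cross u v = u $ 1 * v $ 2 - u $ 2 * v $ 1"

definition linear_form :: "real ^ 2 \<Rightarrow> form" where
  "linear_form u = lin (u $ 1) (u $ 2)"

definition cross_form :: "real ^ 2 \<Rightarrow> form" where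
  "cross_form u = lin (- u $ 2) (u $ 1)"

section \<open>Comitants and invariants of the normal form with a common factor\<close>

context
  fixes a0 g h \<xi> \<eta> :: "real ^ 2" and a1 :: "real ^ 2 ^ 2" and a2 :: "real ^ 2 ^ 2 ^ 2" and a
      \<beta> \<gamma> s c :: real
  assumes a2: "\<And>j i k. a2 $ j $ i $ k = g $ j * \<xi> $ i * \<xi> $ k + h $ j * ((\<xi> $ i * \<eta> $
      k + \<xi> $ k * \<eta> $ i) / 2)"
  and a1: "\<And>j i. a1 $ j $ i = (\<beta> * g $ j + \<gamma> * h $ j) * \<xi> $ i + s * h $ j * \<eta> $ i"
  and a0: "\<And>j. a0 $ j = a * g $ j + c * h $ j"
begin

lemma common_factor_sym: "a2 $ j $ i $ k = a2 $ j $ k $ i"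
  by (simp add: a2 algebra_simps)

lemma B_forms_common_factor:
  "B1 a1 a2 = cst (- (cross \<xi> \<eta> * cross g h * (\<beta> / 2 + s))) * linear_form \<xi>"
  "B3 a2 = cst (cross \<xi> \<eta> * cross g h / 2) * (linear_form \<xi> * linear_form \<xi>)"
  "B2 a0 a1 = cst (cross g h) * (cst (a * \<gamma> - c * \<beta>) * linear_form \<xi> + cst (a * s) *
      linear_form \<eta>)"
  "B4 a0 a2 = cst (cross g h) * (linear_form \<xi> * (cst a * linear_form \<eta> - cst c * linear_form \<xi>))"
  "B5 a1 a2 = cst (cross g h) * (linear_form \<xi> * (linear_form \<xi> * (cst (- \<gamma>) * linear_form
      \<xi> + cst (\<beta> - s) * linear_form \<eta>)))"
  "J1 a1 = cross \<xi> \<eta> * cross g h * s * \<beta>"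
  unfolding B1_eq[OF common_factor_sym] B3_def H_hat_eq[OF common_factor_sym] B2_def B4_def B5_def P_eqs[OF
      common_factor_sym] J1_eq
    a2 a1 a0 linear_form_def cross_def
  by (simp_all only: form_mult form_add form_diff form_inject) ((intro conjI)?; simp add: field_simps)+

text \<open>Powers of \<xi> in the B forms make all three transvectants multiples of \<xi>^2 (facts
  1 to 3; 4 to 6 are homogeneity). The last scalar factor vanishes iff the g-component \<xi>^2 +
  \<beta> \<xi> + a of the field splits as (\<xi> + s)(\<xi> + \<beta> - s).\<close>

lemma comitant_G_common_factor: "comitant_G a0 a1 a2 = cst ((cross \<xi> \<eta>)\<^sup>2 * (cross g
    h)\<^sup>2 * (a - s * (\<beta> - s))) * (linear_form \<xi> * linear_form \<xi>)"
proof -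
  define \<xi>1 \<xi>2 \<eta>1 \<eta>2 where x: "\<xi>1 = \<xi> $ 1" "\<xi>2 = \<xi> $ 2" "\<eta>1 = \<eta>
      $ 1" "\<eta>2 = \<eta> $ 2"
  have d: "cross \<xi> \<eta> = \<xi>1 * \<eta>2 - \<xi>2 * \<eta>1" unfolding cross_def x ..
  have 1: "transvectant 1 3 1 (linear_form \<xi>) (linear_form \<xi> * (linear_form \<xi> * (cst u *
      linear_form \<xi> + cst v * linear_form \<eta>))) = cst (v * cross \<xi> \<eta> / 3) * (linear_form
          \<xi> * linear_form \<xi>)" for u v
    unfolding d linear_form_def x[symmetric] form_mult form_add form_transvectant form_inject
    by (intro conjI; simp add: field_simps)
  have 2: "transvectant 3 3 2 (linear_form \<xi> * (linear_form \<xi> * (cst u * linear_form \<xi> + cst v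
      * linear_form \<eta>))) (linear_form \<xi> * (linear_form \<xi> * (cst u * linear_form \<xi> + cst v
          * linear_form \<eta>)))
     = cst (- 2 / 9 * (v * cross \<xi> \<eta>)\<^sup>2) * (linear_form \<xi> * linear_form \<xi>)" for u v
    unfolding d linear_form_def x[symmetric] form_mult form_add form_transvectant form_inject
    by (intro conjI; simp add: field_simps power2_eq_square)
  have 3: "transvectant 2 2 1 (linear_form \<xi> * linear_form \<xi>) (linear_form \<xi> * (cst u *
      linear_form \<eta> - cst v * linear_form \<xi>)) = cst (u * cross \<xi> \<eta> / 2) * (linear_form
          \<xi> * linear_form \<xi>)" for u v
    unfolding d linear_form_def x[symmetric] form_mult form_diff form_transvectant form_inject
    by (intro conjI; simp add: field_simps)
  have 4: "transvectant 1 3 1 (cst u * lin p1 p2) (cst v * cub q1 q2 q3 q4) = cst (u * v) * transvectant 1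
      3 1 (lin p1 p2) (cub q1 q2 q3 q4)" for u v p1 p2 q1 q2 q3 q4
    unfolding form_mult form_transvectant form_inject by (intro conjI; simp add: field_simps)
  have 5: "transvectant 3 3 2 (cst u * cub p1 p2 p3 p4) (cst v * cub q1 q2 q3 q4) = cst (u * v) *
      transvectant 3 3 2 (cub p1 p2 p3 p4) (cub q1 q2 q3 q4)" for u v p1 p2 p3 p4 q1 q2 q3 q4
    unfolding form_mult form_transvectant form_inject by (intro conjI; simp add: field_simps)
  have 6: "transvectant 2 2 1 (cst u * quad p1 p2 p3) (cst v * quad q1 q2 q3) = cst (u * v) * transvectant
      2 2 1 (quad p1 p2 p3) (quad q1 q2 q3)" for u v p1 p2 p3 q1 q2 q3
    unfolding form_mult form_transvectant form_inject by (intro conjI; simp add: field_simps)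
  obtain b1 b2 b3 b4 where b: "linear_form \<xi> * (linear_form \<xi> * (cst (- \<gamma>) * linear_form
      \<xi> + cst (\<beta> - s) * linear_form \<eta>)) = cub b1 b2 b3 b4"
    unfolding linear_form_def form_mult form_add by blast
  obtain l1 l2 where l: "linear_form \<xi> = lin l1 l2" unfolding linear_form_def by blast
  obtain q1 q2 q3 where q: "linear_form \<xi> * linear_form \<xi> = quad q1 q2 q3" unfolding
      linear_form_def form_mult by blast
  obtain r1 r2 r3 where r: "linear_form \<xi> * (cst a * linear_form \<eta> - cst c * linear_form \<xi>) =
      quad r1 r2 r3" unfolding linear_form_def form_mult form_diff by blast
  have t1: "transvectant 1 3 1 (B1 a1 a2) (B5 a1 a2) = cst (- (cross \<xi> \<eta> * cross g h * (\<beta> /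
      2 + s)) * cross g h) * (cst ((\<beta> - s) * cross \<xi> \<eta> / 3) * (linear_form \<xi> * linear_form \<xi>))"
    using 1[of "- \<gamma>" "\<beta> - s"] unfolding B_forms_common_factor b unfolding l 4 by simp
  have t2: "transvectant 3 3 2 (B5 a1 a2) (B5 a1 a2) = cst (cross g h * cross g h) * (cst (- 2 / 9 *
      ((\<beta> - s) * cross \<xi> \<eta>)\<^sup>2) * (linear_form \<xi> * linear_form \<xi>))"
    using 2[of "- \<gamma>" "\<beta> - s"] unfolding B_forms_common_factor b 5 by simp
  have t3: "transvectant 2 2 1 (B3 a2) (B4 a0 a2) = cst (cross \<xi> \<eta> * cross g h / 2 * cross g h) *
      (cst (a * cross \<xi> \<eta> / 2) * (linear_form \<xi> * linear_form \<xi>))"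
    using 3[of a c] unfolding B_forms_common_factor q r 6 by simp
  show ?thesis
    unfolding comitant_G_def t1 t2 t3 q form_numeral form_mult form_add form_diff form_inject
    by (intro conjI; simp add: field_simps power2_eq_square)
qed

text \<open>Geometrically, \<beta> - 2 s separates the lines \<xi> = -s and \<xi> = s - \<beta> on
  which the g-component vanishes. On the first of them the h-component has the constant value c - s
  \<gamma>.\<close>

lemma comitant_F_common_factor:
  assumes "a = s * (\<beta> - s)"
  shows "comitant_F a0 a1 a2 = cst (cross \<xi> \<eta> * (cross g h)\<^sup>2 * (\<beta> - 2 * s) * (s *
      \<gamma> - c)) * (linear_form \<xi> * (linear_form \<xi> * linear_form \<xi>))"
  unfolding comitant_F_def B_forms_common_factor assms linear_form_def form_numeral form_mult form_add
      form_diff form_inject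
  by (intro conjI; simp add: field_simps power2_eq_square)

lemma C_hat_common_factor: "C_hat a2 = linear_form \<xi> * (linear_form \<xi> * cross_form g + linear_form
    \<eta> * cross_form h)"
  unfolding C_hat_eq[OF common_factor_sym] a2 linear_form_def cross_form_def form_mult form_add form_inject
  by (intro conjI; simp add: field_simps)

lemma D_hat_common_factor:
  assumes "a = s * (\<beta> - s)"
  shows "D_hat a0 a1 a2 = cst ((cross \<xi> \<eta>)\<^sup>2 * (s * \<gamma> - c)) * (cross_form h *
      (cross_form h * cross_form h))"
proof -
  \<comment> \<open>Half of \<open>cross_form h\<close> absorbs the division by two in the quadratic
    coefficients, so that the final identity has integer coefficients.\<close>
  define w where "w = cst (1/2) * cross_form h"
  have W: "cross_form h = 2 * w" unfolding w_def cross_form_def by (simp add: form_numeral form_mult form_inject)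
  have S: "lin (- a2 $ 2 $ i $ k) (a2 $ 1 $ i $ k) = cst (\<xi> $ i) * cst (\<xi> $ k) * cross_form g +
      (cst (\<xi> $ i) * cst (\<eta> $ k) + cst (\<xi> $ k) * cst (\<eta> $ i)) * w" for i k
    unfolding a2 cross_form_def w_def form_mult form_add form_inject by (simp add: field_simps)
  have N: "lin (- a1 $ 2 $ i) (a1 $ 1 $ i) = (cst \<beta> * cross_form g + 2 * (cst \<gamma> * w)) * cst
      (\<xi> $ i) + 2 * cst s * w * cst (\<eta> $ i)" for i
    unfolding a1 cross_form_def w_def form_numeral form_mult form_add form_inject by (simp add: field_simps)
  have M: "lin (- a0 $ 2) (a0 $ 1) = cst s * (cst \<beta> - cst s) * cross_form g + 2 * (cst c * w)"
    unfolding a0 assms cross_form_def w_def form_numeral form_mult form_add form_diff form_inject by (simp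
        add: field_simps)
  have R: "cst ((cross \<xi> \<eta>)\<^sup>2 * (s * \<gamma> - c)) = (cst (\<xi> $ 1) * cst (\<eta> $ 2) -
      cst (\<xi> $ 2) * cst (\<eta> $ 1))
    * (cst (\<xi> $ 1) * cst (\<eta> $ 2) - cst (\<xi> $ 2) * cst (\<eta> $ 1)) * (cst s * cst \<gamma> - cst c)"
    unfolding cross_def form_mult form_diff form_inject by (simp add: power2_eq_square)
  have c: "cst 4 = 4" "cst 2 = 2" by (simp_all add: form_numeral)
  show ?thesis
    unfolding D_hat_eq[OF common_factor_sym] S N M R W c by algebra
qed

lemma K_hat_common_factor: "K_hat a2 = cst (- ((cross \<xi> \<eta>)\<^sup>2) / 4) * (cross_form h * cross_form h)"
  unfolding K_hat_eq[OF common_factor_sym] a2 cross_form_def cross_def form_mult form_diff form_inject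
  by (intro conjI; simp add: field_simps power2_eq_square)

lemma G_hat_common_factor: "G_hat a2 = cst (\<xi> $ 1 * g $ 1 + \<xi> $ 2 * g $ 2 + (\<eta> $ 1 * h $ 1 +
    \<eta> $ 2 * h $ 2) / 2) * linear_form \<xi>
   + cst ((\<xi> $ 1 * h $ 1 + \<xi> $ 2 * h $ 2) / 2) * linear_form \<eta>"
  unfolding G_hat_eq a2 linear_form_def form_mult form_add form_inject by (intro conjI; simp add: field_simps)

text \<open>\<open>D_hat\<close> is a multiple of the cube of x -> h x x, and the third transvectant
  with this cube evaluates a cubic at h. In \<open>C_hat\<close> the term with \<eta> vanishes there
  because h x h = 0.\<close>

lemma C3_common_factor:
  assumes "a = s * (\<beta> - s)"
  shows "C3 a0 a1 a2 = (cross \<xi> \<eta>)\<^sup>2 * (s * \<gamma> - c) * cross g h * (\<xi> $ 1 * h $ 1 +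
      \<xi> $ 2 * h $ 2)\<^sup>2"
  unfolding C3_def A2_def C_hat_common_factor D_hat_common_factor[OF assms] linear_form_def cross_form_def
      cross_def form_mult form_add form_transvectant scalar_cst
  by (simp add: field_simps power2_eq_square)

text \<open>The Hessian of a cube is zero, which kills \<open>A17\<close>, \<open>A19\<close> and
  \<open>A21\<close>. For \<open>A18\<close>, the transvectant of \<open>D_hat\<close> and
  \<open>F_hat\<close> is a multiple of x -> h x x, and \<open>G_hat\<close> is a multiple of \<xi>;
  their bracket is a multiple of \<xi>(h) = 0.\<close>

lemma C11_common_factor:
  assumes a: "a = s * (\<beta> - s)" and h: "\<xi> $ 1 * h $ 1 + \<xi> $ 2 * h $ 2 = 0"
  shows "C11 a0 a1 a2 = 0"
proof -
  obtain k where D: "D_hat a0 a1 a2 = cst k * (cross_form h * (cross_form h * cross_form h))"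
    using D_hat_common_factor[OF a] by blast
  have DD: "transvectant 3 3 2 (D_hat a0 a1 a2) (D_hat a0 a1 a2) = quad 0 0 0"
    unfolding D cross_form_def form_mult form_transvectant form_inject by (simp add: field_simps)
  have A: "A17 a0 a1 a2 = 0" "A19 a0 a1 a2 = 0" "A21 a0 a1 a2 = 0"
    unfolding A17_def A19_def A21_def DD G_hat_eq H_hat_eq[OF common_factor_sym] K_hat_eq[OF
        common_factor_sym] form_mult form_diff form_transvectant scalar_cst
    by simp_all
  obtain u v w where F: "F_hat a0 a1 a2 = quad u v w" using F_hat_quad by blast
  obtain j where G: "G_hat a2 = cst j * linear_form \<xi>"
  proof -
    have "cst ((\<xi> $ 1 * h $ 1 + \<xi> $ 2 * h $ 2) / 2) * linear_form \<eta> = 0"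
      unfolding h by (simp add: cst_def)
    with that show ?thesis unfolding G_hat_common_factor by (metis add.right_neutral)
  qed
  have DF: "transvectant 3 2 2 (D_hat a0 a1 a2) (F_hat a0 a1 a2) = cst (k * (u * (h $ 1)\<^sup>2 + v * h $
      1 * h $ 2 + w * (h $ 2)\<^sup>2)) * cross_form h"
    unfolding D F cross_form_def form_mult form_transvectant form_inject by (simp add: field_simps power2_eq_square)
  have "A18 a0 a1 a2 = - (k * (u * (h $ 1)\<^sup>2 + v * h $ 1 * h $ 2 + w * (h $ 2)\<^sup>2)) * j * (\<xi>
      $ 1 * h $ 1 + \<xi> $ 2 * h $ 2)"
    unfolding A18_def DF G cross_form_def linear_form_def form_mult form_transvectant scalar_cst by (simp
        add: algebra_simps)
  with h have "A18 a0 a1 a2 = 0" by simp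
  moreover have "A2 a0 a1 a2 = 0" using C3_common_factor[OF a] h by (simp add: C3_def)
  ultimately show ?thesis by (simp add: C11_def A)
qed

end

section \<open>Periodic trajectories\<close>

definition trajectory :: "(real ^ 2 \<Rightarrow> real ^ 2) \<Rightarrow> (real \<Rightarrow> real ^ 2)
    \<Rightarrow> bool" where
  "trajectory f \<phi> \<longleftrightarrow> (\<forall>t. (\<phi> has_vector_derivative f (\<phi> t)) (at t))"

definition periodic :: "real \<Rightarrow> (real \<Rightarrow> 'a) \<Rightarrow> bool" where
  "periodic T \<phi> \<longleftrightarrow> T > 0 \<and> (\<forall>t. \<phi> (t + T) = \<phi> t)"

lemma periodic_compose: "periodic T \<phi> \<Longrightarrow> periodic T (\<lambda>t. g (\<phi> t))"
  by (simp add: periodic_def)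

lemma periodic_add_nat:
  assumes "periodic T \<phi>"
  shows "\<phi> (t + real n * T) = \<phi> t"
proof (induction n)
  case (Suc n)
  have "t + real (Suc n) * T = (t + real n * T) + T" by (simp add: algebra_simps)
  then have "\<phi> (t + real (Suc n) * T) = \<phi> ((t + real n * T) + T)" by (rule arg_cong)
  then show ?case using assms Suc by (simp only: periodic_def)
qed simp

lemma periodic_add_int:
  assumes "periodic T \<phi>"
  shows "\<phi> (t + of_int n * T) = \<phi> t"
proof (cases "n \<ge> 0")
  case True
  with periodic_add_nat[OF assms, of t "nat n"] show ?thesis by simp
next
  case False
  with periodic_add_nat[OF assms, of "t + of_int n * T" "nat (- n)"] show ?thesis by (simp add: algebra_simps)
qed

lemma periodic_reduce:
  assumes "periodic T \<phi>"
  obtains s where "0 \<le> s" "s < T" "\<phi> s = \<phi> t"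
proof -
  have T: "T > 0" using assms by (simp add: periodic_def)
  let ?n = "\<lfloor>t / T\<rfloor>"
  have "of_int ?n * T \<le> t" "t < (of_int ?n + 1) * T"
    using floor_divide_lower[OF T, of t] floor_divide_upper[OF T, of t] by simp_all
  then have "0 \<le> t + of_int (- ?n) * T" "t + of_int (- ?n) * T < T"
    by (simp_all add: algebra_simps)
  with periodic_add_int[OF assms, of t "- ?n"] that show thesis by blast
qed

lemma periodic_attains_sup:
  fixes h :: "real \<Rightarrow> real"
  assumes "periodic T h" and "continuous_on UNIV h"
  obtains t where "\<And>s. h s \<le> h t"
proof -
  have "compact {0..T}" "{0..T} \<noteq> {}" "continuous_on {0..T} h"
    using assms by (auto simp: periodic_def intro: continuous_on_subset)
  from continuous_attains_sup[OF this] obtain t where t: "\<And>s. s \<in> {0..T} \<Longrightarrow> h s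
      \<le> h t" by blast
  have "h s \<le> h t" for s
  proof -
    obtain s' where "0 \<le> s'" "s' < T" "h s' = h s" using periodic_reduce[OF assms(1)] by metis
    with t[of s'] show ?thesis by simp
  qed
  with that show thesis by blast
qed

text \<open>The last conclusion is the second derivative test: a positive derivative of
  \<open>h'\<close> at the maximum would make \<open>h\<close> increase just to the right of it. The
  results excluding a center by an extremum rest on this lemma and its mirror image.\<close>

lemma periodic_max:
  fixes h h' :: "real \<Rightarrow> real"
  assumes "periodic T h" and h: "\<And>t. (h has_real_derivative h' t) (at t)"
  obtains t where "\<And>s. h s \<le> h t" "h' t = 0" "\<And>d. (h' has_real_derivative d) (at t)
      \<Longrightarrow> d \<le> 0"
proof -
  have "continuous_on UNIV h"
    using h by (meson DERIV_isCont continuous_at_imp_continuous_on)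
  then obtain t where t: "\<And>s. h s \<le> h t" using periodic_attains_sup[OF assms(1)] by blast
  have 0: "h' t = 0"
    using DERIV_local_max[OF h[of t], of 1] t by simp
  have "d \<le> 0" if d: "(h' has_real_derivative d) (at t)" for d
  proof (rule ccontr)
    assume "\<not> d \<le> 0"
    then obtain e where e: "e > 0" "\<And>k. 0 < k \<Longrightarrow> k < e \<Longrightarrow> h' t < h' (t + k)"
      using DERIV_pos_inc_right[OF d] by auto
    have "h t < h (t + e / 2)"
    proof (rule DERIV_pos_imp_increasing_open[of t "t + e / 2" h])
      show "t < t + e / 2" using e by simp
    next
      fix x assume x: "t < x" "x < t + e / 2"
    show "\<exists>y. (h has_real_derivative y) (at x) \<and> 0 < y"
        using e(2)[of "x - t"] x e(1) 0 h[of x] by auto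
    next
      show "continuous_on {t..t + e / 2} h"
        using \<open>continuous_on UNIV h\<close> by (rule continuous_on_subset) simp
    qed
    with t show False by (meson not_less)
  qed
  with t 0 that show thesis by blast
qed

lemma periodic_min:
  fixes h h' :: "real \<Rightarrow> real"
  assumes "periodic T h" and h: "\<And>t. (h has_real_derivative h' t) (at t)"
  obtains t where "\<And>s. h t \<le> h s" "h' t = 0" "\<And>d. (h' has_real_derivative d) (at t)
      \<Longrightarrow> 0 \<le> d"
proof -
  have "((\<lambda>t. - h t) has_real_derivative - h' t) (at t)" for t
    using h by (intro derivative_intros)
  then obtain t where t: "\<And>s. - h s \<le> - h t" "- h' t = 0" "\<And>d. ((\<lambda>t. - h' t)
      has_real_derivative d) (at t) \<Longrightarrow> d \<le> 0"
    using periodic_max[of T "\<lambda>t. - h t" "\<lambda>t. - h' t"] periodic_compose[OF assms(1), of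
        uminus] by blast
  have "0 \<le> d" if "(h' has_real_derivative d) (at t)" for d
    using t(3)[OF DERIV_minus[OF that]] by simp
  with t show thesis by (intro that[of t]) auto
qed

text \<open>To refute a center, only the periodicity of the nearby trajectories is needed. A time
  shift puts the prescribed point at time 0.\<close>

lemma is_center_trajectory:
  assumes "is_center f z"
  obtains e where "e > 0"
    "\<And>p. p \<noteq> z \<Longrightarrow> dist p z < e \<Longrightarrow> \<exists>\<phi> T. trajectory f
        \<phi> \<and> periodic T \<phi> \<and> \<phi> 0 = p"
proof -
  from assms obtain U where U: "open U" "z \<in> U" "\<And>p. p \<in> U - {z} \<Longrightarrow> \<exists>S.
      closed_orbit f S \<and> p \<in> S"
    unfolding is_center_def by blast
  then obtain e where e: "e > 0" "\<And>p. dist p z < e \<Longrightarrow> p \<in> U" unfolding open_dist by blast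
  have "\<exists>\<phi> T. trajectory f \<phi> \<and> periodic T \<phi> \<and> \<phi> 0 = p" if p: "p
      \<noteq> z" "dist p z < e" for p
  proof -
    from U(3)[of p] e(2) p obtain S where "closed_orbit f S" "p \<in> S" by blast
    then obtain \<phi> T s where \<phi>: "\<And>t. (\<phi> has_vector_derivative f (\<phi> t)) (at t)" "T >
        0" "\<And>t. \<phi> (t + T) = \<phi> t" "p = \<phi> s"
      unfolding closed_orbit_def by blast
    have "((\<lambda>t. \<phi> (t + s)) has_vector_derivative f (\<phi> (t + s))) (at t)" for t
    proof -
      have "((\<lambda>t. t + s) has_vector_derivative 1) (at t)"
        unfolding has_real_derivative_iff_has_vector_derivative[symmetric] by (auto intro!: derivative_eq_intros)
      from vector_diff_chain_at[OF this \<phi>(1)] show ?thesis by (simp add: o_def)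
    qed
    moreover have "\<phi> (t + T + s) = \<phi> (t + s)" for t
      using \<phi>(3)[of "t + s"] by (simp add: algebra_simps)
    ultimately show ?thesis
      using \<phi> by (intro exI[of _ "\<lambda>t. \<phi> (t + s)"] exI[of _ T]) (simp add: trajectory_def
          periodic_def)
  qed
  with e(1) that show thesis by blast
qed

text \<open>A trajectory starting close enough to \<open>z\<close>, followed in the direction in
  which \<open>V\<close> decreases, cannot reach the sphere of radius \<open>r\<close>, where
  \<open>V\<close> is bounded below by \<open>V q\<close>. So \<open>V\<close> is monotone along it,
  hence constant by periodicity, and its derivative \<open>W\<close> vanishes.\<close>

lemma is_center_lyapunov:
  fixes V W :: "real ^ 2 \<Rightarrow> real"
  assumes "is_center f z" and "r > 0" and V: "continuous_on UNIV V" "V z = 0"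
    and pos: "\<And>x. x \<noteq> z \<Longrightarrow> dist x z \<le> r \<Longrightarrow> V x > 0"
    and W: "\<And>\<phi> t. trajectory f \<phi> \<Longrightarrow> ((\<lambda>t. V (\<phi> t))
        has_real_derivative W (\<phi> t)) (at t)"
    and sgn: "\<sigma> \<noteq> 0" "\<And>x. dist x z \<le> r \<Longrightarrow> \<sigma> * W x \<ge> 0"
  obtains \<phi> where "trajectory f \<phi>" "\<phi> 0 \<noteq> z" "\<And>t. dist (\<phi> t) z < r"
      "\<And>t. W (\<phi> t) = 0"
proof -
  obtain e where e: "e > 0" "\<And>p. p \<noteq> z \<Longrightarrow> dist p z < e \<Longrightarrow>
      \<exists>\<phi> T. trajectory f \<phi> \<and> periodic T \<phi> \<and> \<phi> 0 = p"
    using is_center_trajectory[OF assms(1)] by blast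
  have "compact (sphere z r)" "sphere z r \<noteq> {}" "continuous_on (sphere z r) V"
    using \<open>r > 0\<close> V by (auto intro: continuous_on_subset)
  from continuous_attains_inf[OF this] obtain q where q: "q \<in> sphere z r" "\<And>x. x \<in> sphere z r
      \<Longrightarrow> V q \<le> V x" by blast
  then have "V q > 0" using pos[of q] \<open>r > 0\<close> by (auto simp: dist_commute)
  have "open {x. V x < V q}" by (intro open_Collect_less V continuous_intros)
  moreover have "z \<in> {x. V x < V q}" using \<open>V q > 0\<close> V(2) by simp
  ultimately obtain d where d: "d > 0" "\<And>x. dist x z < d \<Longrightarrow> V x < V q"
    unfolding open_dist by blast
  define b where "b = min (min d e) r / 2"
  have b: "b > 0" "b < d" "b < e" "b < r" using d(1) e(1) \<open>r > 0\<close> by (auto simp: b_def)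
  obtain p where p: "dist p z = b" using vector_choose_dist[of b z] b by (metis dist_commute less_imp_le)
  then have "p \<noteq> z" using b by auto
  then obtain \<phi> T where \<phi>: "trajectory f \<phi>" "periodic T \<phi>" "\<phi> 0 = p" using e(2)[of
      p] p b by auto
  \<comment> \<open>Time is reversed when \<sigma> > 0, so that \<open>V\<close> never increases
    along \<psi> inside the ball.\<close>
  define \<psi> where "\<psi> t = \<phi> (- sgn \<sigma> * t)" for t
  have s: "sgn \<sigma> = 1 \<or> sgn \<sigma> = - 1" using sgn(1) by (auto simp: sgn_if)
  have cont: "continuous_on UNIV \<phi>"
    using \<phi>(1) unfolding trajectory_def
    by (auto intro!: continuous_at_imp_continuous_on has_vector_derivative_continuous)
  have d\<psi>: "((\<lambda>t. V (\<psi> t)) has_real_derivative - (sgn \<sigma> * W (\<psi> t))) (at t)" for t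
    unfolding \<psi>_def
    by (rule DERIV_cong[OF DERIV_chain2[where f = "\<lambda>t. V (\<phi> t)" and g = "\<lambda>t. - sgn
        \<sigma> * t" and Db = "- sgn \<sigma>", OF W[OF \<phi>(1)]]])
       (auto intro!: derivative_eq_intros)
  have neg: "- (sgn \<sigma> * W x) \<le> 0" if "dist x z \<le> r" for x
    using sgn(2)[OF that] sgn(1) by (auto simp: sgn_if zero_le_mult_iff split: if_splits)
  have \<psi>0: "\<psi> 0 = p" by (simp add: \<psi>_def \<phi>)
  have cont\<psi>: "continuous_on UNIV \<psi>"
    unfolding \<psi>_def by (intro continuous_on_compose2[OF cont] continuous_intros) auto
  have per: "periodic T \<psi>"
    using s
  proof
    assume "sgn \<sigma> = - 1"
    then show ?thesis using \<phi>(2) by (simp add: \<psi>_def periodic_def)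
  next
    assume 1: "sgn \<sigma> = 1"
    have "\<phi> (- t - T) = \<phi> (- t)" for t
      using \<phi>(2) unfolding periodic_def by (metis diff_add_cancel)
    with 1 \<phi>(2) show ?thesis by (simp add: \<psi>_def periodic_def)
  qed
  have dec: "V (\<psi> t) \<le> V (\<psi> t')" if "0 \<le> t'" "t' \<le> t" "\<And>u. 0 \<le> u
      \<Longrightarrow> u \<le> t \<Longrightarrow> dist (\<psi> u) z \<le> r" for t t'
    using that(2)
  proof (rule DERIV_nonpos_imp_nonincreasing)
    show "\<exists>y. ((\<lambda>t. V (\<psi> t)) has_real_derivative y) (at x) \<and> y \<le> 0" if "t'
        \<le> x" "x \<le> t" for x
      using d\<psi>[of x] neg[of "\<psi> x"] that \<open>0 \<le> t'\<close> \<open>\<And>u. 0 \<le> u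
          \<Longrightarrow> u \<le> t \<Longrightarrow> dist (\<psi> u) z \<le> r\<close> by auto
  qed
  have trap: "dist (\<psi> t) z < r" if "t \<ge> 0" for t
  proof (rule ccontr)
    assume "\<not> dist (\<psi> t) z < r"
    define S where "S = {u \<in> {0..t}. dist (\<psi> u) z \<ge> r}"
    have "closed S"
    proof -
      have "S = {0..t} \<inter> (\<lambda>u. dist (\<psi> u) z) -` {r..}" by (auto simp: S_def)
      moreover have "continuous_on {0..t} (\<lambda>u. dist (\<psi> u) z)"
        by (intro continuous_intros continuous_on_subset[OF cont\<psi>]) simp
      ultimately show ?thesis by (simp add: continuous_closed_preimage)
    qed
    have ne: "S \<noteq> {}" "bdd_below S" using \<open>t \<ge> 0\<close> \<open>\<not> dist (\<psi> t) z <
        r\<close> by (auto simp: S_def)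
    define u where "u = Inf S"
    have u: "u \<in> S" unfolding u_def by (rule closed_contains_Inf[OF ne \<open>closed S\<close>])
    then have u0: "0 \<le> u" "u \<le> t" "dist (\<psi> u) z \<ge> r" by (auto simp: S_def)
    have less: "dist (\<psi> v) z < r" if "0 \<le> v" "v < u" for v
    proof (rule ccontr)
      assume "\<not> dist (\<psi> v) z < r"
      then have "v \<in> S" using that u0 by (auto simp: S_def)
      then have "u \<le> v" unfolding u_def using ne(2) by (rule cInf_lower)
      with that show False by simp
    qed
    have "u \<noteq> 0" using u0 \<psi>0 p b by auto
    then have "u > 0" using u0 by simp
    have "dist (\<psi> u) z \<le> r"
    proof (rule tendsto_upperbound)
      show "((\<lambda>v. dist (\<psi> v) z) \<longlongrightarrow> dist (\<psi> u) z) (at_left u)"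
      proof (intro tendsto_intros)
        have "isCont \<psi> u" using cont\<psi> by (simp add: continuous_on_eq_continuous_at)
        then show "(\<psi> \<longlongrightarrow> \<psi> u) (at_left u)"
          unfolding isCont_def by (rule tendsto_within_subset) simp
      qed
    next
      show "\<forall>\<^sub>F v in at_left u. dist (\<psi> v) z \<le> r"
        using \<open>u > 0\<close> less by (auto simp: eventually_at_left intro!: exI[of _ 0] less_imp_le)
    qed simp
    with u0 have "dist (\<psi> u) z = r" by simp
    then have "V q \<le> V (\<psi> u)" using q(2) by (simp add: dist_commute)
    moreover have "V (\<psi> u) \<le> V (\<psi> 0)"
      using dec[of 0 u] u0 less \<open>dist (\<psi> u) z = r\<close> by (metis less_eq_real_def order_refl)
    moreover have "V (\<psi> 0) < V q" using d(2)[of p] p b \<psi>0 by simp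
    ultimately show False by simp
  qed
  \<comment> \<open>Periodicity carries the bound over to negative times.\<close>
  have trap': "dist (\<psi> t) z < r" for t
  proof -
    obtain s where "0 \<le> s" "\<psi> s = \<psi> t" using periodic_reduce[OF per] by metis
    with trap show ?thesis by metis
  qed
  have const: "V (\<psi> t) = V (\<psi> 0)" for t
  proof -
    obtain s where s: "0 \<le> s" "s < T" "\<psi> s = \<psi> t" using periodic_reduce[OF per] by metis
    have "V (\<psi> s) \<le> V (\<psi> 0)" using dec[of 0 s] s trap' by (auto intro: less_imp_le)
    moreover have "V (\<psi> T) \<le> V (\<psi> s)" using dec[of s T] s trap' by (auto intro: less_imp_le)
    moreover have "\<psi> T = \<psi> 0" using per by (metis add_0 periodic_def)
    ultimately show ?thesis using s by simp
  qed
  have "W (\<psi> t) = 0" for t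
  proof -
    have "((\<lambda>t. V (\<psi> t)) has_real_derivative 0) (at t)"
    proof -
      have "(\<lambda>t. V (\<psi> t)) = (\<lambda>_. V (\<psi> 0))" by (rule ext) (rule const)
      then show ?thesis by (simp only: DERIV_const)
    qed
    then have "- (sgn \<sigma> * W (\<psi> t)) = 0" using d\<psi> DERIV_unique by blast
    then show ?thesis using s by auto
  qed
  then have "W (\<phi> t) = 0" for t
    using s unfolding \<psi>_def by (metis minus_minus mult_1 mult_minus1)
  moreover have "dist (\<phi> t) z < r" for t
    using s trap' unfolding \<psi>_def by (metis minus_minus mult_1 mult_minus1)
  moreover have "\<phi> 0 \<noteq> z" using \<phi>(3) \<open>p \<noteq> z\<close> by simp
  ultimately show thesis using that \<phi>(1) by blast
qed

section \<open>Criteria for a center\<close>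

lemma antiderivative_real:
  fixes f :: "real \<Rightarrow> real"
  assumes "continuous_on UNIV f"
  obtains F where "F 0 = 0" "\<And>x. (F has_real_derivative f x) (at x)"
proof -
  define F where "F u = (LBINT y=ereal 0..ereal u. f y)" for u
  have "(F has_real_derivative f x) (at x)" for x
  proof -
    define a b where "a = - \<bar>x\<bar> - 1" and "b = \<bar>x\<bar> + 1"
    have "(F has_vector_derivative f x) (at x within {a..b})"
      unfolding F_def
      by (rule interval_integral_FTC2)
         (use assms in \<open>auto simp: a_def b_def intro: continuous_on_subset\<close>)
    then have "(F has_vector_derivative f x) (at x)"
      by (subst (asm) at_within_Icc_at) (auto simp: a_def b_def)
    then show ?thesis by (simp add: has_real_derivative_iff_has_vector_derivative)
  qed
  moreover have "F 0 = 0" by (simp add: F_def)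
  ultimately show thesis using that by blast
qed

text \<open>\<open>F\<close> need not be onto, so \<open>G\<close> is controlled only on its range.
  The intermediate value theorem between x - 1 and x + 1 gives a neighbourhood of \<open>F x\<close>
  on which \<open>F\<close> inverts \<open>G\<close>.\<close>

lemma strict_mono_inverse:
  fixes F :: "real \<Rightarrow> real"
  assumes F: "\<And>x. (F has_real_derivative f x) (at x)" and f: "\<And>x. f x > 0"
  obtains G where "\<And>x. G (F x) = x" "\<And>x. (G has_real_derivative 1 / f x) (at (F x))"
    "strict_mono F"
proof -
  have mono: "F x < F y" if "x < y" for x y
    using that
    by (rule DERIV_pos_imp_increasing) (use F f in blast)
  have inj: "inj F" using mono by (metis injI linorder_neqE_linordered_idom order_less_irrefl)
  define G where "G = inv F"
  have G: "G (F x) = x" for x by (simp add: G_def inj)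
  have isCont: "isCont F x" for x using F by (rule DERIV_isCont)
  have "(G has_real_derivative 1 / f x) (at (F x))" for x
  proof -
    have contG: "isCont G (F x)"
      by (rule isCont_inverse_function[where d = 1]) (use G isCont in auto)
    have FG: "F (G y) = y" if "F (x - 1) < y" "y < F (x + 1)" for y
    proof -
      have "\<exists>u\<ge>x - 1. u \<le> x + 1 \<and> F u = y"
        by (rule IVT) (use that isCont in auto)
      with G show ?thesis by metis
    qed
    have "(G has_real_derivative inverse (f x)) (at (F x))"
      by (rule DERIV_inverse_function[where f = F and a = "F (x - 1)" and b = "F (x + 1)"])
         (use F[of x] f[of x] mono FG contG G in auto)
    then show ?thesis by (simp add: inverse_eq_divide)
  qed
  with G mono that show thesis by (metis strict_monoI)
qed

text \<open>This is a potential energy with its minimum at 0: its derivative has the sign of u. It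
  supplies the positive definite summands of first integrals and Lyapunov functions.\<close>

lemma weighted_primitive:
  fixes w :: "real \<Rightarrow> real"
  assumes cont: "continuous_on UNIV w" and pos: "\<And>u. w u > 0"
  obtains G where "G 0 = 0" "\<And>u. (G has_real_derivative u * w u) (at u)" "\<And>u. u \<noteq> 0
      \<Longrightarrow> G u > 0"
    "continuous_on UNIV G"
proof -
  have "continuous_on UNIV (\<lambda>u. u * w u)" using cont by (intro continuous_intros)
  then obtain G where G: "G 0 = 0" "\<And>u. (G has_real_derivative u * w u) (at u)"
    using antiderivative_real by blast
  have contG: "continuous_on UNIV G"
    using G(2) by (meson DERIV_isCont continuous_at_imp_continuous_on)
  have "G u > 0" if "u \<noteq> 0" for u
  proof (cases "u > 0")
    case True
    have "G 0 < G u"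
      by (rule DERIV_pos_imp_increasing_open[OF True])
         (use G(2) pos contG in \<open>auto intro: continuous_on_subset mult_pos_pos\<close>)
    with G(1) show ?thesis by simp
  next
    case False
    with that have u: "u < 0" by simp
    have "G u > G 0"
      by (rule DERIV_neg_imp_decreasing_open[OF u])
         (use G(2) pos contG in \<open>auto intro: continuous_on_subset mult_neg_pos\<close>)
    with G(1) show ?thesis by simp
  qed
  with G contG that show thesis by blast
qed

text \<open>\<open>\<eta>\<close> is the local inverse of \<open>\<rho> u = sgn u * sqrt (2 * G u)\<close>, where \<open>G\<close> is the primitive of
  \<open>u * w u\<close>: in the coordinate \<open>\<rho>\<close> the level curves of \<open>G u +
      v\<^sup>2 / 2\<close> are circles. Writing
  \<open>\<rho> u = u * k u\<close> avoids a case distinction at \<open>u = 0\<close>.\<close>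

lemma signed_sqrt_coordinate:
  fixes w :: "real \<Rightarrow> real"
  assumes cont: "continuous_on UNIV w" and pos: "\<And>u. w u > 0" and "e > 0"
  obtains R \<eta> \<kappa> where "R > 0" "\<eta> 0 = 0" "inj_on \<eta> {-R<..<R}"
    "\<And>a. \<bar>a\<bar> < R \<Longrightarrow> \<bar>\<eta> a\<bar> < e" "\<And>a. \<bar>a\<bar> < R
        \<Longrightarrow> \<eta> a = \<kappa> a * a" "\<And>a. \<bar>a\<bar> < R \<Longrightarrow> \<kappa> a > 0"
    "\<And>a. \<bar>a\<bar> < R \<Longrightarrow> isCont \<kappa> a"
    "\<And>a. \<bar>a\<bar> < R \<Longrightarrow> (\<eta> has_real_derivative 1 / (\<kappa> a * w (\<eta> a))) (at a)"
proof -
  obtain G where G: "G 0 = 0" "\<And>u. (G has_real_derivative u * w u) (at u)"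
    and Gpos: "\<And>u. u \<noteq> 0 \<Longrightarrow> G u > 0" and contG: "continuous_on UNIV G"
    using weighted_primitive[OF cont pos] by blast
  define k where "k u = (if u = 0 then sqrt (w 0) else sqrt (2 * G u / u\<^sup>2))" for u
  have kpos: "k u > 0" for u using pos[of 0] Gpos[of u] by (auto simp: k_def)
  \<comment> \<open>L'Hopital compares G u with w 0 u^2 / 2, which gives the value of
    \<open>k\<close> at 0.\<close>
  have k0: "(\<lambda>u. 2 * G u / u\<^sup>2) \<midarrow>0\<rightarrow> w 0"
  proof (rule lhopital[where f' = "\<lambda>u. 2 * (u * w u)" and g' = "\<lambda>u. 2 * u"])
    show "(\<lambda>u. 2 * G u) \<midarrow>0\<rightarrow> 0"
      using contG G(1) by (auto intro!: tendsto_eq_intros simp: continuous_on_eq_continuous_at isCont_def)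
    show "(\<lambda>u::real. u\<^sup>2) \<midarrow>0\<rightarrow> 0" by (auto intro!: tendsto_eq_intros)
    show "\<forall>\<^sub>F u in at (0::real). u\<^sup>2 \<noteq> 0" by (auto simp: eventually_at intro!: exI[of _ 1])
    show "\<forall>\<^sub>F u in at (0::real). 2 * u \<noteq> 0" by (auto simp: eventually_at intro!: exI[of _ 1])
    show "\<forall>\<^sub>F u in at 0. ((\<lambda>u. 2 * G u) has_real_derivative 2 * (u * w u)) (at u)"
      by (intro always_eventually allI DERIV_cmult G(2))
    show "\<forall>\<^sub>F u in at 0. ((\<lambda>u. u\<^sup>2) has_real_derivative 2 * u) (at (u::real))"
      by (intro always_eventually allI) (auto intro!: derivative_eq_intros)
    have "(\<lambda>u. w u) \<midarrow>0\<rightarrow> w 0"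
      using cont by (simp add: continuous_on_eq_continuous_at isCont_def)
    moreover have "\<forall>\<^sub>F u in at 0. w u = 2 * (u * w u) / (2 * u)"
      by (auto simp: eventually_at intro!: exI[of _ 1])
    ultimately show "(\<lambda>u. 2 * (u * w u) / (2 * u)) \<midarrow>0\<rightarrow> w 0"
      by (rule Lim_transform_eventually)
  qed
  have contk: "isCont k u" for u
  proof (cases "u = 0")
    case True
    have "(\<lambda>u. sqrt (2 * G u / u\<^sup>2)) \<midarrow>0\<rightarrow> sqrt (w 0)" using k0 by (rule
        tendsto_real_sqrt)
    moreover have "\<forall>\<^sub>F u in at 0. sqrt (2 * G u / u\<^sup>2) = k u"
      by (auto simp: eventually_at k_def intro!: exI[of _ 1])
    ultimately have "k \<midarrow>0\<rightarrow> sqrt (w 0)" by (rule Lim_transform_eventually)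
    with True show ?thesis by (simp add: isCont_def k_def)
  next
    case False
    have "isCont (\<lambda>u. sqrt (2 * G u / u\<^sup>2)) u"
      using False contG by (intro continuous_intros) (auto simp: continuous_on_eq_continuous_at)
    moreover have "\<forall>\<^sub>F v in nhds u. k v = sqrt (2 * G v / v\<^sup>2)"
      by (rule eventually_mono[OF t1_space_nhds[OF False]]) (simp add: k_def)
    ultimately show ?thesis by (simp only: isCont_cong)
  qed
  define \<rho> where "\<rho> u = u * k u" for u
  have d\<rho>: "(\<rho> has_real_derivative w u / k u) (at u)" for u
  proof (cases "u = 0")
    case True
    have "(\<lambda>h. (\<rho> (0 + h) - \<rho> 0) / h) \<midarrow>0\<rightarrow> k 0"
    proof (rule Lim_transform_eventually)
      show "k \<midarrow>0\<rightarrow> k 0" using contk[of 0] by (simp add: isCont_def)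
      show "\<forall>\<^sub>F h in at 0. k h = (\<rho> (0 + h) - \<rho> 0) / h"
        by (auto simp: eventually_at \<rho>_def intro!: exI[of _ 1])
    qed
    moreover have "w 0 / k 0 = k 0"
      using pos[of 0] by (simp add: k_def real_div_sqrt)
    ultimately show ?thesis using True by (simp add: DERIV_def)
  next
    case False
    have kk: "k u = sqrt (2 * G u / u\<^sup>2)" using False by (simp add: k_def)
    have q: "2 * G u / u\<^sup>2 > 0" using Gpos[OF False] False by simp
    have "((\<lambda>u. u * sqrt (2 * G u / u\<^sup>2)) has_real_derivative w u / k u) (at u)"
    proof -
      have d1: "((\<lambda>u. 2 * G u / u\<^sup>2) has_real_derivative (2 * (u * w u) * u\<^sup>2 - 2 * G u
          * (2 * u)) / (u\<^sup>2 * u\<^sup>2)) (at u)"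
        using False by (auto intro!: derivative_eq_intros G(2))
      have d2: "((\<lambda>u. sqrt (2 * G u / u\<^sup>2)) has_real_derivative
         (2 * (u * w u) * u\<^sup>2 - 2 * G u * (2 * u)) / (u\<^sup>2 * u\<^sup>2) * (inverse (sqrt (2 * G
             u / u\<^sup>2)) / 2)) (at u)"
        using DERIV_chain2[OF DERIV_real_sqrt[OF q] d1] by (simp add: mult.commute)
      have k2: "k u * k u = 2 * G u / u\<^sup>2" unfolding kk using q by (simp only: real_sqrt_mult_self abs_of_pos)
      have "k u + u * ((2 * (u * w u) * u\<^sup>2 - 2 * G u * (2 * u)) / (u\<^sup>2 * u\<^sup>2) * (inverse
          (k u) / 2)) = w u / k u"
      proof -
        have Gk: "G u = k u * k u * u\<^sup>2 / 2" using k2 False by (simp add: field_simps)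
        show ?thesis unfolding Gk using kpos[of u] False by (simp add: field_simps power2_eq_square)
      qed
      with DERIV_mult[OF DERIV_ident d2] show ?thesis
        unfolding kk by (simp add: mult.commute add.commute)
    qed
    moreover have "\<forall>\<^sub>F v in nhds u. \<rho> v = v * sqrt (2 * G v / v\<^sup>2)"
      by (rule eventually_mono[OF t1_space_nhds[OF False]]) (simp add: \<rho>_def k_def)
    ultimately show ?thesis by (subst DERIV_cong_ev[OF refl _ refl]) auto
  qed
  have "w u / k u > 0" for u using pos kpos by simp
  then obtain \<eta> where \<eta>: "\<And>x. \<eta> (\<rho> x) = x" "\<And>x. (\<eta> has_real_derivative 1
      / (w x / k x)) (at (\<rho> x))" "strict_mono \<rho>"
    using strict_mono_inverse[OF d\<rho>] by blast
  have \<rho>0: "\<rho> 0 = 0" by (simp add: \<rho>_def)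
  \<comment> \<open>Every a with |a| < R lies between the values of \<rho> at -e/2 and e/2, so it is
    attained at some u with |u| < e.\<close>
  define R where "R = min (\<rho> (e / 2)) (- \<rho> (- e / 2))"
  have "R > 0" using \<eta>(3) \<open>e > 0\<close> \<rho>0 unfolding R_def strict_mono_def
    by (metis divide_pos_pos min_less_iff_conj neg_0_less_iff_less zero_less_numeral divide_less_0_iff
        neg_less_0_iff_less not_numeral_less_zero)
  have surj: "\<exists>u. \<bar>u\<bar> < e \<and> \<rho> u = a" if "\<bar>a\<bar> < R" for a
  proof -
    have "\<exists>u\<ge>- e / 2. u \<le> e / 2 \<and> \<rho> u = a"
    proof (rule IVT)
      show "\<rho> (- e / 2) \<le> a" "a \<le> \<rho> (e / 2)" using that by (auto simp: R_def)
    qed (use \<open>e > 0\<close> d\<rho> in \<open>auto intro: DERIV_isCont\<close>)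
    then obtain u where "u \<ge> - e / 2" "u \<le> e / 2" "\<rho> u = a" by blast
    with \<open>e > 0\<close> show ?thesis by (intro exI[of _ u]) auto
  qed
  show thesis
  proof (rule that[of R \<eta> "\<lambda>a. 1 / k (\<eta> a)"])
    show "R > 0" by fact
    show "\<eta> 0 = 0" using \<eta>(1)[of 0] \<rho>0 by simp
    show "inj_on \<eta> {-R<..<R}"
      using surj \<eta>(1) by (intro inj_onI) (metis abs_less_iff greaterThanLessThan_iff minus_less_iff)
    fix a assume "\<bar>a\<bar> < R"
    then obtain u where u: "\<bar>u\<bar> < e" "\<rho> u = a" using surj by blast
    then have \<eta>u: "\<eta> a = u" using \<eta>(1) by blast
    show "\<bar>\<eta> a\<bar> < e" using u \<eta>u by simp
    show "\<eta> a = 1 / k (\<eta> a) * a" using u \<eta>u kpos[of u] by (auto simp: \<rho>_def)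
    show "1 / k (\<eta> a) > 0" using kpos by simp
    show "(\<eta> has_real_derivative 1 / (1 / k (\<eta> a) * w (\<eta> a))) (at a)"
      using \<eta>(2)[of u] u \<eta>u by simp
    then have "isCont \<eta> a" by (rule DERIV_isCont)
    then show "isCont (\<lambda>a. 1 / k (\<eta> a)) a"
      using kpos[of "\<eta> a"] isCont_o2[OF _ contk] by (intro continuous_intros) auto
  qed
qed
text \<open>The primitive \<tau> of the speed \<open>l\<close> is the true time along the curve.
  Composing \<gamma> with its inverse \<sigma> gives a solution of period
  \<open>\<tau> P\<close>.\<close>

lemma closed_orbit_reparametrize:
  fixes \<gamma> :: "real \<Rightarrow> real ^ 2"
  assumes \<gamma>: "\<And>\<theta>. (\<gamma> has_vector_derivative l \<theta> *\<^sub>R f (\<gamma>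
      \<theta>)) (at \<theta>)"
    and l: "continuous_on UNIV l" "\<And>\<theta>. l \<theta> > 0"
    and per: "periodic P \<gamma>" "periodic P l"
    and nonconst: "\<gamma> \<theta>\<^sub>0 \<noteq> \<gamma> 0"
  shows "closed_orbit f (range \<gamma>)"
proof -
  obtain \<tau> where \<tau>: "\<tau> 0 = 0" "\<And>x. (\<tau> has_real_derivative l x) (at x)"
    using antiderivative_real[OF l(1)] by blast
  obtain \<sigma> where \<sigma>: "\<And>x. \<sigma> (\<tau> x) = x" "\<And>x. (\<sigma>
      has_real_derivative 1 / l x) (at (\<tau> x))" "strict_mono \<tau>"
    using strict_mono_inverse[OF \<tau>(2) l(2)] by blast
  have P: "P > 0" using per by (simp add: periodic_def)
  define T where "T = \<tau> P"
  have T: "T > 0" using \<sigma>(3) P \<tau>(1) by (metis T_def strict_mono_less)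
  have shift: "\<tau> (x + P) = \<tau> x + T" for x
  proof -
    have "((\<lambda>x. \<tau> (x + P) - \<tau> x) has_real_derivative 0) (at x)" for x
    proof -
      have "((\<lambda>x. \<tau> (x + P)) has_real_derivative l (x + P)) (at x)"
        using \<tau>(2)[of "x + P"] by (simp add: DERIV_shift)
      from DERIV_diff[OF this \<tau>(2)[of x]]
      have "((\<lambda>x. \<tau> (x + P) - \<tau> x) has_real_derivative l (x + P) - l x) (at x)" .
      then show ?thesis using per(2) by (simp add: periodic_def)
    qed
    then have "\<tau> (x + P) - \<tau> x = \<tau> (0 + P) - \<tau> 0"
      using DERIV_isconst_all[of "\<lambda>x. \<tau> (x + P) - \<tau> x" x 0] by blast
    then show ?thesis by (simp add: T_def \<tau>(1))
  qed
  have surj: "\<exists>x. \<tau> x = t" for t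
  proof -
    \<comment> \<open>Subtracting the mean growth makes \<tau> periodic. Hence \<tau> takes the
      value n T at n P, is unbounded in both directions and so is onto.\<close>
    have "periodic P (\<lambda>x. \<tau> x - T * x / P)"
      using P by (simp add: periodic_def shift field_simps)
    from periodic_add_int[OF this, of 0] have n: "\<tau> (of_int n * P) = of_int n * T" for n
      using P \<tau>(1) by (simp add: mult.commute)
    define n where "n = \<lceil>\<bar>t\<bar> / T\<rceil>"
    have "\<bar>t\<bar> / T \<le> of_int n" by (simp add: n_def)
    then have t: "\<bar>t\<bar> \<le> of_int n * T" using T by (simp add: pos_divide_le_eq)
    have "\<exists>x\<ge>of_int (- n) * P. x \<le> of_int n * P \<and> \<tau> x = t"
    proof (rule IVT)
      show "\<tau> (of_int (- n) * P) \<le> t" unfolding n using t by simp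
      show "t \<le> \<tau> (of_int n * P)" unfolding n using t by simp
      have "0 \<le> of_int n * T" using t by simp
      then have "n \<ge> 0" using T by (simp add: zero_le_mult_iff)
      then have "real_of_int (- n) \<le> of_int n" by simp
      then show "of_int (- n) * P \<le> of_int n * P" using P by (intro mult_right_mono) auto
    qed (use \<tau> in \<open>auto intro: DERIV_isCont\<close>)
    then show ?thesis by blast
  qed
  define \<phi> where "\<phi> t = \<gamma> (\<sigma> t)" for t
  have \<phi>\<tau>: "\<phi> (\<tau> x) = \<gamma> x" for x by (simp add: \<phi>_def \<sigma>)
  have "(\<phi> has_vector_derivative f (\<phi> t)) (at t)" for t
  proof -
    obtain x where x: "t = \<tau> x" using surj by metis
    have "(\<sigma> has_vector_derivative 1 / l x) (at (\<tau> x))"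
      using \<sigma>(2) by (simp add: has_real_derivative_iff_has_vector_derivative)
    then have "(\<gamma> \<circ> \<sigma> has_vector_derivative (1 / l x) *\<^sub>R (l x *\<^sub>R f
        (\<gamma> x))) (at (\<tau> x))"
      by (rule vector_diff_chain_at) (simp add: \<sigma> \<gamma>)
    moreover have "(1 / l x) *\<^sub>R (l x *\<^sub>R f (\<gamma> x)) = f (\<phi> t)"
      using l(2)[of x] by (simp add: x \<phi>\<tau>)
    moreover have "\<gamma> \<circ> \<sigma> = \<phi>" by (simp add: fun_eq_iff \<phi>_def)
    ultimately show ?thesis by (simp add: x)
  qed
  moreover have "\<phi> (t + T) = \<phi> t" for t
  proof -
    obtain x where x: "t = \<tau> x" using surj by metis
    have "\<phi> (\<tau> (x + P)) = \<phi> (\<tau> x)" using per(1) unfolding \<phi>\<tau> by (simp add: periodic_def)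
    then show ?thesis by (simp add: x shift)
  qed
  moreover have "\<phi> (\<tau> \<theta>\<^sub>0) \<noteq> \<phi> 0" using nonconst \<phi>\<tau>[of
      \<theta>\<^sub>0] \<phi>\<tau>[of 0] by (simp add: \<tau>(1))
  moreover have "range \<gamma> = range \<phi>"
  proof -
    have "\<phi> t \<in> range \<gamma>" for t by (simp add: \<phi>_def)
    moreover have "\<gamma> x \<in> range \<phi>" for x by (metis \<phi>\<tau> rangeI)
    ultimately show ?thesis by blast
  qed
  ultimately show ?thesis using T unfolding closed_orbit_def by blast
qed

section \<open>Families of closed curves around a point\<close>

lemma sphere_polar:
  assumes "r > 0"
  shows "sphere (0, 0) r = range (\<lambda>\<theta>. (r * sin \<theta>, r * cos \<theta>))"
proof (rule set_eqI, rule iffI)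
  fix x :: "real \<times> real" assume x: "x \<in> sphere (0, 0) r"
  obtain a b where ab: "x = (a, b)" by (cases x)
  from x have "sqrt (a\<^sup>2 + b\<^sup>2) = r" by (simp add: ab dist_Pair_Pair)
  then have "a\<^sup>2 + b\<^sup>2 = r\<^sup>2" by (metis real_sqrt_pow2 sum_power2_ge_zero)
  then have "(b / r)\<^sup>2 + (a / r)\<^sup>2 = 1" using assms by (simp add: power_divide field_simps)
  then obtain t where "b / r = cos t" "a / r = sin t" using sincos_total_2pi by metis
  then have "x = (r * sin t, r * cos t)" using assms by (simp add: ab field_simps)
  then show "x \<in> range (\<lambda>\<theta>. (r * sin \<theta>, r * cos \<theta>))" by blast
next
  fix x :: "real \<times> real" assume "x \<in> range (\<lambda>\<theta>. (r * sin \<theta>, r * cos \<theta>))"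
  then obtain t where x: "x = (r * sin t, r * cos t)" by blast
  have "(r * sin t)\<^sup>2 + (r * cos t)\<^sup>2 = r\<^sup>2 * ((sin t)\<^sup>2 + (cos t)\<^sup>2)"
    by (simp only: power_mult_distrib distrib_left)
  then have "(r * sin t)\<^sup>2 + (r * cos t)\<^sup>2 = r\<^sup>2" by simp
  then show "x \<in> sphere (0, 0) r" using assms by (simp add: x dist_Pair_Pair)
qed

text \<open>By invariance of domain the image \<open>?D\<close> of the open ball is open, so its
  frontier lies in the image of the sphere. The component of \<Phi> c in the complement of the curve
  cannot cross this frontier; it stays in \<open>?D\<close> and is bounded.\<close>

lemma image_inside_image_sphere:
  fixes \<Phi> :: "real \<times> real \<Rightarrow> real ^ 2"
  assumes "continuous_on (cball c r) \<Phi>" "inj_on \<Phi> (cball c r)" "r > 0"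
  shows "\<Phi> c \<in> inside (\<Phi> ` sphere c r)"
proof -
  let ?D = "\<Phi> ` ball c r"
  have "open ?D"
    by (rule invariance_of_domain_gen)
       (use assms in \<open>auto intro: continuous_on_subset inj_on_subset\<close>)
  have comp: "compact (\<Phi> ` cball c r)" using assms(1) by (intro compact_continuous_image) auto
  have sub: "?D \<subseteq> \<Phi> ` cball c r" by auto
  have disj: "\<Phi> ` sphere c r \<inter> ?D = {}"
  proof -
    have "\<Phi> x \<noteq> \<Phi> y" if "x \<in> sphere c r" "y \<in> ball c r" for x y
      using that inj_onD[OF assms(2), of x y] by auto
    then show ?thesis by blast
  qed
  have front: "frontier ?D \<subseteq> \<Phi> ` sphere c r"
  proof -
    have "closure ?D \<subseteq> \<Phi> ` cball c r" using sub comp by (simp add: closure_minimal compact_imp_closed)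
    moreover have fr: "frontier ?D = closure ?D - ?D" using \<open>open ?D\<close> by (simp add:
        frontier_def interior_open)
    moreover have "\<Phi> ` cball c r \<subseteq> ?D \<union> \<Phi> ` sphere c r"
    proof -
      have "cball c r \<subseteq> ball c r \<union> sphere c r" by auto
      then show ?thesis by blast
    qed
    moreover have "A - D \<subseteq> S" if "A \<subseteq> B" "B \<subseteq> D \<union> S" for A B D S ::
        "(real ^ 2) set"
      using that by blast
    ultimately show ?thesis unfolding fr by metis
  qed
  have c: "\<Phi> c \<in> ?D" using \<open>r > 0\<close> by (intro imageI) simp
  let ?C = "connected_component_set (- (\<Phi> ` sphere c r)) (\<Phi> c)"
  have cS: "\<Phi> c \<notin> \<Phi> ` sphere c r" using disj c by (meson disjoint_iff)
  have "?C \<subseteq> ?D"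
  proof (rule ccontr)
    assume "\<not> ?C \<subseteq> ?D"
    moreover have "\<Phi> c \<in> ?C" using cS by (simp add: connected_component_refl_eq)
    ultimately have "?C \<inter> frontier ?D \<noteq> {}"
      using c by (intro connected_Int_frontier connected_connected_component) blast+
    moreover have "?C \<subseteq> - (\<Phi> ` sphere c r)" by (rule connected_component_subset)
    ultimately show False using front by (meson disjoint_iff subsetD ComplD)
  qed
  then have "bounded ?C"
    by (rule bounded_subset[OF compact_imp_bounded[OF comp] subset_trans[OF _ sub]])
  then show ?thesis using cS by (simp add: inside_def)
qed

lemma polar_less:
  fixes r :: real
  assumes "0 < r" "r < R" shows "\<bar>r * sin \<theta>\<bar> < R"
proof -
  have "\<bar>r * sin \<theta>\<bar> \<le> r * 1" unfolding abs_mult using assms by (intro mult_mono) auto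
  with assms show ?thesis by simp
qed

text \<open>\<Phi> carries concentric circles to orbits up to the positive time factor
  \<open>l\<close>. Invariance of domain makes the image of the disc a neighbourhood of
  \<open>z\<close>, and each image circle surrounds \<open>z\<close>.\<close>

lemma is_center_polar:
  fixes \<Phi> :: "real \<times> real \<Rightarrow> real ^ 2"
  assumes "R > 0" and z: "\<Phi> (0, 0) = z" "f z = 0"
    and \<Phi>: "continuous_on (ball (0, 0) R) \<Phi>" "inj_on \<Phi> (ball (0, 0) R)"
    and curve: "\<And>r \<theta>. 0 < r \<Longrightarrow> r < R \<Longrightarrow> ((\<lambda>\<theta>.
        \<Phi> (r * sin \<theta>, r * cos \<theta>)) has_vector_derivative
       l (r * sin \<theta>) *\<^sub>R f (\<Phi> (r * sin \<theta>, r * cos \<theta>))) (at \<theta>)"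
    and l: "\<And>a. \<bar>a\<bar> < R \<Longrightarrow> l a > 0" "\<And>a. \<bar>a\<bar> < R
        \<Longrightarrow> isCont l a"
  shows "is_center f z"
proof -
  have "open (\<Phi> ` ball (0, 0) R)" by (rule invariance_of_domain_gen) (use \<Phi> in auto)
  moreover have "z \<in> \<Phi> ` ball (0, 0) R" using \<open>R > 0\<close> z(1) by (metis centre_in_ball imageI)
  moreover have "\<exists>S. closed_orbit f S \<and> p \<in> S \<and> z \<in> inside S" if "p \<in> \<Phi>
      ` ball (0, 0) R - {z}" for p
  proof -
    from that obtain x where x: "x \<in> ball (0, 0) R" "p = \<Phi> x" "p \<noteq> z" by blast
    define r where "r = dist (0, 0) x"
    have "x \<noteq> (0, 0)" using x z by blast
    then have r: "0 < r" "r < R" using x by (auto simp: r_def)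
    define \<gamma> where "\<gamma> \<theta> = \<Phi> (r * sin \<theta>, r * cos \<theta>)" for \<theta>
    have S: "\<Phi> ` sphere (0, 0) r = range \<gamma>"
      unfolding sphere_polar[OF r(1)] by (auto simp: \<gamma>_def)
    have a: "\<bar>r * sin \<theta>\<bar> < R" for \<theta> using r by (rule polar_less)
    have sub: "cball (0, 0) r \<subseteq> ball (0, 0) R" using r by auto
    have "closed_orbit f (range \<gamma>)"
    proof (rule closed_orbit_reparametrize[where l = "\<lambda>\<theta>. l (r * sin \<theta>)" and P = "2 *
        pi" and \<theta>\<^sub>0 = pi])
      show "(\<gamma> has_vector_derivative l (r * sin \<theta>) *\<^sub>R f (\<gamma> \<theta>)) (at
          \<theta>)" for \<theta>
        unfolding \<gamma>_def using r by (rule curve)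
      have "isCont (\<lambda>\<theta>. l (r * sin \<theta>)) \<theta>" for \<theta>
        by (rule isCont_o2[where g = l]) (use l(2) a in \<open>auto intro!: continuous_intros\<close>)
      then show "continuous_on UNIV (\<lambda>\<theta>. l (r * sin \<theta>))" by (simp add:
          continuous_on_eq_continuous_at)
      show "l (r * sin \<theta>) > 0" for \<theta> using a l(1) by blast
      show "periodic (2 * pi) \<gamma>" "periodic (2 * pi) (\<lambda>\<theta>. l (r * sin \<theta>))"
        by (simp_all add: periodic_def \<gamma>_def)
      show "\<gamma> pi \<noteq> \<gamma> 0"
      proof
        assume "\<gamma> pi = \<gamma> 0"
        then have "\<Phi> (0, - r) = \<Phi> (0, r)" by (simp add: \<gamma>_def)
        moreover have "(0, - r) \<in> ball (0, 0) R" "(0, r) \<in> ball (0, 0) R"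
          using r by (simp_all add: dist_Pair_Pair)
        ultimately have "(0 :: real, - r) = (0, r)" using inj_onD[OF \<Phi>(2)] by blast
        with r show False by simp
      qed
    qed
    moreover have "x \<in> sphere (0, 0) r" by (simp add: r_def)
    then have "p \<in> range \<gamma>" using x(2) S by blast
    moreover have "z \<in> inside (range \<gamma>)"
      using image_inside_image_sphere[of "(0, 0)" r \<Phi>] sub \<Phi> r(1) z(1) unfolding S
      by (metis continuous_on_subset inj_on_subset)
    ultimately show ?thesis by blast
  qed
  ultimately show ?thesis unfolding is_center_def using z(2) by blast
qed

section \<open>The two integrable systems with a center\<close>

lemma frame_curve:
  fixes e1 e2 z :: "real ^ 2"
  assumes "(y has_real_derivative y') (at t)" "(v has_real_derivative v') (at t)"
  shows "((\<lambda>t. z + y t *\<^sub>R e1 + v t *\<^sub>R e2) has_vector_derivative y' *\<^sub>R e1 + v'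
      *\<^sub>R e2) (at t)"
proof -
  have "((\<lambda>t. y t *\<^sub>R e1) has_vector_derivative y' *\<^sub>R e1) (at t)"
    "((\<lambda>t. v t *\<^sub>R e2) has_vector_derivative v' *\<^sub>R e2) (at t)"
    using has_vector_derivative_scaleR[OF assms(1) has_vector_derivative_const]
      has_vector_derivative_scaleR[OF assms(2) has_vector_derivative_const] by auto
  from has_vector_derivative_add[OF has_vector_derivative_add[OF has_vector_derivative_const this(1)] this(2)]
  show ?thesis by simp
qed

lemma frame_inject:
  fixes e1 e2 z :: "real ^ 2"
  assumes "\<forall>p q. p *\<^sub>R e1 + q *\<^sub>R e2 = 0 \<longrightarrow> p = 0 \<and> q = 0"
  shows "z + y *\<^sub>R e1 + v *\<^sub>R e2 = z + y' *\<^sub>R e1 + v' *\<^sub>R e2 \<longleftrightarrow>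
      y = y' \<and> v = v'"
  using assms[rule_format, of "y - y'" "v - v'"] by (auto simp: algebra_simps)

text \<open>The sine comes first: then a = r sin \<theta>, b = r cos \<theta> satisfy a' = b, b' =
  -a, the orientation of y' = v, v' = -D y.\<close>

lemma polar_derivatives:
  "((\<lambda>\<theta>. r * sin \<theta>) has_real_derivative r * cos \<theta>) (at \<theta>)"
  "((\<lambda>\<theta>. r * cos \<theta>) has_real_derivative - (r * sin \<theta>)) (at \<theta>)"
  by (auto intro!: derivative_eq_intros)

lemma fst_less_ball: "x \<in> ball (0, 0) R \<Longrightarrow> \<bar>fst x\<bar> < R" for x :: "real \<times> real"
  using dist_fst_le[of "(0, 0)" x] by (simp add: dist_real_def)

text \<open>The integrating factor exp(-2 \<beta> y) gives the first integral G(y) + exp(-2 \<beta>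
  y) v^2 / 2, where G is the primitive of u w(u). With a = \<rho>(y) and b = exp(-\<beta> y) v its
  level curves are circles; \<Phi> inverts this change of coordinates.\<close>

lemma is_center_square_damping:
  fixes z e1 e2 :: "real ^ 2"
  assumes D: "D > 0" and indep: "\<forall>p q. p *\<^sub>R e1 + q *\<^sub>R e2 = 0 \<longrightarrow> p = 0
      \<and> q = 0"
    and f: "\<And>y v. f (z + y *\<^sub>R e1 + v *\<^sub>R e2) = v *\<^sub>R e1 + (\<beta> * v\<^sup>2 - D
        * y) *\<^sub>R e2"
  shows "is_center f z"
proof -
  define w where "w u = D * exp (- 2 * \<beta> * u)" for u
  have "continuous_on UNIV w" unfolding w_def by (intro continuous_intros)
  moreover have "w u > 0" for u using D by (simp add: w_def)
  ultimately obtain R \<eta> \<kappa> where \<eta>: "R > 0" "\<eta> 0 = 0" "inj_on \<eta> {-R<..<R}"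
      "\<And>a. \<bar>a\<bar> < R \<Longrightarrow> \<bar>\<eta> a\<bar> < 1" "\<And>a. \<bar>a\<bar> < R
          \<Longrightarrow> \<eta> a = \<kappa> a * a" "\<And>a. \<bar>a\<bar> < R \<Longrightarrow> \<kappa> a > 0"
      "\<And>a. \<bar>a\<bar> < R \<Longrightarrow> isCont \<kappa> a"
      "\<And>a. \<bar>a\<bar> < R \<Longrightarrow> (\<eta> has_real_derivative 1 / (\<kappa> a * w (\<eta>
          a))) (at a)"
    using signed_sqrt_coordinate[of w 1] by (metis zero_less_one)
  have cont\<eta>: "isCont \<eta> a" if "\<bar>a\<bar> < R" for a using \<eta>(8)[OF that] by (rule DERIV_isCont)
  define \<Phi> where "\<Phi> x = z + \<eta> (fst x) *\<^sub>R e1 + (exp (\<beta> * \<eta> (fst x)) * snd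
      x) *\<^sub>R e2" for x
  define l where "l a = exp (\<beta> * \<eta> a) / (\<kappa> a * D)" for a
  show ?thesis
  proof (rule is_center_polar[where R = R and \<Phi> = \<Phi> and l = l])
    show "\<Phi> (0, 0) = z" by (simp add: \<Phi>_def \<eta>)
    show "f z = 0" using f[of 0 0] by simp
    have c: "isCont (\<lambda>x :: real \<times> real. \<eta> (fst x)) x" if "x \<in> ball (0, 0) R" for x
      by (rule isCont_o2[OF _ cont\<eta>]) (use fst_less_ball[OF that] in \<open>auto intro!:
          continuous_intros\<close>)
    show "continuous_on (ball (0, 0) R) \<Phi>"
    proof (rule continuous_at_imp_continuous_on, rule ballI)
      fix x :: "real \<times> real" assume "x \<in> ball (0, 0) R"
      then show "isCont \<Phi> x" unfolding \<Phi>_def using c by (intro continuous_intros)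
    qed
    show "inj_on \<Phi> (ball (0, 0) R)"
    proof (rule inj_onI)
      fix x y assume xy: "x \<in> ball (0, 0) R" "y \<in> ball (0, 0) R" "\<Phi> x = \<Phi> y"
      from xy(3) have eq: "\<eta> (fst x) = \<eta> (fst y) \<and> exp (\<beta> * \<eta> (fst x)) * snd x =
          exp (\<beta> * \<eta> (fst y)) * snd y"
        unfolding \<Phi>_def by (rule frame_inject[OF indep, THEN iffD1])
      moreover from eq have "fst x = fst y"
        using inj_onD[OF \<eta>(3)] fst_less_ball[OF xy(1)] fst_less_ball[OF xy(2)]
        by (auto simp: abs_less_iff)
      ultimately show "x = y" by (simp add: prod_eq_iff)
    qed
    show "0 < l a" if "\<bar>a\<bar> < R" for a using \<eta>(6)[OF that] D by (simp add: l_def)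
    show "isCont l a" if "\<bar>a\<bar> < R" for a
      unfolding l_def using \<eta>(6,7)[OF that] cont\<eta>[OF that] D by (intro continuous_intros) auto
    fix r \<theta> assume r: "0 < r" "r < R"
    define a b where "a = r * sin \<theta>" and "b = r * cos \<theta>"
    have a: "\<bar>a\<bar> < R" unfolding a_def using r by (rule polar_less)
    define \<eta>' where "\<eta>' = 1 / (\<kappa> a * w (\<eta> a))"
    have d\<eta>: "((\<lambda>\<theta>. \<eta> (r * sin \<theta>)) has_real_derivative \<eta>' * b) (at \<theta>)"
      using DERIV_chain2[OF \<eta>(8)[OF a, unfolded a_def] polar_derivatives(1)] by (simp add: a_def b_def
          \<eta>'_def)
    have d2: "((\<lambda>\<theta>. exp (\<beta> * \<eta> (r * sin \<theta>)) * (r * cos \<theta>)) has_real_derivative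
       exp (\<beta> * \<eta> a) * (\<beta> * (\<eta>' * b)) * b - exp (\<beta> * \<eta> a) * a) (at \<theta>)"
      by (rule derivative_eq_intros d\<eta> polar_derivatives refl)+ (simp add: a_def b_def)
    have E1: "\<eta>' * b = l a * (exp (\<beta> * \<eta> a) * b)"
      by (simp add: \<eta>'_def l_def w_def exp_minus field_simps flip: exp_add exp_double)
    have E2: "exp (\<beta> * \<eta> a) * (\<beta> * (\<eta>' * b)) * b - exp (\<beta> * \<eta> a) * a =
        l a * (\<beta> * (exp (\<beta> * \<eta> a) * b)\<^sup>2 - D * \<eta> a)"
    proof -
      have "l a * (D * \<eta> a) = exp (\<beta> * \<eta> a) * a"
        using \<eta>(6)[OF a] D by (simp add: l_def \<eta>(5)[OF a])
      moreover have "exp (\<beta> * \<eta> a) * (\<beta> * (\<eta>' * b)) * b = l a * (\<beta> * (exp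
          (\<beta> * \<eta> a) * b)\<^sup>2)"
        unfolding E1 by (simp add: power2_eq_square)
      ultimately show ?thesis by (simp add: right_diff_distrib)
    qed
    have eq: "l a *\<^sub>R ((exp (\<beta> * \<eta> a) * b) *\<^sub>R e1 + (\<beta> * (exp (\<beta> *
        \<eta> a) * b)\<^sup>2 - D * \<eta> a) *\<^sub>R e2) =
        (\<eta>' * b) *\<^sub>R e1 + (exp (\<beta> * \<eta> a) * (\<beta> * (\<eta>' * b)) * b - exp
            (\<beta> * \<eta> a) * a) *\<^sub>R e2"
      unfolding E2 unfolding E1 by (simp only: scaleR_add_right scaleR_scaleR)
    show "((\<lambda>\<theta>. \<Phi> (r * sin \<theta>, r * cos \<theta>)) has_vector_derivative
        l (r * sin \<theta>) *\<^sub>R f (\<Phi> (r * sin \<theta>, r * cos \<theta>))) (at \<theta>)"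
      unfolding \<Phi>_def fst_conv snd_conv f a_def[symmetric] b_def[symmetric] eq
      by (rule frame_curve[OF d\<eta> d2])
  qed (use \<eta> in auto)
qed

text \<open>Separating variables gives v dv / (D - \<alpha> v) = -y dy, so the energy coordinate is
  now taken in v, with weight 1 / (D - \<alpha> v). The other coordinate is b = -y, which keeps the
  orientation.\<close>

lemma is_center_product_damping:
  fixes z e1 e2 :: "real ^ 2"
  assumes D: "D > 0" and indep: "\<forall>p q. p *\<^sub>R e1 + q *\<^sub>R e2 = 0 \<longrightarrow> p = 0
      \<and> q = 0"
    and f: "\<And>y v. f (z + y *\<^sub>R e1 + v *\<^sub>R e2) = v *\<^sub>R e1 + (\<alpha> * y * v - D *
        y) *\<^sub>R e2"
  shows "is_center f z"
proof -
  define e where "e = D / (2 * (\<bar>\<alpha>\<bar> + 1))"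
  have e: "e > 0" using D by (simp add: e_def)
  \<comment> \<open>The weight is wanted only near 0. The maximum with D / 2 makes it positive and
    continuous everywhere, and it has no effect for |u| < e by the choice of
    \<open>e\<close>.\<close>
  define w where "w u = 1 / max (D - \<alpha> * u) (D / 2)" for u
  have "continuous_on UNIV w" unfolding w_def using D by (intro continuous_intros) (auto simp: max_def)
  moreover have "w u > 0" for u using D by (simp add: w_def less_max_iff_disj)
  ultimately obtain R \<eta> \<kappa> where \<eta>: "R > 0" "\<eta> 0 = 0" "inj_on \<eta> {-R<..<R}"
      "\<And>a. \<bar>a\<bar> < R \<Longrightarrow> \<bar>\<eta> a\<bar> < e" "\<And>a. \<bar>a\<bar> < R
          \<Longrightarrow> \<eta> a = \<kappa> a * a" "\<And>a. \<bar>a\<bar> < R \<Longrightarrow> \<kappa> a > 0"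
      "\<And>a. \<bar>a\<bar> < R \<Longrightarrow> isCont \<kappa> a"
      "\<And>a. \<bar>a\<bar> < R \<Longrightarrow> (\<eta> has_real_derivative 1 / (\<kappa> a * w (\<eta>
          a))) (at a)"
    using signed_sqrt_coordinate[of w e] e by metis
  have w: "w u = 1 / (D - \<alpha> * u)" if "\<bar>u\<bar> < e" for u
  proof -
    have "\<alpha> * u \<le> \<bar>\<alpha>\<bar> * \<bar>u\<bar>" by (metis abs_ge_self abs_mult)
    also have "\<dots> \<le> (\<bar>\<alpha>\<bar> + 1) * e" using that by (intro mult_mono) auto
    also have "\<dots> = D / 2" by (simp add: e_def field_simps)
    finally show ?thesis by (simp add: w_def max_def)
  qed
  have cont\<eta>: "isCont \<eta> a" if "\<bar>a\<bar> < R" for a using \<eta>(8)[OF that] by (rule DERIV_isCont)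
  define \<Phi> where "\<Phi> x = z + (- snd x) *\<^sub>R e1 + \<eta> (fst x) *\<^sub>R e2" for x
  define l where "l a = 1 / \<kappa> a" for a
  show ?thesis
  proof (rule is_center_polar[where R = R and \<Phi> = \<Phi> and l = l])
    show "\<Phi> (0, 0) = z" by (simp add: \<Phi>_def \<eta>)
    show "f z = 0" using f[of 0 0] by simp
    have c: "isCont (\<lambda>x :: real \<times> real. \<eta> (fst x)) x" if "x \<in> ball (0, 0) R" for x
      by (rule isCont_o2[OF _ cont\<eta>]) (use fst_less_ball[OF that] in \<open>auto intro!:
          continuous_intros\<close>)
    show "continuous_on (ball (0, 0) R) \<Phi>"
    proof (rule continuous_at_imp_continuous_on, rule ballI)
      fix x :: "real \<times> real" assume "x \<in> ball (0, 0) R"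
      then show "isCont \<Phi> x" unfolding \<Phi>_def using c by (intro continuous_intros)
    qed
    show "inj_on \<Phi> (ball (0, 0) R)"
    proof (rule inj_onI)
      fix x y assume xy: "x \<in> ball (0, 0) R" "y \<in> ball (0, 0) R" "\<Phi> x = \<Phi> y"
      from xy(3) have eq: "- snd x = - snd y \<and> \<eta> (fst x) = \<eta> (fst y)"
        unfolding \<Phi>_def by (rule frame_inject[OF indep, THEN iffD1])
      moreover from eq have "fst x = fst y"
        using inj_onD[OF \<eta>(3)] fst_less_ball[OF xy(1)] fst_less_ball[OF xy(2)]
        by (auto simp: abs_less_iff)
      ultimately show "x = y" by (simp add: prod_eq_iff)
    qed
    show "0 < l a" if "\<bar>a\<bar> < R" for a using \<eta>(6)[OF that] by (simp add: l_def)
    show "isCont l a" if "\<bar>a\<bar> < R" for a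
      unfolding l_def using \<eta>(6,7)[OF that] by (intro continuous_intros) auto
    fix r \<theta> assume r: "0 < r" "r < R"
    define a b where "a = r * sin \<theta>" and "b = r * cos \<theta>"
    have a: "\<bar>a\<bar> < R" unfolding a_def using r by (rule polar_less)
    define \<eta>' where "\<eta>' = 1 / (\<kappa> a * w (\<eta> a))"
    have d\<eta>: "((\<lambda>\<theta>. \<eta> (r * sin \<theta>)) has_real_derivative \<eta>' * b) (at \<theta>)"
      using DERIV_chain2[OF \<eta>(8)[OF a, unfolded a_def] polar_derivatives(1)] by (simp add: a_def b_def
          \<eta>'_def)
    have d1: "((\<lambda>\<theta>. - (r * cos \<theta>)) has_real_derivative a) (at \<theta>)"
      using DERIV_minus[OF polar_derivatives(2)] by (simp add: a_def)
    have E1: "l a * \<eta> a = a"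
      using \<eta>(6)[OF a] by (simp add: l_def \<eta>(5)[OF a])
    have E2: "l a * (\<alpha> * (- b) * \<eta> a - D * (- b)) = \<eta>' * b"
      by (simp add: \<eta>'_def l_def w[OF \<eta>(4)[OF a]] algebra_simps diff_divide_distrib add_divide_distrib)
    have eq: "l a *\<^sub>R (\<eta> a *\<^sub>R e1 + (\<alpha> * (- b) * \<eta> a - D * (- b)) *\<^sub>R
        e2) = a *\<^sub>R e1 + (\<eta>' * b) *\<^sub>R e2"
      unfolding scaleR_add_right scaleR_scaleR E1 E2 ..
    show "((\<lambda>\<theta>. \<Phi> (r * sin \<theta>, r * cos \<theta>)) has_vector_derivative
        l (r * sin \<theta>) *\<^sub>R f (\<Phi> (r * sin \<theta>, r * cos \<theta>))) (at \<theta>)"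
      unfolding \<Phi>_def fst_conv snd_conv f a_def[symmetric] b_def[symmetric] eq
      by (rule frame_curve[OF d1 d\<eta>])
  qed (use \<eta> in auto)
qed

section \<open>Criteria excluding a center\<close>

lemma trajectory_inner:
  assumes "trajectory f \<phi>"
  shows "((\<lambda>t. p \<bullet> (\<phi> t - z)) has_real_derivative p \<bullet> f (\<phi> t)) (at t)"
proof -
  have "(\<phi> has_vector_derivative f (\<phi> t)) (at t)" using assms by (simp add: trajectory_def)
  then have "((\<lambda>t. \<phi> t - z) has_vector_derivative f (\<phi> t)) (at t)"
    by (auto intro!: derivative_eq_intros)
  from bounded_linear.has_vector_derivative[OF bounded_linear_inner_right this, of p]
  show ?thesis by (simp add: has_real_derivative_iff_has_vector_derivative)
qed

lemma is_center_probe: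
  assumes "is_center f z" and "p \<noteq> 0" and "s \<noteq> 0"
  obtains \<phi> T where "trajectory f \<phi>" "periodic T \<phi>" "s * (p \<bullet> (\<phi> 0 - z)) > 0"
proof -
  obtain e where e: "e > 0" "\<And>x. x \<noteq> z \<Longrightarrow> dist x z < e \<Longrightarrow>
      \<exists>\<phi> T. trajectory f \<phi> \<and> periodic T \<phi> \<and> \<phi> 0 = x"
    using is_center_trajectory[OF assms(1)] by blast
  \<comment> \<open>The starting point lies at distance e / 2 from \<open>z\<close>, on the side
    given by the sign of \<open>s\<close>.\<close>
  define c where "c = sgn s * (e / (2 * norm p))"
  have c: "c \<noteq> 0" "s * c > 0"
  proof -
    have "s * c = \<bar>s\<bar> * (e / (2 * norm p))" by (simp add: c_def abs_sgn)
    then show "s * c > 0" using e(1) assms(2,3) by simp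
    then show "c \<noteq> 0" by auto
  qed
  have "dist (z + c *\<^sub>R p) z = \<bar>c\<bar> * norm p" by (simp add: dist_norm)
  also have "\<dots> = e / 2" using e(1) assms(2,3) by (simp add: c_def abs_mult sgn_if)
  finally have "dist (z + c *\<^sub>R p) z < e" using e(1) by simp
  moreover have "z + c *\<^sub>R p \<noteq> z" using c assms(2) by simp
  ultimately obtain \<phi> T where \<phi>: "trajectory f \<phi>" "periodic T \<phi>" "\<phi> 0 = z + c
      *\<^sub>R p" using e(2) by blast
  have "s * (p \<bullet> (\<phi> 0 - z)) = s * c * (p \<bullet> p)" by (simp add: \<phi>(3))
  also have "\<dots> > 0" using mult_pos_pos[OF c(2), of "p \<bullet> p"] assms(2) by simp
  finally show thesis using that \<phi> by blast
qed

text \<open>The function X = p . (x - z) satisfies X' = k X, so it vanishes at its maximum on a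
  periodic orbit, although the orbit starts with X > 0.\<close>

lemma not_center_eigenvector:
  assumes p: "p \<noteq> 0" and f: "\<And>x. p \<bullet> f x = k * (p \<bullet> (x - z))" and "k \<noteq> 0"
  shows "\<not> is_center f z"
proof
  assume "is_center f z"
  then obtain \<phi> T where \<phi>: "trajectory f \<phi>" "periodic T \<phi>" "1 * (p \<bullet> (\<phi> 0 - z)) > 0"
    using is_center_probe[OF _ p, of f z 1] by auto
  obtain t where t: "\<And>s. p \<bullet> (\<phi> s - z) \<le> p \<bullet> (\<phi> t - z)" "p \<bullet> f
      (\<phi> t) = 0"
    using periodic_max[OF periodic_compose[OF \<phi>(2)] trajectory_inner[OF \<phi>(1), of p z]] by metis
  from t(2) f \<open>k \<noteq> 0\<close> have "p \<bullet> (\<phi> t - z) = 0" by simp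
  with t(1)[of 0] \<phi>(3) show False by simp
qed

text \<open>X = p . (x - z) satisfies X' = g X (X + S), so its critical values are 0 and -S. At
  both, S X is at most 0, which is impossible at the maximum of S X on an orbit starting with S X >
  0. That maximum is a maximum or a minimum of X according to the sign of S.\<close>

lemma not_center_invariant_line:
  assumes p: "p \<noteq> 0" and f: "\<And>x. p \<bullet> f x = g * (p \<bullet> (x - z)) * (p \<bullet> (x
      - z) + S)" and "g \<noteq> 0" "S \<noteq> 0"
  shows "\<not> is_center f z"
proof
  assume "is_center f z"
  then obtain \<phi> T where \<phi>: "trajectory f \<phi>" "periodic T \<phi>" "S * (p \<bullet> (\<phi> 0 - z)) > 0"
    using is_center_probe[OF _ p \<open>S \<noteq> 0\<close>] by metis
  have "\<exists>t. S * (p \<bullet> (\<phi> 0 - z)) \<le> S * (p \<bullet> (\<phi> t - z)) \<and> p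
      \<bullet> f (\<phi> t) = 0"
  proof (cases "S > 0")
    case True
    then show ?thesis
      using periodic_max[OF periodic_compose[OF \<phi>(2)] trajectory_inner[OF \<phi>(1), of p z]]
      by (metis mult_left_mono less_imp_le)
  next
    case False
    then have "S \<le> 0" by simp
    then show ?thesis
      using periodic_min[OF periodic_compose[OF \<phi>(2)] trajectory_inner[OF \<phi>(1), of p z]]
      by (metis mult_left_mono_neg)
  qed
  then obtain t where t: "S * (p \<bullet> (\<phi> 0 - z)) \<le> S * (p \<bullet> (\<phi> t - z))" "p
      \<bullet> f (\<phi> t) = 0" by blast
  from t(2) f \<open>g \<noteq> 0\<close> have "p \<bullet> (\<phi> t - z) = 0 \<or> p \<bullet> (\<phi> t
      - z) = - S" by auto
  then have "S * (p \<bullet> (\<phi> t - z)) \<le> 0" by (auto simp: mult_less_0_iff not_less zero_le_mult_iff)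
  with t(1) \<phi>(3) show False by simp
qed

context
  fixes f :: "real ^ 2 \<Rightarrow> real ^ 2" and p q z :: "real ^ 2"
  assumes nz: "p \<noteq> 0" "q \<noteq> 0" and indep: "\<And>u. p \<bullet> u = 0 \<Longrightarrow> q
      \<bullet> u = 0 \<Longrightarrow> u = 0"
begin

lemma away: "x \<noteq> z \<Longrightarrow> p \<bullet> (x - z) \<noteq> 0 \<or> q \<bullet> (x - z) \<noteq> 0"
  using indep[of "x - z"] by auto

text \<open>Write y = p . (x - z) and v = q . (x - z), so that y' = v. At a maximum of y one has v =
  0, so the second derivative of y is -D y. For D < 0 and y > 0 it is positive, a
  contradiction.\<close>

lemma not_center_saddle:
  assumes f1: "\<And>x. p \<bullet> f x = q \<bullet> (x - z)"
    and f2: "\<And>x. q \<bullet> f x = \<tau> * (q \<bullet> (x - z)) - D * (p \<bullet> (x - z))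
        + (q \<bullet> (x - z)) * (\<alpha> * (p \<bullet> (x - z)) + \<beta> * (q \<bullet> (x - z)))"
    and "D < 0"
  shows "\<not> is_center f z"
proof
  assume "is_center f z"
  then obtain \<phi> T where \<phi>: "trajectory f \<phi>" "periodic T \<phi>" "1 * (p \<bullet> (\<phi> 0 - z)) > 0"
    using is_center_probe[OF _ nz(1), of f z 1] by auto
  obtain t where t: "\<And>s. p \<bullet> (\<phi> s - z) \<le> p \<bullet> (\<phi> t - z)" "p \<bullet> f
      (\<phi> t) = 0"
      "\<And>d. ((\<lambda>t. p \<bullet> f (\<phi> t)) has_real_derivative d) (at t) \<Longrightarrow> d \<le> 0"
    using periodic_max[OF periodic_compose[OF \<phi>(2)] trajectory_inner[OF \<phi>(1), of p z]] by blast
  have "q \<bullet> f (\<phi> t) \<le> 0" using t(3) trajectory_inner[OF \<phi>(1), of q z t] unfolding f1 by blast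
  moreover have "q \<bullet> f (\<phi> t) = - D * (p \<bullet> (\<phi> t - z))" using t(2) unfolding f1 f2 by simp
  ultimately have "p \<bullet> (\<phi> t - z) \<le> 0" using \<open>D < 0\<close> by (auto simp: zero_le_mult_iff)
  with t(1)[of 0] \<phi>(3) show False by simp
qed

lemma small_perturbation:
  assumes "\<tau> \<noteq> 0"
  obtains r where "r > 0" "\<And>x. dist x z \<le> r \<Longrightarrow> \<tau> * (\<tau> + \<alpha> * (p
      \<bullet> (x - z)) + \<beta> * (q \<bullet> (x - z))) > 0"
proof -
  let ?g = "\<lambda>x. \<tau> * (\<tau> + \<alpha> * (p \<bullet> (x - z)) + \<beta> * (q \<bullet> (x - z)))"
  have "open {x. 0 < ?g x}" by (intro open_Collect_less continuous_intros)
  moreover have "z \<in> {x. 0 < ?g x}" using assms by (auto simp: zero_less_mult_iff)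
  ultimately obtain r where r: "r > 0" "cball z r \<subseteq> {x. 0 < ?g x}" unfolding open_contains_cball by blast
  show thesis
  proof (rule that[OF r(1)])
    fix x assume "dist x z \<le> r"
    then have "x \<in> cball z r" by (simp add: dist_commute)
    with r(2) show "?g x > 0" by blast
  qed
qed

text \<open>With y and v as before, V = D y^2 + v^2 changes at the rate 2 v^2 (\<tau> + \<alpha> y +
  \<beta> v), which near \<open>z\<close> is 0 or has the sign of \<tau>. If the rate is 0 along an
  orbit, then v = 0 throughout, and v' = 0 gives y = 0.\<close>

lemma not_center_trace:
  assumes f1: "\<And>x. p \<bullet> f x = q \<bullet> (x - z)"
    and f2: "\<And>x. q \<bullet> f x = \<tau> * (q \<bullet> (x - z)) - D * (p \<bullet> (x - z))
        + (q \<bullet> (x - z)) * (\<alpha> * (p \<bullet> (x - z)) + \<beta> * (q \<bullet> (x - z)))"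
    and "D > 0" "\<tau> \<noteq> 0"
  shows "\<not> is_center f z"
proof
  assume c: "is_center f z"
  obtain r where r: "r > 0" "\<And>x. dist x z \<le> r \<Longrightarrow> \<tau> * (\<tau> + \<alpha> * (p
      \<bullet> (x - z)) + \<beta> * (q \<bullet> (x - z))) > 0"
    using small_perturbation[OF \<open>\<tau> \<noteq> 0\<close>] by blast
  define V where "V x = D * (p \<bullet> (x - z))\<^sup>2 + (q \<bullet> (x - z))\<^sup>2" for x
  define W where "W x = 2 * (q \<bullet> (x - z))\<^sup>2 * (\<tau> + \<alpha> * (p \<bullet> (x - z)) +
      \<beta> * (q \<bullet> (x - z)))" for x
  obtain \<phi> where \<phi>: "trajectory f \<phi>" "\<phi> 0 \<noteq> z" "\<And>t. dist (\<phi> t) z < r"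
      "\<And>t. W (\<phi> t) = 0"
  proof (rule is_center_lyapunov[OF c r(1), of V W \<tau>])
    show "continuous_on UNIV V" unfolding V_def by (intro continuous_intros)
    show "V z = 0" by (simp add: V_def)
    show "V x > 0" if "x \<noteq> z" for x
      using away[OF that] \<open>D > 0\<close> by (auto simp: V_def add_pos_nonneg add_nonneg_pos)
    show "((\<lambda>t. V (\<phi> t)) has_real_derivative W (\<phi> t)) (at t)" if "trajectory f \<phi>" for \<phi> t
      unfolding V_def
      by (rule derivative_eq_intros trajectory_inner[OF that] refl)+
         (simp add: W_def f1 f2 algebra_simps power2_eq_square)
    show "0 \<le> \<tau> * W x" if "dist x z \<le> r" for x
    proof -
      have "\<tau> * W x = 2 * (q \<bullet> (x - z))\<^sup>2 * (\<tau> * (\<tau> + \<alpha> * (p \<bullet>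
          (x - z)) + \<beta> * (q \<bullet> (x - z))))"
        by (simp add: W_def)
      then show ?thesis using r(2)[OF that] by (metis mult_nonneg_nonneg less_imp_le zero_le_power2 zero_le_numeral)
    qed
  qed (use \<open>\<tau> \<noteq> 0\<close> in auto)
  have q: "q \<bullet> (\<phi> t - z) = 0" for t
    using \<phi>(4)[of t] r(2)[of "\<phi> t"] \<phi>(3)[of t] by (auto simp: W_def)
  have "q \<bullet> f (\<phi> 0) = 0"
    using trajectory_inner[OF \<phi>(1), of q z 0] DERIV_unique[OF _ DERIV_const] unfolding q by blast
  then have "p \<bullet> (\<phi> 0 - z) = 0" unfolding f2 using q[of 0] \<open>D > 0\<close> by simp
  with q[of 0] away \<phi>(2) show False by blast
qed

text \<open>In the Lienard coordinates \<open>y\<close>, \<open>Y\<close> the system is compared with the one whose damping is an exact function of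
  the potential energy \<open>G\<close>; \<open>V\<close> is the first integral of the latter.\<close>
lemma not_center_focal:
  assumes f1: "\<And>x. p \<bullet> f x = q \<bullet> (x - z)"
    and f2: "\<And>x. q \<bullet> f x = - D * (p \<bullet> (x - z))
        + (q \<bullet> (x - z)) * (\<alpha> * (p \<bullet> (x - z)) + \<beta> * (q \<bullet> (x - z)))"
    and "D > 0" "\<alpha> \<noteq> 0" "\<beta> \<noteq> 0"
  shows "\<not> is_center f z"
proof
  assume center: "is_center f z"
  \<comment> \<open>With this value \<alpha> F and c G agree to second order at 0.\<close>
  define c where "c = \<alpha> / D"
  have w: "continuous_on UNIV (\<lambda>u. D * exp (- 2 * \<beta> * u))" "continuous_on UNIV (\<lambda>u.
      exp (- \<beta> * u))"
     "continuous_on UNIV (\<lambda>u. exp (c * u))" by (intro continuous_intros)+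
  obtain G where G: "G 0 = 0" "\<And>u. (G has_real_derivative u * (D * exp (- 2 * \<beta> * u))) (at u)"
      "\<And>u. u \<noteq> 0 \<Longrightarrow> G u > 0" "continuous_on UNIV G"
    using weighted_primitive[OF w(1)] \<open>D > 0\<close> by auto
  obtain F where F: "F 0 = 0" "\<And>u. (F has_real_derivative u * exp (- \<beta> * u)) (at u)" "continuous_on UNIV F"
    using weighted_primitive[OF w(2)] exp_gt_zero by metis
  obtain P where P: "P 0 = 0" "\<And>u. (P has_real_derivative u * exp (c * u)) (at u)"
      "\<And>u. u \<noteq> 0 \<Longrightarrow> P u > 0" "continuous_on UNIV P"
    using weighted_primitive[OF w(3)] exp_gt_zero by metis
  \<comment> \<open>After multiplying time by exp(\<beta> y) the system reads y' = Y + \<alpha>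
    F(y), Y' = -G'(y). Replacing \<alpha> F by c G makes exp(c Y) G(y) + P(Y) a first integral,
    since P' = u exp(c u). The difference \<open>H\<close> of the dampings alone remains in
    \<open>W\<close>.\<close>
  define y v Y where "y x = p \<bullet> (x - z)" and "v x = q \<bullet> (x - z)"
    and "Y x = exp (- \<beta> * y x) * v x - \<alpha> * F (y x)" for x
  define V where "V x = exp (c * Y x) * G (y x) + P (Y x)" for x
  define H where "H u = \<alpha> * F u - c * G u" for u
  define W where "W x = exp (c * Y x) * D * exp (- \<beta> * y x) * (y x * H (y x))" for x
  have cy: "continuous_on UNIV y" "continuous_on UNIV v"
    unfolding y_def v_def by (intro continuous_intros)+
  have cY: "continuous_on UNIV Y"
    unfolding Y_def by (intro continuous_intros cy continuous_on_compose2[OF F(3)]) auto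
  have Hpos: "\<alpha> * \<beta> * (u * H u) > 0" if "u \<noteq> 0" for u
  proof -
    \<comment> \<open>The factor exp(-\<beta> u) - exp(-2 \<beta> u) has the sign of \<beta> u, so
      \<alpha> \<beta> H increases on both sides of 0.\<close>
    have dH: "((\<lambda>u. \<alpha> * \<beta> * H u) has_real_derivative \<alpha>\<^sup>2 * ((exp (-
        \<beta> * u) - exp (- 2 * \<beta> * u)) * (\<beta> * u))) (at u)" for u
      unfolding H_def
      by (rule derivative_eq_intros F(2) G(2) refl)+ (use \<open>D > 0\<close> in \<open>simp add: c_def
          field_simps power2_eq_square\<close>)
    have pos: "\<alpha>\<^sup>2 * ((exp (- \<beta> * u) - exp (- 2 * \<beta> * u)) * (\<beta> * u)) > 0" if
        "u \<noteq> 0" for u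
    proof -
      have "(exp (- \<beta> * u) - exp (- 2 * \<beta> * u)) * (\<beta> * u) > 0"
        using that \<open>\<beta> \<noteq> 0\<close> by (cases "\<beta> * u > 0") (auto intro!:
            mult_pos_pos mult_neg_neg simp: not_less mult_less_0_iff zero_less_mult_iff)
      with \<open>\<alpha> \<noteq> 0\<close> show ?thesis by simp
    qed
    have contH: "continuous_on A (\<lambda>u. \<alpha> * \<beta> * H u)" for A
      unfolding H_def by (intro continuous_intros continuous_on_subset[OF F(3)] continuous_on_subset[OF G(4)]) auto
    have H0: "H 0 = 0" by (simp add: H_def F G)
    have inc: "\<alpha> * \<beta> * H a < \<alpha> * \<beta> * H b" if ab: "a < b" "a \<ge> 0 \<or> b \<le> 0" for a b
    proof (rule DERIV_pos_imp_increasing_open[OF ab(1)])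
      fix x assume "a < x" "x < b"
      with ab(2) have "x \<noteq> 0" by auto
      show "\<exists>y. ((\<lambda>u. \<alpha> * \<beta> * H u) has_real_derivative y) (at x) \<and> 0 < y"
        using dH[of x] pos[OF \<open>x \<noteq> 0\<close>] by blast
    qed (rule contH)
    have eq: "\<alpha> * \<beta> * (u * H u) = u * (\<alpha> * \<beta> * H u)" by (rule mult.left_commute)
    show ?thesis
    proof (cases "u > 0")
      case True
      have "\<alpha> * \<beta> * H 0 < \<alpha> * \<beta> * H u"
        by (rule inc[OF True]) simp
      then have "u * (\<alpha> * \<beta> * H u) > 0" using mult_pos_pos[OF True, of "\<alpha> * \<beta> * H
          u"] by (simp only: H0 mult_zero_right)
      then show ?thesis unfolding eq .
    next
      case False
      with that have "u < 0" by simp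
      have "\<alpha> * \<beta> * H u < \<alpha> * \<beta> * H 0"
        by (rule inc[OF \<open>u < 0\<close>]) simp
      then have "u * (\<alpha> * \<beta> * H u) > 0" using mult_neg_neg[OF \<open>u < 0\<close>, of
          "\<alpha> * \<beta> * H u"] by (simp only: H0 mult_zero_right)
      then show ?thesis unfolding eq .
    qed
  qed
  have Hnn: "\<alpha> * \<beta> * (u * H u) \<ge> 0" for u using Hpos[of u] less_imp_le by (cases "u = 0")
      (simp, blast)
  obtain \<phi> where \<phi>: "trajectory f \<phi>" "\<phi> 0 \<noteq> z" "\<And>t. W (\<phi> t) = 0"
  proof (rule is_center_lyapunov[OF center zero_less_one, of V W "\<alpha> * \<beta>"])
    show "continuous_on UNIV V" unfolding V_def
      by (intro continuous_intros cY continuous_on_compose2[OF G(4) cy(1)] continuous_on_compose2[OF P(4) cY]) auto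
    show "V z = 0" by (simp add: V_def Y_def y_def v_def F G P)
    show "V x > 0" if "x \<noteq> z" for x
    proof (cases "y x = 0")
      case True
      then have "v x \<noteq> 0" using away[OF that] by (simp add: y_def v_def)
      then have "Y x \<noteq> 0" using True by (simp add: Y_def F)
      then show ?thesis using P(3) True by (simp add: V_def G)
    next
      case False
      have "P u \<ge> 0" for u using P(1,3) by (metis less_imp_le order_refl)
      then show ?thesis using G(3)[OF False] unfolding V_def by (intro add_pos_nonneg mult_pos_pos) auto
    qed
    show "((\<lambda>t. V (\<phi> t)) has_real_derivative W (\<phi> t)) (at t)" if \<phi>: "trajectory f
        \<phi>" for \<phi> t
    proof -
      let ?x = "\<phi> t"
      have dy: "((\<lambda>t. y (\<phi> t)) has_real_derivative v ?x) (at t)"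
        using trajectory_inner[OF \<phi>, of p z t] unfolding f1 y_def v_def .
      have dv: "((\<lambda>t. v (\<phi> t)) has_real_derivative - D * y ?x + v ?x * (\<alpha> * y ?x +
          \<beta> * v ?x)) (at t)"
        using trajectory_inner[OF \<phi>, of q z t] unfolding f2 y_def v_def .
      have dF: "((\<lambda>t. F (y (\<phi> t))) has_real_derivative y ?x * exp (- \<beta> * y ?x) * v ?x) (at t)"
        by (rule DERIV_chain2[OF F(2) dy])
      have dG: "((\<lambda>t. G (y (\<phi> t))) has_real_derivative y ?x * (D * exp (- 2 * \<beta> * y ?x))
          * v ?x) (at t)"
        by (rule DERIV_chain2[OF G(2) dy])
      have dY: "((\<lambda>t. Y (\<phi> t)) has_real_derivative - D * y ?x * exp (- \<beta> * y ?x)) (at t)"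
        unfolding Y_def
        by (rule derivative_eq_intros dy dv dF refl)+ (simp add: algebra_simps)
      have dP: "((\<lambda>t. P (Y (\<phi> t))) has_real_derivative Y ?x * exp (c * Y ?x) * (- D * y ?x *
          exp (- \<beta> * y ?x))) (at t)"
        by (rule DERIV_chain2[OF P(2) dY])
      have vY: "exp (- \<beta> * y ?x) * v ?x = Y ?x + \<alpha> * F (y ?x)" by (simp add: Y_def)
      have e2: "exp (- 2 * \<beta> * y ?x) = exp (- \<beta> * y ?x) * exp (- \<beta> * y ?x)"
        by (simp flip: exp_add)
      have eqG: "y ?x * (D * exp (- 2 * \<beta> * y ?x)) * v ?x = D * y ?x * exp (- \<beta> * y ?x) * (Y ?x
          + \<alpha> * F (y ?x))"
        unfolding vY[symmetric] e2 by simp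
      have dG': "((\<lambda>t. G (y (\<phi> t))) has_real_derivative D * y ?x * exp (- \<beta> * y ?x) * (Y
          ?x + \<alpha> * F (y ?x))) (at t)"
        using dG unfolding eqG .
      show ?thesis
        unfolding V_def
        by (rule derivative_eq_intros dY dG' dP refl)+ (simp add: W_def H_def algebra_simps)
    qed
    show "0 \<le> \<alpha> * \<beta> * W x" for x
    proof -
      have "\<alpha> * \<beta> * W x = exp (c * Y x) * D * exp (- \<beta> * y x) * (\<alpha> * \<beta> * (y
          x * H (y x)))"
        by (simp add: W_def)
      also have "\<dots> \<ge> 0" using \<open>D > 0\<close> by (intro mult_nonneg_nonneg Hnn) auto
      finally show ?thesis .
    qed
  qed (use \<open>\<alpha> \<noteq> 0\<close> \<open>\<beta> \<noteq> 0\<close> in auto)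
  have y: "y (\<phi> t) = 0" for t
  proof (rule ccontr)
    assume "y (\<phi> t) \<noteq> 0"
    moreover have "y (\<phi> t) * H (y (\<phi> t)) = 0"
      using \<phi>(3)[of t] \<open>D > 0\<close> by (simp add: W_def)
    ultimately show False using Hpos by (metis less_irrefl mult_zero_right)
  qed
  have "p \<bullet> f (\<phi> 0) = 0"
    using trajectory_inner[OF \<phi>(1), of p z 0] DERIV_unique[OF _ DERIV_const]
    unfolding y[unfolded y_def] by blast
  then have "v (\<phi> 0) = 0" by (simp add: f1 v_def)
  with y[of 0] away \<phi>(2) show False by (auto simp: y_def v_def)
qed

text \<open>Up to the factor \<open>S + X\<close>, where \<open>X = p \<bullet> (x - z)\<close>, this is a Lienard system. If its trace vanishes, its
  damping is a multiple of \<open>X\<^sup>2 / (S + X)\<close>, and \<open>V\<close> below is the first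
      integral of the reversible
  system with damping \<open>X\<^sup>2 / S\<close>.\<close>

lemma not_center_lienard:
  assumes f1: "\<And>x. p \<bullet> f x = (S + p \<bullet> (x - z)) * (q \<bullet> (x - z) + \<sigma> * (p
      \<bullet> (x - z))) + k * (p \<bullet> (x - z))"
    and f2: "\<And>x. q \<bullet> f x = - D * (p \<bullet> (x - z)) * (S + p \<bullet> (x - z))"
    and "S \<noteq> 0" "k \<noteq> 0" "D \<noteq> 0"
  shows "\<not> is_center f z"
proof
  assume center: "is_center f z"
  show False
  proof (cases "D < 0")
    case True
    obtain \<phi> T where \<phi>: "trajectory f \<phi>" "periodic T \<phi>" "k * (q \<bullet> (\<phi> 0 - z)) > 0"
      using is_center_probe[OF center nz(2) \<open>k \<noteq> 0\<close>] by metis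
    define x y where "x t = p \<bullet> (\<phi> t - z)" and "y t = q \<bullet> (\<phi> t - z)" for t
    have dx: "(x has_real_derivative (S + x t) * (y t + \<sigma> * x t) + k * x t) (at t)" for t
      using trajectory_inner[OF \<phi>(1), of p z t] unfolding f1 x_def y_def .
    have dy: "(y has_real_derivative - D * x t * (S + x t)) (at t)" for t
      using trajectory_inner[OF \<phi>(1), of q z t] unfolding f2 x_def y_def .
    have dy': "((\<lambda>t. - D * x t * (S + x t)) has_real_derivative
        - D * (S + 2 * x t) * ((S + x t) * (y t + \<sigma> * x t) + k * x t)) (at t)" for t
      by (rule derivative_eq_intros dx refl)+ (simp add: algebra_simps)
    \<comment> \<open>Critical points of y have x = 0 or x = -S, and there the second derivative of
      y is a positive multiple of y or of k. At the extremum of y taken in the direction of k, both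
      have the sign of k, contrary to the second derivative test.\<close>
    have crit: "- D * (S + 2 * x t) * ((S + x t) * (y t + \<sigma> * x t) + k * x t) = - D * S\<^sup>2 *
        (if x t = 0 then y t else k)"
      if "- D * x t * (S + x t) = 0" for t
    proof -
      from that \<open>D \<noteq> 0\<close> consider "x t = 0" | "x t \<noteq> 0" "x t = - S" by fastforce
      then show ?thesis by cases (simp_all add: power2_eq_square)
    qed
    have per: "periodic T y" using periodic_compose[OF \<phi>(2)] unfolding y_def .
    have DS: "- D * S\<^sup>2 > 0" using True \<open>S \<noteq> 0\<close> by (simp add: mult_neg_pos)
    show False
    proof (cases "k > 0")
      case True
      obtain t where t: "\<And>s. y s \<le> y t" "- D * x t * (S + x t) = 0"
          "\<And>d. ((\<lambda>t. - D * x t * (S + x t)) has_real_derivative d) (at t) \<Longrightarrow> d \<le> 0"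
        using periodic_max[OF per dy] by blast
      from t(3)[OF dy'] DS have "(if x t = 0 then y t else k) \<le> 0" unfolding crit[OF t(2)] by (metis
          mult_le_0_iff not_less)
      then have "y t \<le> 0" using True by (simp split: if_splits)
      with t(1)[of 0] \<phi>(3) True show False by (simp add: y_def zero_less_mult_iff)
    next
      case False
      obtain t where t: "\<And>s. y t \<le> y s" "- D * x t * (S + x t) = 0"
          "\<And>d. ((\<lambda>t. - D * x t * (S + x t)) has_real_derivative d) (at t) \<Longrightarrow> 0 \<le> d"
        using periodic_min[OF per dy] by blast
      from t(3)[OF dy'] DS have "0 \<le> (if x t = 0 then y t else k)" unfolding crit[OF t(2)] by (metis
          zero_le_mult_iff not_less)
      then have "0 \<le> y t" using False \<open>k \<noteq> 0\<close> by (simp split: if_splits)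
      with t(1)[of 0] \<phi>(3) False show False by (simp add: y_def zero_less_mult_iff)
    qed
  next
    case False
    with \<open>D \<noteq> 0\<close> have D: "D > 0" by simp
    \<comment> \<open>This is the trace of the linear part in the coordinates p, q.\<close>
    define \<tau> where "\<tau> = \<sigma> * S + k"
    have line: False if \<phi>: "trajectory f \<phi>" "\<phi> 0 \<noteq> z" and x: "\<And>t. p \<bullet>
        (\<phi> t - z) = 0" for \<phi>
    proof -
      have "p \<bullet> f (\<phi> 0) = 0"
        using trajectory_inner[OF \<phi>(1), of p z 0] DERIV_unique[OF _ DERIV_const] unfolding x by blast
      then have "q \<bullet> (\<phi> 0 - z) = 0" unfolding f1 x using \<open>S \<noteq> 0\<close> by simp
      with x[of 0] away \<phi>(2) show False by blast
    qed
    show False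
    proof (cases "\<tau> = 0")
      case False
      obtain r where r: "r > 0" "\<And>x. dist x z \<le> r \<Longrightarrow> \<tau> * (\<tau> + \<sigma> *
          (p \<bullet> (x - z)) + 0 * (q \<bullet> (x - z))) > 0"
        using small_perturbation[OF False, of \<sigma> 0] by blast
      define V where "V x = D * (p \<bullet> (x - z))\<^sup>2 + (q \<bullet> (x - z))\<^sup>2" for x
      define W where "W x = 2 * D * (p \<bullet> (x - z))\<^sup>2 * (\<tau> + \<sigma> * (p \<bullet> (x - z)))" for x
      obtain \<phi> where \<phi>: "trajectory f \<phi>" "\<phi> 0 \<noteq> z" "\<And>t. dist (\<phi> t) z <
          r" "\<And>t. W (\<phi> t) = 0"
      proof (rule is_center_lyapunov[OF center r(1), of V W \<tau>])
        show "continuous_on UNIV V" unfolding V_def by (intro continuous_intros)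
        show "V z = 0" by (simp add: V_def)
        show "V x > 0" if "x \<noteq> z" for x
          using away[OF that] D by (auto simp: V_def add_pos_nonneg add_nonneg_pos)
        show "((\<lambda>t. V (\<phi> t)) has_real_derivative W (\<phi> t)) (at t)" if "trajectory f
            \<phi>" for \<phi> t
          unfolding V_def
          by (rule derivative_eq_intros trajectory_inner[OF that] refl)+
             (simp add: W_def f1 f2 \<tau>_def algebra_simps power2_eq_square)
        show "0 \<le> \<tau> * W x" if "dist x z \<le> r" for x
        proof -
          have "\<tau> * W x = 2 * D * (p \<bullet> (x - z))\<^sup>2 * (\<tau> * (\<tau> + \<sigma> * (p
              \<bullet> (x - z)) + 0 * (q \<bullet> (x - z))))"
            by (simp add: W_def)
          also have "\<dots> \<ge> 0" by (rule mult_nonneg_nonneg[OF _ less_imp_le[OF r(2)[OF that]]]) (use D in simp)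
          finally show ?thesis .
        qed
      qed (use False in auto)
      have "p \<bullet> (\<phi> t - z) = 0" for t
      proof -
        have "\<tau> + \<sigma> * (p \<bullet> (\<phi> t - z)) \<noteq> 0"
          using r(2)[OF less_imp_le[OF \<phi>(3)[of t]]] by auto
        then show ?thesis using \<phi>(4)[of t] D by (simp add: W_def)
      qed
      with line \<phi>(1,2) show False by blast
    next
      case True
      \<comment> \<open>The exponent \<open>c\<close> is chosen so that the cubic terms in the
        derivative of \<open>V\<close> cancel. The quartic term that remains has a constant
        sign.\<close>
      define K c where "K = k / S" and "c = - 2 * k / (S\<^sup>2 * D)"
      have \<sigma>: "\<sigma> = - K" using True \<open>S \<noteq> 0\<close> by (simp add: K_def \<tau>_def
          field_simps add_eq_0_iff)
      have kK: "k = K * S" using \<open>S \<noteq> 0\<close> by (simp add: K_def)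
      have cD: "c * D * S = - 2 * K" using \<open>S \<noteq> 0\<close> D by (simp add: c_def K_def power2_eq_square)
      have w: "continuous_on UNIV (\<lambda>u. exp (c * u))" by (intro continuous_intros)
      obtain P where P: "P 0 = 0" "\<And>u. (P has_real_derivative u * exp (c * u)) (at u)"
          "\<And>u. u \<noteq> 0 \<Longrightarrow> P u > 0" "continuous_on UNIV P"
        using weighted_primitive[OF w] exp_gt_zero by metis
      define V where "V x = exp (c * (q \<bullet> (x - z))) * (D * (p \<bullet> (x - z))\<^sup>2) + 2 * P
          (q \<bullet> (x - z))" for x
      define W where "W x = exp (c * (q \<bullet> (x - z))) * (2 * D * (K * (p \<bullet> (x - z)) ^ 4) / S)" for x
      obtain \<phi> where \<phi>: "trajectory f \<phi>" "\<phi> 0 \<noteq> z" "\<And>t. W (\<phi> t) = 0"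
      proof (rule is_center_lyapunov[OF center zero_less_one, of V W k])
        show "continuous_on UNIV V" unfolding V_def
          by (intro continuous_intros continuous_on_compose2[OF P(4)]) auto
        show "V z = 0" by (simp add: V_def P)
        show "V x > 0" if "x \<noteq> z" for x
        proof (cases "q \<bullet> (x - z) = 0")
          case True
          then show ?thesis using away[OF that] D by (simp add: V_def P)
        next
          case False
          from P(3)[OF this] show ?thesis using D unfolding V_def by (intro add_nonneg_pos) auto
        qed
        show "((\<lambda>t. V (\<phi> t)) has_real_derivative W (\<phi> t)) (at t)" if \<phi>: "trajectory
            f \<phi>" for \<phi> t
        proof -
          define x y where "x t = p \<bullet> (\<phi> t - z)" and "y t = q \<bullet> (\<phi> t - z)" for t
          have dx: "(x has_real_derivative (S + x t) * (y t + \<sigma> * x t) + k * x t) (at t)"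
            using trajectory_inner[OF \<phi>, of p z t] unfolding f1 x_def y_def .
          have dy: "(y has_real_derivative - D * x t * (S + x t)) (at t)"
            using trajectory_inner[OF \<phi>, of q z t] unfolding f2 x_def y_def .
          have dP: "((\<lambda>t. P (y t)) has_real_derivative y t * exp (c * y t) * (- D * x t * (S + x t))) (at t)"
            by (rule DERIV_chain2[OF P(2) dy])
          have "((\<lambda>t. exp (c * y t) * (D * (x t)\<^sup>2) + 2 * P (y t)) has_real_derivative
             exp (c * y t) * (c * (- D * x t * (S + x t))) * (D * (x t)\<^sup>2)
             + exp (c * y t) * (D * (2 * x t * ((S + x t) * (y t + \<sigma> * x t) + k * x t)))
             + 2 * (y t * exp (c * y t) * (- D * x t * (S + x t)))) (at t)"
            by (rule derivative_eq_intros dx dy dP refl)+ simp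
          moreover have "exp (c * y t) * (c * (- D * x t * (S + x t))) * (D * (x t)\<^sup>2)
             + exp (c * y t) * (D * (2 * x t * ((S + x t) * (y t + \<sigma> * x t) + k * x t)))
             + 2 * (y t * exp (c * y t) * (- D * x t * (S + x t)))
             = exp (c * y t) * (2 * D * (K * x t ^ 4) / S)"
          proof -
            have "S * (c * (- D * x t * (S + x t)) * (D * (x t)\<^sup>2)
               + D * (2 * x t * ((S + x t) * (y t + \<sigma> * x t) + k * x t))
               + 2 * (y t * (- D * x t * (S + x t)))) = 2 * D * (K * x t ^ 4)"
              using cD \<sigma> kK by algebra
            then have "c * (- D * x t * (S + x t)) * (D * (x t)\<^sup>2)
               + D * (2 * x t * ((S + x t) * (y t + \<sigma> * x t) + k * x t))
               + 2 * (y t * (- D * x t * (S + x t))) = 2 * D * (K * x t ^ 4) / S"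
              using \<open>S \<noteq> 0\<close> by (simp add: eq_divide_eq mult.commute)
            from arg_cong[OF this, of "\<lambda>u. exp (c * y t) * u"] show ?thesis by (simp only: algebra_simps)
          qed
          ultimately show ?thesis by (simp only: V_def W_def x_def y_def)
        qed
        show "0 \<le> k * W x" for x
        proof -
          have "k * W x = exp (c * (q \<bullet> (x - z))) * (2 * D * (K * (p \<bullet> (x - z))\<^sup>2)\<^sup>2)"
            unfolding W_def kK using \<open>S \<noteq> 0\<close> by (simp add: field_simps eval_nat_numeral)
          also have "\<dots> \<ge> 0" using D by (intro mult_nonneg_nonneg) auto
          finally show ?thesis .
        qed
      qed (use \<open>k \<noteq> 0\<close> in auto)
      have "K \<noteq> 0" using \<open>k \<noteq> 0\<close> \<open>S \<noteq> 0\<close> by (simp add: K_def)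
      then have "p \<bullet> (\<phi> t - z) = 0" for t
        using \<phi>(3)[of t] D \<open>S \<noteq> 0\<close> by (simp add: W_def)
      with line \<phi>(1,2) show False by blast
    qed
  qed
qed

end

section \<open>Normal forms\<close>

text \<open>A nonzero entry of the first row determines the ratio of the rows. If the first row is
  zero, the second one is the common row.\<close>

lemma rank_one_minors:
  fixes p1 p2 p3 q1 q2 q3 :: real
  assumes "p1 * q2 = p2 * q1" "p1 * q3 = p3 * q1" "p2 * q3 = p3 * q2"
  obtains w1 w2 r s t where "p1 = w1 * r" "p2 = w1 * s" "p3 = w1 * t" "q1 = w2 * r" "q2 = w2 * s" "q3 = w2 * t"
proof -
  consider "p1 \<noteq> 0" | "p2 \<noteq> 0" | "p3 \<noteq> 0" | "p1 = 0" "p2 = 0" "p3 = 0" by blast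
  then show thesis
  proof cases
    case 1 show thesis by (rule that[of 1 p1 p2 p3 "q1 / p1"]) (use 1 assms in \<open>auto simp: field_simps\<close>)
  next
    case 2 show thesis by (rule that[of 1 p1 p2 p3 "q2 / p2"]) (use 2 assms in \<open>auto simp: field_simps\<close>)
  next
    case 3 show thesis by (rule that[of 1 p1 p2 p3 "q3 / p3"]) (use 3 assms in \<open>auto simp: field_simps\<close>)
  next
    case 4 show thesis by (rule that[of 0 q1 q2 q3 1]) (use 4 in auto)
  qed
qed

section \<open>Reduction to the normal form when \<open>B3\<close> = 0\<close>

context
  fixes a0 w :: "real ^ 2" and a1 :: "real ^ 2 ^ 2" and a2 :: "real ^ 2 ^ 2 ^ 2" and r s t l1 l2 :: real
  assumes a2: "\<And>j. a2 $ j $ 1 $ 1 = w $ j * r" "\<And>j. a2 $ j $ 1 $ 2 = w $ j * s"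
     "\<And>j. a2 $ j $ 2 $ 1 = w $ j * s" "\<And>j. a2 $ j $ 2 $ 2 = w $ j * t"
  and l: "l1 = w $ 1 * a1 $ 2 $ 1 - w $ 2 * a1 $ 1 $ 1" "l2 = w $ 1 * a1 $ 2 $ 2 - w $ 2 * a1 $ 1 $ 2"
begin

lemma sym_rank_one: "a2 $ j $ \<alpha> $ \<beta> = a2 $ j $ \<beta> $ \<alpha>"
  using exhaust_2[of \<alpha>] exhaust_2[of \<beta>] by (auto simp: a2)

lemma B_forms_rank_one:
  "B1 a1 a2 = lin (l1 * s - l2 * r) (l1 * t - l2 * s)"
  "B3 a2 = quad 0 0 0"
  "B4 a0 a2 = cst (w $ 2 * a0 $ 1 - w $ 1 * a0 $ 2) * quad r (2 * s) t"
  "B5 a1 a2 = - (lin l1 l2 * quad r (2 * s) t)"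
  unfolding B1_eq[OF sym_rank_one] B3_def H_hat_eq[OF sym_rank_one] B4_def B5_def P_eqs[OF sym_rank_one] a2 l
  by (simp_all only: form_mult form_diff form_uminus form_inject) (simp_all add: algebra_simps)

text \<open>The scalar factor is the quadratic form evaluated at (l2, -l1), a zero of l. For a
  nonzero quadratic form, G = 0 therefore says that l divides it.\<close>

lemma comitant_G_rank_one:
  "comitant_G a0 a1 a2 = cst (r * l2\<^sup>2 - 2 * s * l1 * l2 + t * l1\<^sup>2) * quad r (2 * s) t"
  unfolding comitant_G_def B_forms_rank_one form_numeral form_mult form_uminus form_transvectant form_diff
      form_add form_inject
  by (intro conjI; simp add: field_simps power2_eq_square)

lemma comitant_F_rank_one:
  "comitant_F a0 a1 a2 = - ((cst (J1 a1) * lin l1 l2 + cst (2 * (w $ 1 * a0 $ 2 - w $ 2 * a0 $ 1)) * lin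
      (l1 * s - l2 * r) (l1 * t - l2 * s)) * quad r (2 * s) t)"
  unfolding comitant_F_def B_forms_rank_one form_numeral form_mult form_uminus form_add
  by (simp add: form_mult form_add form_uminus B2_def form_inject quad_def[of 0 0 0] algebra_simps)

end

lemma split_quadratic:
  fixes l1 l2 r s t :: real
  assumes "r * l2\<^sup>2 - 2 * s * l1 * l2 + t * l1\<^sup>2 = 0" "l1 \<noteq> 0 \<or> l2 \<noteq> 0"
  obtains m1 m2 where "r = l1 * m1" "s = (l1 * m2 + l2 * m1) / 2" "t = l2 * m2"
proof (cases "l1 = 0")
  case True
  with assms have "l2 \<noteq> 0" "r = 0" by auto
  then show thesis using True by (intro that[of "2 * s / l2" "t / l2"]) auto
next
  case False
  define m1 m2 where "m1 = r / l1" and "m2 = (2 * s - l2 * m1) / l1"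
  have 1: "r = l1 * m1" using False by (simp add: m1_def)
  have 2: "2 * s = l1 * m2 + l2 * m1" using False by (simp add: m2_def)
  have "l1\<^sup>2 * (t - l2 * m2) = 0" using assms(1) unfolding 1 using 2 by algebra
  with False have "t = l2 * m2" by simp
  with 1 2 show thesis by (intro that[of m1 m2]) auto
qed

text \<open>\<open>B3\<close> = 0 makes all quadratic coefficients multiples of one vector w. F
  \<noteq> 0 keeps l and the quadratic form nonzero, so G = 0 splits the form as l m. Then F is a
  multiple of l times this form with scalar -d, and d turns out to be the determinant at the
  singular point.\<close>

lemma normal_form_rank_one:
  fixes a0 :: "real ^ 2" and a1 :: "real ^ 2 ^ 2" and a2 :: "real ^ 2 ^ 2 ^ 2"
  assumes sym: "\<And>j \<alpha> \<beta>. a2 $ j $ \<alpha> $ \<beta> = a2 $ j $ \<beta> $ \<alpha>"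
    and B3: "B3 a2 = 0" and G: "comitant_G a0 a1 a2 = 0" and F: "comitant_F a0 a1 a2 \<noteq> 0"
  obtains w l m z :: "real ^ 2" and A :: "real ^ 2 ^ 2" where
    "\<And>j \<alpha> \<beta>. a2 $ j $ \<alpha> $ \<beta> = w $ j * ((l $ \<alpha> * m $ \<beta> + l $
        \<beta> * m $ \<alpha>) / 2)"
    "\<And>\<alpha>. l $ \<alpha> = w $ 1 * A $ 2 $ \<alpha> - w $ 2 * A $ 1 $ \<alpha>"
    "\<And>j \<alpha>. a1 $ j $ \<alpha> = A $ j $ \<alpha> - 2 * (a2 $ j $ \<alpha> $ 1 * z $ 1 + a2 $ j $
        \<alpha> $ 2 * z $ 2)"
    "\<And>j. a0 $ j = a2 $ j $ 1 $ 1 * (z $ 1)\<^sup>2 + 2 * a2 $ j $ 1 $ 2 * z $ 1 * z $ 2 + a2 $ j $ 2 $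
        2 * (z $ 2)\<^sup>2
       - (A $ j $ 1 * z $ 1 + A $ j $ 2 * z $ 2)"
    "A $ 1 $ 1 * A $ 2 $ 2 - A $ 1 $ 2 * A $ 2 $ 1 \<noteq> 0" "l \<noteq> 0" "m \<noteq> 0"
proof -
  from B3 have "a2 $ 1 $ 1 $ 1 * a2 $ 2 $ 1 $ 2 = a2 $ 1 $ 1 $ 2 * a2 $ 2 $ 1 $ 1"
    "a2 $ 1 $ 1 $ 1 * a2 $ 2 $ 2 $ 2 = a2 $ 1 $ 2 $ 2 * a2 $ 2 $ 1 $ 1"
    "a2 $ 1 $ 1 $ 2 * a2 $ 2 $ 2 $ 2 = a2 $ 1 $ 2 $ 2 * a2 $ 2 $ 1 $ 2"
    unfolding B3_def H_hat_eq[OF sym] form_eq_0 by auto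
  then obtain w1 w2 r s t where R: "a2 $ 1 $ 1 $ 1 = w1 * r" "a2 $ 1 $ 1 $ 2 = w1 * s" "a2 $ 1 $ 2 $ 2 = w1 * t"
      "a2 $ 2 $ 1 $ 1 = w2 * r" "a2 $ 2 $ 1 $ 2 = w2 * s" "a2 $ 2 $ 2 $ 2 = w2 * t"
    by (rule rank_one_minors)
  define w :: "real ^ 2" where "w = vector [w1, w2]"
  have a2: "a2 $ j $ 1 $ 1 = w $ j * r" "a2 $ j $ 1 $ 2 = w $ j * s" "a2 $ j $ 2 $ 1 = w $ j * s" "a2 $ j $
      2 $ 2 = w $ j * t" for j
    using exhaust_2[of j] by (auto simp: w_def R sym[of _ 2 1])
  define l1 where "l1 = w $ 1 * a1 $ 2 $ 1 - w $ 2 * a1 $ 1 $ 1"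
  define l2 where "l2 = w $ 1 * a1 $ 2 $ 2 - w $ 2 * a1 $ 1 $ 2"
  define k where "k = w $ 1 * a0 $ 2 - w $ 2 * a0 $ 1"
  have F': "- ((cst (J1 a1) * lin l1 l2 + cst (2 * k) * lin (l1 * s - l2 * r) (l1 * t - l2 * s)) * quad r
      (2 * s) t) \<noteq> 0"
    using F unfolding comitant_F_rank_one[OF a2 l1_def l2_def] k_def .
  have lnz: "l1 \<noteq> 0 \<or> l2 \<noteq> 0"
  proof (rule ccontr)
    assume "\<not> (l1 \<noteq> 0 \<or> l2 \<noteq> 0)"
    then show False using F' by (simp add: form_mult form_add form_eq_0 form_uminus)
  qed
  have Rnz: "quad r (2 * s) t \<noteq> 0" using F' by auto
  have "r * l2\<^sup>2 - 2 * s * l1 * l2 + t * l1\<^sup>2 = 0"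
    using G Rnz unfolding comitant_G_rank_one[OF a2 l1_def l2_def] by (auto simp: form_eq_0)
  then obtain m1 m2 where m: "r = l1 * m1" "s = (l1 * m2 + l2 * m1) / 2" "t = l2 * m2"
    using lnz by (rule split_quadratic)
  define al where "al = l1 * m2 - l2 * m1"
  define d where "d = J1 a1 + k * al"
  have "l1 * s - l2 * r = al / 2 * l1" "l1 * t - l2 * s = al / 2 * l2"
    by (simp_all add: m al_def field_simps)
  then have eqF: "cst (J1 a1) * lin l1 l2 + cst (2 * k) * lin (l1 * s - l2 * r) (l1 * t - l2 * s) = cst d * lin l1 l2"
    by (simp add: form_mult form_add form_inject d_def algebra_simps)
  have d: "d \<noteq> 0"
  proof
    assume "d = 0"
    then show False using F' unfolding eqF by (simp add: form_mult form_eq_0 form_uminus)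
  qed
  \<comment> \<open>Taking w x of the field shows that a singular point satisfies l(x) = -k. On that
    line the quadratic part is -k m(x) w, so the remaining equation is linear with matrix
    \<open>M\<close>. Its determinant is d, and \<open>z1\<close>, \<open>z2\<close> come from
    Cramer's rule.\<close>
  define M where "M i j = a1 $ i $ j - k * w $ i * (if j = 1 then m1 else m2)" for i j :: 2
  have M': "M i 1 = a1 $ i $ 1 - k * w $ i * m1" "M i 2 = a1 $ i $ 2 - k * w $ i * m2" for i
    by (simp_all add: M_def)
  have dM: "M 1 1 * M 2 2 - M 1 2 * M 2 1 = d"
    unfolding M' d_def J1_eq al_def l1_def l2_def by algebra
  define z1 where "z1 = (M 1 2 * a0 $ 2 - M 2 2 * a0 $ 1) / d"
  define z2 where "z2 = (M 2 1 * a0 $ 1 - M 1 1 * a0 $ 2) / d"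
  have z: "d * z1 = M 1 2 * a0 $ 2 - M 2 2 * a0 $ 1" "d * z2 = M 2 1 * a0 $ 1 - M 1 1 * a0 $ 2"
    using d by (simp_all add: z1_def z2_def)
  have "d * (M 1 1 * z1 + M 1 2 * z2 + a0 $ 1) = 0" "d * (M 2 1 * z1 + M 2 2 * z2 + a0 $ 2) = 0"
    using z dM by algebra+
  then have Mz: "M 1 1 * z1 + M 1 2 * z2 = - a0 $ 1" "M 2 1 * z1 + M 2 2 * z2 = - a0 $ 2"
    using d by (simp_all add: add_eq_0_iff2)
  have lz: "l1 * z1 + l2 * z2 = - k"
    using Mz unfolding M' k_def l1_def l2_def by algebra
  define lmz where "lmz = m1 * z1 + m2 * z2"
  define l m z :: "real ^ 2" where "l = vector [l1, l2]" and "m = vector [m1, m2]" and "z = vector [z1, z2]"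
  \<comment> \<open>This is the Jacobian matrix at z, with l(z) = -k inserted.\<close>
  define A :: "real ^ 2 ^ 2" where "A = (\<chi> i j. a1 $ i $ j + w $ i * (l $ j * lmz + m $ j * (- k)))"
  have v: "l $ 1 = l1" "l $ 2 = l2" "m $ 1 = m1" "m $ 2 = m2" "z $ 1 = z1" "z $ 2 = z2"
    by (simp_all add: l_def m_def z_def)
  have A: "A $ i $ j = a1 $ i $ j + w $ i * (l $ j * lmz + m $ j * (- k))" for i j
    by (simp add: A_def)
  show thesis
  proof (rule that[of w l m A z])
    show *: "a2 $ j $ \<alpha> $ \<beta> = w $ j * ((l $ \<alpha> * m $ \<beta> + l $ \<beta> * m $
        \<alpha>) / 2)" for j \<alpha> \<beta>
      using exhaust_2[of \<alpha>] exhaust_2[of \<beta>] by (auto simp: a2 v m algebra_simps)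
    show "l $ \<alpha> = w $ 1 * A $ 2 $ \<alpha> - w $ 2 * A $ 1 $ \<alpha>" for \<alpha>
      using exhaust_2[of \<alpha>] by (auto simp: A v l1_def l2_def algebra_simps)
    show "a1 $ j $ \<alpha> = A $ j $ \<alpha> - 2 * (a2 $ j $ \<alpha> $ 1 * z $ 1 + a2 $ j $ \<alpha> $ 2
        * z $ 2)" for j \<alpha>
    proof -
      have "2 * (a2 $ j $ \<alpha> $ 1 * z $ 1 + a2 $ j $ \<alpha> $ 2 * z $ 2) = w $ j * (l $ \<alpha> *
          lmz + m $ \<alpha> * (l1 * z1 + l2 * z2))"
        unfolding * v lmz_def by (simp add: field_simps)
      then show ?thesis unfolding A lz by simp
    qed
    show "a0 $ j = a2 $ j $ 1 $ 1 * (z $ 1)\<^sup>2 + 2 * a2 $ j $ 1 $ 2 * z $ 1 * z $ 2 + a2 $ j $ 2 $ 2 *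
        (z $ 2)\<^sup>2
       - (A $ j $ 1 * z $ 1 + A $ j $ 2 * z $ 2)" for j
    proof -
      have e: "a2 $ j $ 1 $ 1 * (z $ 1)\<^sup>2 + 2 * a2 $ j $ 1 $ 2 * z $ 1 * z $ 2 + a2 $ j $ 2 $ 2 * (z
          $ 2)\<^sup>2
          = w $ j * ((l1 * z1 + l2 * z2) * lmz)"
        unfolding * v lmz_def by (simp add: field_simps power2_eq_square)
      have "M j 1 * z1 + M j 2 * z2 = - a0 $ j" using exhaust_2[of j] Mz by auto
      then have "a1 $ j $ 1 * z1 + a1 $ j $ 2 * z2 - k * w $ j * lmz = - a0 $ j"
        unfolding M' lmz_def by (simp add: algebra_simps)
      moreover have "A $ j $ 1 * z $ 1 + A $ j $ 2 * z $ 2 =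
         a1 $ j $ 1 * z1 + a1 $ j $ 2 * z2 + w $ j * ((l1 * z1 + l2 * z2) * lmz - k * lmz)"
        unfolding A v lmz_def by (simp add: algebra_simps)
      ultimately show ?thesis unfolding e lz by (simp add: algebra_simps)
    qed
    have "A $ 1 $ 1 * A $ 2 $ 2 - A $ 1 $ 2 * A $ 2 $ 1 = d"
      unfolding A v d_def J1_eq al_def l1_def l2_def by algebra
    with d show "A $ 1 $ 1 * A $ 2 $ 2 - A $ 1 $ 2 * A $ 2 $ 1 \<noteq> 0" by simp
    show "l \<noteq> 0" using lnz v by (metis zero_index)
    show "m \<noteq> 0"
    proof
      assume "m = 0"
      then have "m1 = 0" "m2 = 0" using v by (metis zero_index)+
      then show False using Rnz m by (simp add: form_eq_0)
    qed
  qed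
qed

section \<open>Reduction to the normal form when \<open>B3\<close> is not zero\<close>

lemma perfect_square:
  fixes b0 b1 b2 :: real
  assumes "b1\<^sup>2 = 4 * b0 * b2"
  obtains k x1 x2 y1 y2 where "b0 = k * x1\<^sup>2" "b1 = 2 * k * x1 * x2" "b2 = k * x2\<^sup>2" "x1 * y2 -
      x2 * y1 = 1"
proof (cases "b0 = 0")
  case True
  with assms have "b1 = 0" by simp
  with True show thesis by (intro that[of b2 0 1 0 "-1"]) auto
next
  case False
  show thesis
  proof (rule that[of b0 1 "b1 / (2 * b0)" 1 0])
    show "b2 = b0 * (b1 / (2 * b0))\<^sup>2" using False assms by (simp add: power_divide field_simps
        power2_eq_square)
  qed (use False in auto)
qed

lemma normal_form_common_factor:
  fixes a0 :: "real ^ 2" and a1 :: "real ^ 2 ^ 2" and a2 :: "real ^ 2 ^ 2 ^ 2"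
  assumes sym: "\<And>j \<alpha> \<beta>. a2 $ j $ \<alpha> $ \<beta> = a2 $ j $ \<beta> $ \<alpha>"
    and mu: "comitant_mu a2 = 0" and H: "comitant_H a1 a2 = 0"
    and G: "comitant_G a0 a1 a2 = 0" and F: "comitant_F a0 a1 a2 \<noteq> 0" and B3: "B3 a2 \<noteq> 0"
  obtains g h \<xi> \<eta> :: "real ^ 2" and \<beta> \<gamma> s c where
    "\<And>j i k. a2 $ j $ i $ k = g $ j * \<xi> $ i * \<xi> $ k + h $ j * ((\<xi> $ i * \<eta> $ k + \<xi>
        $ k * \<eta> $ i) / 2)"
    "\<And>j i. a1 $ j $ i = (\<beta> * g $ j + \<gamma> * h $ j) * \<xi> $ i + s * h $ j * \<eta> $ i"
    "\<And>j. a0 $ j = s * (\<beta> - s) * g $ j + c * h $ j"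
    "cross \<xi> \<eta> = 1" "cross g h \<noteq> 0"
    "\<beta> \<noteq> 2 * s" "s * \<gamma> \<noteq> c"
proof -
  define b0 where "b0 = a2 $ 1 $ 1 $ 1 * a2 $ 2 $ 1 $ 2 - a2 $ 1 $ 1 $ 2 * a2 $ 2 $ 1 $ 1"
  define b1 where "b1 = a2 $ 1 $ 1 $ 1 * a2 $ 2 $ 2 $ 2 - a2 $ 1 $ 2 $ 2 * a2 $ 2 $ 1 $ 1"
  define b2 where "b2 = a2 $ 1 $ 1 $ 2 * a2 $ 2 $ 2 $ 2 - a2 $ 1 $ 2 $ 2 * a2 $ 2 $ 1 $ 2"
  have b: "B3 a2 = quad b0 b1 b2"
    unfolding B3_def H_hat_eq[OF sym] b0_def b1_def b2_def ..
  have "scalar (- 2 * transvectant 2 2 2 (quad b0 b1 b2) (quad b0 b1 b2)) = b1\<^sup>2 - 4 * b0 * b2"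
    unfolding form_numeral form_transvectant form_uminus form_mult scalar_cst by (simp add: field_simps
        power2_eq_square)
  with mu have "b1\<^sup>2 = 4 * b0 * b2" by (simp add: comitant_mu_def b)
  then obtain k x1 x2 y1 y2 where kx: "b0 = k * x1\<^sup>2" "b1 = 2 * k * x1 * x2" "b2 = k * x2\<^sup>2"
      and d: "x1 * y2 - x2 * y1 = 1"
    by (rule perfect_square)
  have k: "k \<noteq> 0" using B3 unfolding b kx by (auto simp: form_eq_0)
  define \<xi> \<eta> :: "real ^ 2" where "\<xi> = vector [x1, x2]" and "\<eta> = vector [y1, y2]"
  have v: "\<xi> $ 1 = x1" "\<xi> $ 2 = x2" "\<eta> $ 1 = y1" "\<eta> $ 2 = y2" by (simp_all add: \<xi>_def
      \<eta>_def)
  \<comment> \<open>\<open>(y2, -y1)\<close>, \<open>(-x2, x1)\<close> is the frame dual to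
      \<open>\<xi>\<close>, \<open>\<eta>\<close>.\<close>
  define g h :: "real ^ 2"
    where "g = (\<chi> j. a2 $ j $ 1 $ 1 * y2\<^sup>2 - 2 * a2 $ j $ 1 $ 2 * y1 * y2 + a2 $ j $ 2 $ 2 * y1\<^sup>2)"
      and "h = (\<chi> j. 2 * (- a2 $ j $ 1 $ 1 * y2 * x2 + a2 $ j $ 1 $ 2 * (x1 * y2 + x2 * y1) - a2 $ j $
          2 $ 2 * x1 * y1))"
  \<comment> \<open>Both quadratic parts vanish at (-x2, x1), the double root of \<open>B3\<close>;
    hence \<xi> divides them.\<close>
  have "k * (a2 $ 1 $ 1 $ 1 * x2\<^sup>2 - 2 * a2 $ 1 $ 1 $ 2 * x1 * x2 + a2 $ 1 $ 2 $ 2 * x1\<^sup>2) = 0"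
    "k * (a2 $ 2 $ 1 $ 1 * x2\<^sup>2 - 2 * a2 $ 2 $ 1 $ 2 * x1 * x2 + a2 $ 2 $ 2 $ 2 * x1\<^sup>2) = 0"
    using kx unfolding b0_def b1_def b2_def by algebra+
  then have ee: "a2 $ j $ 1 $ 1 * x2\<^sup>2 - 2 * a2 $ j $ 1 $ 2 * x1 * x2 + a2 $ j $ 2 $ 2 * x1\<^sup>2 = 0" for j
    using k exhaust_2[of j] by auto
  have a2': "a2 $ j $ 1 $ 1 = g $ j * x1 * x1 + h $ j * ((x1 * y1 + x1 * y1) / 2)"
    "a2 $ j $ 1 $ 2 = g $ j * x1 * x2 + h $ j * ((x1 * y2 + x2 * y1) / 2)"
    "a2 $ j $ 2 $ 2 = g $ j * x2 * x2 + h $ j * ((x2 * y2 + x2 * y2) / 2)" for j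
  proof -
    have gj: "g $ j = a2 $ j $ 1 $ 1 * y2\<^sup>2 - 2 * a2 $ j $ 1 $ 2 * y1 * y2 + a2 $ j $ 2 $ 2 * y1\<^sup>2"
      by (simp add: g_def)
    obtain h' where h': "h $ j = 2 * h'"
      "h' = - a2 $ j $ 1 $ 1 * y2 * x2 + a2 $ j $ 1 $ 2 * (x1 * y2 + x2 * y1) - a2 $ j $ 2 $ 2 * x1 * y1"
      by (simp add: h_def)
    have "a2 $ j $ 1 $ 1 = g $ j * x1 * x1 + h' * (x1 * y1 + x1 * y1)"
      "a2 $ j $ 1 $ 2 = g $ j * x1 * x2 + h' * (x1 * y2 + x2 * y1)"
      "a2 $ j $ 2 $ 2 = g $ j * x2 * x2 + h' * (x2 * y2 + x2 * y2)"
      using gj h'(2) ee[of j] d by algebra+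
    then show "a2 $ j $ 1 $ 1 = g $ j * x1 * x1 + h $ j * ((x1 * y1 + x1 * y1) / 2)"
      "a2 $ j $ 1 $ 2 = g $ j * x1 * x2 + h $ j * ((x1 * y2 + x2 * y1) / 2)"
      "a2 $ j $ 2 $ 2 = g $ j * x2 * x2 + h $ j * ((x2 * y2 + x2 * y2) / 2)"
      unfolding h'(1) by simp_all
  qed
  have a2: "a2 $ j $ i $ k = g $ j * \<xi> $ i * \<xi> $ k + h $ j * ((\<xi> $ i * \<eta> $ k + \<xi> $ k *
      \<eta> $ i) / 2)" for j i k
    using exhaust_2[of i] exhaust_2[of k] by (auto simp: v a2' sym[of _ 2 1] algebra_simps)
  define \<Gamma> where "\<Gamma> = g $ 1 * h $ 2 - g $ 2 * h $ 1"
  have "b0 = \<Gamma> / 2 * x1\<^sup>2 * (x1 * y2 - x2 * y1)" "b1 = \<Gamma> * x1 * x2 * (x1 * y2 - x2 *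
      y1)" "b2 = \<Gamma> / 2 * x2\<^sup>2 * (x1 * y2 - x2 * y1)"
    unfolding b0_def b1_def b2_def a2' \<Gamma>_def by (simp_all add: field_simps power2_eq_square)
  then have \<Gamma>: "\<Gamma> \<noteq> 0" using B3 unfolding b by (auto simp: form_eq_0)
  \<comment> \<open>The vector (e1, e2) is the image of (-x2, x1) under the linear part. H = 0 makes
    it parallel to h, which removes a term g \<eta> from the normal form of
    \<open>a1\<close>.\<close>
  define e1 e2 where "e1 = - a1 $ 1 $ 1 * x2 + a1 $ 1 $ 2 * x1" and "e2 = - a1 $ 2 $ 1 * x2 + a1 $ 2 $ 2 * x1"
  have B1: "B1 a1 a2 = lin (a1 $ 1 $ 2 * a2 $ 2 $ 1 $ 1 - a1 $ 1 $ 1 * a2 $ 2 $ 1 $ 2 - a1 $ 2 $ 2 * a2 $ 1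
      $ 1 $ 1 + a1 $ 2 $ 1 * a2 $ 1 $ 1 $ 2)
     (a1 $ 1 $ 2 * a2 $ 2 $ 1 $ 2 - a1 $ 1 $ 1 * a2 $ 2 $ 2 $ 2 - a1 $ 2 $ 2 * a2 $ 1 $ 1 $ 2 + a1 $ 2 $ 1
         * a2 $ 1 $ 2 $ 2)" (is "_ = lin ?u ?v")
    by (rule B1_eq[OF sym])
  have "x1 * ?v - x2 * ?u = (e1 * h $ 2 - e2 * h $ 1) / 2 * (x1 * y2 - x2 * y1)"
    unfolding e1_def e2_def a2' by (simp add: field_simps)
  then have uv: "x1 * ?v - x2 * ?u = (e1 * h $ 2 - e2 * h $ 1) / 2" by (simp add: d)
  have "comitant_H a1 a2 = cst (2 * k * (x1 * ?v - x2 * ?u)) * lin x1 x2"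
    unfolding comitant_H_def b B1 kx form_numeral form_transvectant form_mult form_inject
    by (simp add: field_simps power2_eq_square)
  with H have "(x1 * ?v - x2 * ?u = 0) \<or> lin x1 x2 = 0" using k by (simp add: form_eq_0)
  then have "x1 * ?v - x2 * ?u = 0" using d by (auto simp: form_eq_0)
  then have eh: "e1 * h $ 2 = e2 * h $ 1" unfolding uv by simp
  have "\<exists>s. e1 = s * h $ 1 \<and> e2 = s * h $ 2"
  proof (cases "h $ 1 = 0")
    case True
    then have "h $ 2 \<noteq> 0" using \<Gamma> by (auto simp: \<Gamma>_def)
    with True eh show ?thesis by (intro exI[of _ "e2 / h $ 2"]) auto
  next
    case False
    with eh show ?thesis by (intro exI[of _ "e1 / h $ 1"]) (auto simp: field_simps)
  qed
  then obtain s where s: "e1 = s * h $ 1" "e2 = s * h $ 2" by blast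
  have cramer: "\<exists>p q. u1 = p * g $ 1 + q * h $ 1 \<and> u2 = p * g $ 2 + q * h $ 2" for u1 u2
    using \<Gamma> by (intro exI[of _ "(u1 * h $ 2 - u2 * h $ 1) / \<Gamma>"] exI[of _ "(g $ 1 * u2 - g $ 2
        * u1) / \<Gamma>"])
      (simp add: add_divide_distrib[symmetric] eq_divide_eq, simp add: \<Gamma>_def algebra_simps)
  define f1 f2 where "f1 = a1 $ 1 $ 1 * y2 - a1 $ 1 $ 2 * y1" and "f2 = a1 $ 2 $ 1 * y2 - a1 $ 2 $ 2 * y1"
  obtain \<beta> \<gamma> where \<beta>: "f1 = \<beta> * g $ 1 + \<gamma> * h $ 1" "f2 = \<beta> * g $ 2 +
      \<gamma> * h $ 2"
    using cramer by blast
  obtain a c where ac: "a0 $ 1 = a * g $ 1 + c * h $ 1" "a0 $ 2 = a * g $ 2 + c * h $ 2"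
    using cramer by blast
  have "a1 $ 1 $ 1 = f1 * x1 + e1 * y1" "a1 $ 1 $ 2 = f1 * x2 + e1 * y2"
    "a1 $ 2 $ 1 = f2 * x1 + e2 * y1" "a1 $ 2 $ 2 = f2 * x2 + e2 * y2"
    unfolding f1_def f2_def e1_def e2_def using d by algebra+
  then have a1: "a1 $ j $ i = (\<beta> * g $ j + \<gamma> * h $ j) * \<xi> $ i + s * h $ j * \<eta> $ i" for j i
    using exhaust_2[of i] exhaust_2[of j] by (auto simp: v \<beta> s)
  have a0: "a0 $ j = a * g $ j + c * h $ j" for j
    using exhaust_2[of j] ac by auto
  have \<delta>: "cross \<xi> \<eta> = 1" by (simp add: cross_def v d)
  have \<Gamma>': "cross g h = \<Gamma>" by (simp add: cross_def \<Gamma>_def)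
  have L: "linear_form \<xi> \<noteq> 0" using d by (auto simp: linear_form_def v form_eq_0)
  have a: "a = s * (\<beta> - s)"
    using G \<Gamma> L unfolding comitant_G_common_factor[OF a2 a1 a0] \<Gamma>' \<delta> by (simp add: form_eq_0)
  have "(\<beta> - 2 * s) * (s * \<gamma> - c) \<noteq> 0"
  proof
    assume "(\<beta> - 2 * s) * (s * \<gamma> - c) = 0"
    then have e: "cross \<xi> \<eta> * (cross g h)\<^sup>2 * (\<beta> - 2 * s) * (s * \<gamma> - c) = 0" by
        (simp only: mult.assoc mult_zero_right)
    show False using F unfolding comitant_F_common_factor[OF a2 a1 a0 a] e by (simp only: cst_0 mult_zero_left)
  qed
  then have "\<beta> \<noteq> 2 * s" "s * \<gamma> \<noteq> c" by auto
  moreover have "cross g h \<noteq> 0" using \<Gamma> \<Gamma>' by simp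
  ultimately show thesis
    using a2 a1 a0 \<delta> unfolding a by (intro that[of g \<xi> h \<eta> \<beta> \<gamma> s c])
qed

section \<open>The center problem for the normal forms\<close>

lemma vector_field_nth:
  "vector_field a0 a1 a2 x $ j = a0 $ j + (a1 $ j $ 1 * x $ 1 + a1 $ j $ 2 * x $ 2)
     + (a2 $ j $ 1 $ 1 * x $ 1 * x $ 1 + a2 $ j $ 1 $ 2 * x $ 1 * x $ 2
        + (a2 $ j $ 2 $ 1 * x $ 2 * x $ 1 + a2 $ j $ 2 $ 2 * x $ 2 * x $ 2))"
  by (simp add: vector_field_def contract_2)

lemma inner_2: "u \<bullet> v = u $ 1 * v $ 1 + u $ 2 * v $ 2" for u v :: "real ^ 2"
  by (simp add: inner_vec_def sum_2)

lemma vec_eq_2: "u = v \<longleftrightarrow> u $ 1 = v $ 1 \<and> u $ 2 = v $ 2" for u v :: "real ^ 2"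
  by (simp add: vec_eq_iff forall_2)

text \<open>On \<xi> = -s the h-component is c - s \<gamma> \<noteq> 0, so every singular point lies
  on \<xi> = s - \<beta>. Centering there gives X (X + S) g + (t X + Y (X + S)) h. If \<xi>(h) = 0,
  the equation for X is autonomous with a second invariant line; otherwise the field is of Lienard
  type.\<close>

lemma no_center_common_factor:
  fixes a0 g h \<xi> \<eta> :: "real ^ 2" and a1 :: "real ^ 2 ^ 2" and a2 :: "real ^ 2 ^ 2 ^ 2"
  assumes a2: "\<And>j i k. a2 $ j $ i $ k = g $ j * \<xi> $ i * \<xi> $ k + h $ j * ((\<xi> $ i * \<eta> $
      k + \<xi> $ k * \<eta> $ i) / 2)"
    and a1: "\<And>j i. a1 $ j $ i = (\<beta> * g $ j + \<gamma> * h $ j) * \<xi> $ i + s * h $ j * \<eta> $ i"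
    and a0: "\<And>j. a0 $ j = s * (\<beta> - s) * g $ j + c * h $ j"
    and \<delta>: "cross \<xi> \<eta> = 1" and \<Gamma>: "cross g h \<noteq> 0" and nz: "\<beta> \<noteq> 2
        * s" "s * \<gamma> \<noteq> c"
  shows "\<not> is_center (vector_field a0 a1 a2) z"
proof
  let ?f = "vector_field a0 a1 a2"
  assume center: "is_center ?f z"
  have f: "?f x = (((\<xi> \<bullet> x) + s) * ((\<xi> \<bullet> x) + \<beta> - s)) *\<^sub>R g + (c +
      \<gamma> * (\<xi> \<bullet> x) + (\<eta> \<bullet> x) * (s + \<xi> \<bullet> x)) *\<^sub>R h" for x
    unfolding vec_eq_2 vector_field_nth a0 a1 a2 inner_2 by (simp add: algebra_simps)
  have indep: "u = 0 \<and> v = 0" if "u *\<^sub>R g + v *\<^sub>R h = 0" for u v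
  proof -
    have "u * g $ 1 + v * h $ 1 = 0" "u * g $ 2 + v * h $ 2 = 0" using that by (simp_all add: vec_eq_2)
    then have "u * cross g h = 0" "v * cross g h = 0" unfolding cross_def by algebra+
    with \<Gamma> show ?thesis by simp
  qed
  have "?f z = 0" using center by (simp add: is_center_def)
  from indep[OF this[unfolded f]]
  have z: "((\<xi> \<bullet> z) + s) * ((\<xi> \<bullet> z) + \<beta> - s) = 0" "c + \<gamma> * (\<xi>
      \<bullet> z) + (\<eta> \<bullet> z) * (s + \<xi> \<bullet> z) = 0" by auto
  have "\<xi> \<bullet> z + s \<noteq> 0"
  proof
    assume 0: "\<xi> \<bullet> z + s = 0"
    then have "\<xi> \<bullet> z = - s" by simp
    with z(2) nz(2) show False by (simp add: mult.commute)
  qed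
  with z(1) have X: "\<xi> \<bullet> z = s - \<beta>" by simp
  define S t where "S = 2 * s - \<beta>" and "t = \<gamma> + \<eta> \<bullet> z"
  have S: "S \<noteq> 0" using nz(1) by (auto simp: S_def)
  have "t * S = s * \<gamma> - c" using z(2) unfolding t_def S_def X by (simp add: algebra_simps)
  then have t: "t \<noteq> 0" using nz(2) by auto
  have f': "?f x = ((\<xi> \<bullet> (x - z)) * (\<xi> \<bullet> (x - z) + S)) *\<^sub>R g
      + (t * (\<xi> \<bullet> (x - z)) + (\<eta> \<bullet> (x - z)) * (S + \<xi> \<bullet> (x - z)))
          *\<^sub>R h" for x
  proof -
    have x: "\<xi> \<bullet> x = \<xi> \<bullet> (x - z) + (s - \<beta>)" "\<eta> \<bullet> x = \<eta>
        \<bullet> (x - z) + \<eta> \<bullet> z"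
      by (simp_all add: inner_diff_right X)
    have "c = - \<gamma> * (s - \<beta>) - (\<eta> \<bullet> z) * S" using z(2) unfolding X S_def by (simp
        add: algebra_simps)
    then have "(((\<xi> \<bullet> x) + s) * ((\<xi> \<bullet> x) + \<beta> - s)) = (\<xi> \<bullet> (x -
        z)) * (\<xi> \<bullet> (x - z) + S)"
       "c + \<gamma> * (\<xi> \<bullet> x) + (\<eta> \<bullet> x) * (s + \<xi> \<bullet> x) = t * (\<xi>
           \<bullet> (x - z)) + (\<eta> \<bullet> (x - z)) * (S + \<xi> \<bullet> (x - z))"
      unfolding x S_def t_def by (simp_all add: algebra_simps)
    then show ?thesis unfolding f by simp
  qed
  have \<xi>: "\<xi> \<noteq> 0" using \<delta> by (auto simp: cross_def)
  have both: "u = 0" if "\<xi> \<bullet> u = 0" "\<eta> \<bullet> u = 0" for u :: "real ^ 2"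
  proof -
    have "u $ 1 * cross \<xi> \<eta> = 0" "u $ 2 * cross \<xi> \<eta> = 0"
      using that unfolding cross_def inner_2 by algebra+
    with \<delta> show ?thesis by (simp add: vec_eq_2)
  qed
  have D: "(\<xi> \<bullet> g) * (\<eta> \<bullet> h) - (\<xi> \<bullet> h) * (\<eta> \<bullet> g) = cross g h"
  proof -
    have "(\<xi> \<bullet> g) * (\<eta> \<bullet> h) - (\<xi> \<bullet> h) * (\<eta> \<bullet> g) = cross
        \<xi> \<eta> * cross g h"
      unfolding cross_def inner_2 by algebra
    with \<delta> show ?thesis by simp
  qed
  show False
  proof (cases "\<xi> \<bullet> h = 0")
    case True
    then have "\<xi> \<bullet> g \<noteq> 0" using D \<Gamma> by auto
    moreover have "\<xi> \<bullet> ?f x = (\<xi> \<bullet> g) * (\<xi> \<bullet> (x - z)) * (\<xi>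
        \<bullet> (x - z) + S)" for x
      unfolding f' inner_add_right inner_scaleR_right True by simp
    ultimately show False using not_center_invariant_line[OF \<xi> _ _ S] center by blast
  next
    case False
    \<comment> \<open>The form \<open>q\<close> annihilates h, so only the g-component X (X + S)
      enters its derivative.\<close>
    define q where "q = (\<xi> \<bullet> h) *\<^sub>R \<eta> - (\<eta> \<bullet> h) *\<^sub>R \<xi>"
    have q: "q \<bullet> u = (\<xi> \<bullet> h) * (\<eta> \<bullet> u) - (\<eta> \<bullet> h) * (\<xi>
        \<bullet> u)" for u
      by (simp add: q_def inner_diff_left)
    have "q \<noteq> 0"
    proof
      assume "q = 0"
      then have "(\<xi> \<bullet> h) * (\<eta> \<bullet> g) - (\<eta> \<bullet> h) * (\<xi> \<bullet> g) =
          0" using q[of g] by simp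
      with D \<Gamma> show False by (simp add: algebra_simps)
    qed
    moreover have "u = 0" if "\<xi> \<bullet> u = 0" "q \<bullet> u = 0" for u
      using that both[of u] False unfolding q by simp
    moreover have "\<xi> \<bullet> ?f x = (S + \<xi> \<bullet> (x - z)) * (q \<bullet> (x - z) + (\<xi>
        \<bullet> g + \<eta> \<bullet> h) * (\<xi> \<bullet> (x - z))) + (t * (\<xi> \<bullet> h)) * (\<xi>
            \<bullet> (x - z))" for x
      unfolding f' inner_add_right inner_scaleR_right q by algebra
    moreover have "q \<bullet> ?f x = - cross g h * (\<xi> \<bullet> (x - z)) * (S + \<xi> \<bullet> (x - z))" for x
      unfolding f' inner_add_right inner_scaleR_right q D[symmetric] by algebra
    ultimately show False
      using not_center_lienard[OF \<xi>, of q ?f S z "\<xi> \<bullet> g + \<eta> \<bullet> h" "t * (\<xi>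
          \<bullet> h)" "cross g h"] S t False \<Gamma> center
      by (metis mult_eq_0_iff)
  qed
qed

text \<open>Both conditions of the criterion fail: \<open>N_tilde\<close> \<noteq> 0 excludes the
  second, and the implication is incompatible with \<open>C11\<close> < 0 in the first.\<close>

lemma criterion_common_factor:
  fixes a0 g h \<xi> \<eta> :: "real ^ 2" and a1 :: "real ^ 2 ^ 2" and a2 :: "real ^ 2 ^ 2 ^ 2"
  assumes a2: "\<And>j i k. a2 $ j $ i $ k = g $ j * \<xi> $ i * \<xi> $ k + h $ j * ((\<xi> $ i * \<eta> $
      k + \<xi> $ k * \<eta> $ i) / 2)"
    and a1: "\<And>j i. a1 $ j $ i = (\<beta> * g $ j + \<gamma> * h $ j) * \<xi> $ i + s * h $ j * \<eta> $ i"
    and a0: "\<And>j. a0 $ j = s * (\<beta> - s) * g $ j + c * h $ j"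
    and \<delta>: "cross \<xi> \<eta> = 1" and \<Gamma>: "cross g h \<noteq> 0" and nz: "s * \<gamma> \<noteq> c"
  shows "N_tilde a2 \<noteq> 0" "C3 a0 a1 a2 = 0 \<Longrightarrow> C11 a0 a1 a2 = 0"
proof -
  have "h $ 1 \<noteq> 0 \<or> h $ 2 \<noteq> 0" using \<Gamma> by (auto simp: cross_def)
  then show "N_tilde a2 \<noteq> 0"
    unfolding N_tilde_def K_hat_common_factor[OF a2 a1 a0] \<delta> cross_form_def form_mult form_eq_0 by auto
  assume "C3 a0 a1 a2 = 0"
  then have "\<xi> $ 1 * h $ 1 + \<xi> $ 2 * h $ 2 = 0"
    using \<Gamma> nz unfolding C3_common_factor[OF a2 a1 a0 refl] \<delta> by simp
  then show "C11 a0 a1 a2 = 0" by (rule C11_common_factor[OF a2 a1 a0 refl])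
qed

section \<open>The case of quadratic parts of rank one\<close>

context
  fixes a0 z w l m :: "real ^ 2" and A a1 :: "real ^ 2 ^ 2" and a2 :: "real ^ 2 ^ 2 ^ 2"
  assumes a2: "\<And>j \<alpha> \<beta>. a2 $ j $ \<alpha> $ \<beta> = w $ j * ((l $ \<alpha> * m $ \<beta>
      + l $ \<beta> * m $ \<alpha>) / 2)"
  and l: "\<And>\<alpha>. l $ \<alpha> = w $ 1 * A $ 2 $ \<alpha> - w $ 2 * A $ 1 $ \<alpha>"
  and a1: "\<And>j \<alpha>. a1 $ j $ \<alpha> = A $ j $ \<alpha> - 2 * (a2 $ j $ \<alpha> $ 1 * z $ 1 + a2
      $ j $ \<alpha> $ 2 * z $ 2)"
  and a0: "\<And>j. a0 $ j = a2 $ j $ 1 $ 1 * (z $ 1)\<^sup>2 + 2 * a2 $ j $ 1 $ 2 * z $ 1 * z $ 2 + a2 $ j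
      $ 2 $ 2 * (z $ 2)\<^sup>2
     - (A $ j $ 1 * z $ 1 + A $ j $ 2 * z $ 2)"
begin

lemma vector_field_rank_one:
  "vector_field a0 a1 a2 x $ j = A $ j $ 1 * (x - z) $ 1 + A $ j $ 2 * (x - z) $ 2 + w $ j * ((l \<bullet>
      (x - z)) * (m \<bullet> (x - z)))"
proof -
  have a12: "a2 $ j $ 2 $ 1 = a2 $ j $ 1 $ 2" by (simp add: a2 add.commute)
  have "a2 $ j $ 1 $ 1 * u * u + 2 * a2 $ j $ 1 $ 2 * u * v + a2 $ j $ 2 $ 2 * v * v
      = w $ j * ((l $ 1 * u + l $ 2 * v) * (m $ 1 * u + m $ 2 * v))" for u v
    unfolding a2 by (simp add: field_simps)
  from this[of "(x - z) $ 1" "(x - z) $ 2"] show ?thesis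
    unfolding vector_field_nth a0 a1 inner_2 a12 by (simp add: algebra_simps power2_eq_square)
qed

text \<open>Moving from \<open>A\<close> to \<open>a1\<close> changes the determinant by l(z) times
  l x m, which is zero by hypothesis.\<close>

lemma J1_rank_one:
  assumes "l $ 1 * m $ 2 - l $ 2 * m $ 1 = 0"
  shows "J1 a1 = A $ 1 $ 1 * A $ 2 $ 2 - A $ 1 $ 2 * A $ 2 $ 1"
proof -
  have a1': "a1 $ j $ \<alpha> = A $ j $ \<alpha> - w $ j * (l $ \<alpha> * (m \<bullet> z) + m $ \<alpha>
      * (l \<bullet> z))" for j \<alpha>
    unfolding a1 a2 inner_2 by (simp add: field_simps)
  have "J1 a1 = A $ 1 $ 1 * A $ 2 $ 2 - A $ 1 $ 2 * A $ 2 $ 1 + (l \<bullet> z) * (l $ 1 * m $ 2 - l $ 2 * m $ 1)"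
    unfolding J1_eq a1' l by algebra
  with assms show ?thesis by simp
qed

text \<open>All dependence on z collects in the factor l(z) - w x A z, which vanishes by the
  definition of l.\<close>

lemma J2_rank_one:
  assumes "m = k *\<^sub>R l"
  shows "J2 a0 a1 a2 = - 2 * (A $ 1 $ 1 + A $ 2 $ 2) * (A $ 1 $ 1 * A $ 2 $ 2 - A $ 1 $ 2 * A $ 2 $ 1)"
proof -
  define lz where "lz = l \<bullet> z"
  define Az1 where "Az1 = A $ 1 $ 1 * z $ 1 + A $ 1 $ 2 * z $ 2"
  define Az2 where "Az2 = A $ 2 $ 1 * z $ 1 + A $ 2 $ 2 * z $ 2"
  define c where "c = l $ 1 * w $ 1 + l $ 2 * w $ 2"
  have m: "m $ i = k * l $ i" for i using assms by simp
  have a2': "a2 $ j $ \<alpha> $ \<beta> = k * w $ j * l $ \<alpha> * l $ \<beta>" for j \<alpha> \<beta>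
    unfolding a2 m by (simp add: field_simps)
  have a1': "a1 $ j $ \<alpha> = A $ j $ \<alpha> - 2 * k * lz * w $ j * l $ \<alpha>" for j \<alpha>
    unfolding a1 a2' lz_def inner_2 by (simp add: algebra_simps)
  have a0': "a0 $ 1 = k * w $ 1 * lz\<^sup>2 - Az1" "a0 $ 2 = k * w $ 2 * lz\<^sup>2 - Az2"
    unfolding a0 a2' lz_def inner_2 Az1_def Az2_def by (simp_all add: algebra_simps power2_eq_square)
  have G: "a2 $ 1 $ 1 $ 1 + a2 $ 2 $ 1 $ 2 = k * c * l $ 1" "a2 $ 1 $ 2 $ 1 + a2 $ 2 $ 2 $ 2 = k * c * l $ 2"
    unfolding a2' c_def by (simp_all add: algebra_simps)
  have lz: "w $ 1 * Az2 - w $ 2 * Az1 = lz" unfolding Az1_def Az2_def lz_def inner_2 l by (simp add: algebra_simps)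
  have det: "a1 $ 1 $ 1 * a1 $ 2 $ 2 - a1 $ 1 $ 2 * a1 $ 2 $ 1 = A $ 1 $ 1 * A $ 2 $ 2 - A $ 1 $ 2 * A $ 2 $ 1"
    unfolding a1' l by algebra
  have tr: "a1 $ 1 $ 1 + a1 $ 2 $ 2 = A $ 1 $ 1 + A $ 2 $ 2 - 2 * k * lz * c"
    unfolding a1' c_def by (simp add: algebra_simps)
  \<comment> \<open>This is the Cayley-Hamilton theorem applied to the covector u -> w x u, whose
    image under \<open>A\<close> is l.\<close>
  have lA: "l $ 1 * A $ 1 $ 1 + l $ 2 * A $ 2 $ 1 = (A $ 1 $ 1 + A $ 2 $ 2) * l $ 1 + (A $ 1 $ 1 * A $ 2 $
      2 - A $ 1 $ 2 * A $ 2 $ 1) * w $ 2"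
    "l $ 1 * A $ 1 $ 2 + l $ 2 * A $ 2 $ 2 = (A $ 1 $ 1 + A $ 2 $ 2) * l $ 2 - (A $ 1 $ 1 * A $ 2 $ 2 - A $
        1 $ 2 * A $ 2 $ 1) * w $ 1"
    unfolding l by algebra+
  define \<tau> d where "\<tau> = A $ 1 $ 1 + A $ 2 $ 2" and "d = A $ 1 $ 1 * A $ 2 $ 2 - A $ 1 $ 2 * A $ 2 $ 1"
  have la: "a1 $ 1 $ 1 * (k * c * l $ 1) + a1 $ 2 $ 1 * (k * c * l $ 2) = k * c * (\<tau> * l $ 1 + d * w $
      2 - 2 * k * lz * c * l $ 1)"
    "a1 $ 1 $ 2 * (k * c * l $ 1) + a1 $ 2 $ 2 * (k * c * l $ 2) = k * c * (\<tau> * l $ 2 - d * w $ 1 - 2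
        * k * lz * c * l $ 2)"
    unfolding a1' c_def \<tau>_def d_def using lA by algebra+
  have "J2 a0 a1 a2 = - 2 * \<tau> * d + 4 * k * c * d * (lz - (w $ 1 * Az2 - w $ 2 * Az1))"
    unfolding J2_eq Let_def G det tr la a0' \<tau>_def[symmetric] d_def[symmetric]
    by (simp add: algebra_simps power2_eq_square)
  then show ?thesis unfolding lz \<tau>_def d_def by simp
qed

context
  assumes det: "A $ 1 $ 1 * A $ 2 $ 2 - A $ 1 $ 2 * A $ 2 $ 1 \<noteq> 0" and l0: "l \<noteq> 0" and m0: "m
      \<noteq> 0"
begin

lemma criterion_rank_one:
  "(\<exists>z. is_center (vector_field a0 a1 a2) z) \<longleftrightarrow>
      (N_tilde a2 \<noteq> 0 \<and> C3 a0 a1 a2 = 0 \<and> C10 a0 a1 a2 = 0 \<and> C11 a0 a1 a2 < 0) \<or>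
      (N_tilde a2 = 0 \<and> J2 a0 a1 a2 = 0 \<and> J1 a1 > 0)"
proof -
  let ?f = "vector_field a0 a1 a2"
  define \<tau> d al lw mw where "\<tau> = A $ 1 $ 1 + A $ 2 $ 2" and "d = A $ 1 $ 1 * A $ 2 $ 2 - A $ 1 $
      2 * A $ 2 $ 1"
    and "al = l $ 1 * m $ 2 - l $ 2 * m $ 1" and "lw = l $ 1 * w $ 1 + l $ 2 * w $ 2"
    and "mw = m $ 1 * w $ 1 + m $ 2 * w $ 2"
  define p :: "real ^ 2" where "p = vector [- w $ 2, w $ 1]"
  have p: "p $ 1 = - w $ 2" "p $ 2 = w $ 1" by (simp_all add: p_def)
  have d: "d \<noteq> 0" using det by (simp add: d_def)
  have w0: "w $ 1 \<noteq> 0 \<or> w $ 2 \<noteq> 0" using l0 l by (auto simp: vec_eq_2)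
  then have p0: "p \<noteq> 0" by (auto simp: vec_eq_2 p)
  have N: "N_tilde a2 = 0 \<longleftrightarrow> al = 0"
    using w0 unfolding N_tilde_def forms_rank_one(4)[OF a2 l a1 a0] form_mult form_eq_0 al_def by auto
  have C3: "C3 a0 a1 a2 = - (1 / 3) * lw * mw * d * al"
    unfolding C3_rank_one[OF a2 l a1 a0] lw_def mw_def d_def al_def ..
  \<comment> \<open>Expanding lw m in the covectors p and l turns l(w) m into the factor al y + mw v
    of the normal form.\<close>
  have m_eq: "lw * m $ 1 = al * p $ 1 + mw * l $ 1" "lw * m $ 2 = al * p $ 2 + mw * l $ 2"
    unfolding lw_def al_def mw_def p by algebra+
  have f1: "p \<bullet> ?f x = l \<bullet> (x - z)" for x
    unfolding inner_2 vector_field_rank_one p l by algebra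
  have f2: "l \<bullet> ?f x = \<tau> * (l \<bullet> (x - z)) - d * (p \<bullet> (x - z))
      + (l \<bullet> (x - z)) * (al * (p \<bullet> (x - z)) + mw * (l \<bullet> (x - z)))" for x
  proof -
    have "lw * (m \<bullet> (x - z)) = al * (p \<bullet> (x - z)) + mw * (l \<bullet> (x - z))"
      unfolding inner_2 using m_eq by algebra
    moreover have "l \<bullet> ?f x = \<tau> * (l \<bullet> (x - z)) - d * (p \<bullet> (x - z)) + (l
        \<bullet> (x - z)) * (lw * (m \<bullet> (x - z)))"
      unfolding inner_2[of l "?f x"] vector_field_rank_one lw_def \<tau>_def d_def
      unfolding inner_2[of l "x - z"] inner_2[of p "x - z"] p l by algebra
    ultimately show ?thesis by simp
  qed
  have unique: "z' = z" if "is_center ?f z'" for z'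
  proof -
    have 0: "?f z' = 0" using that by (simp add: is_center_def)
    then have "l \<bullet> (z' - z) = 0" using f1[of z'] by simp
    then have "A $ 1 $ 1 * (z' - z) $ 1 + A $ 1 $ 2 * (z' - z) $ 2 = 0"
       "A $ 2 $ 1 * (z' - z) $ 1 + A $ 2 $ 2 * (z' - z) $ 2 = 0"
      using 0 vector_field_rank_one[of z'] by simp_all
    then have "d * (z' - z) $ 1 = 0" "d * (z' - z) $ 2 = 0" unfolding d_def by algebra+
    with d have "z' - z = 0" by (simp add: vec_eq_2)
    then show ?thesis by simp
  qed
  have indep: "u = 0" if "lw \<noteq> 0" "p \<bullet> u = 0" "l \<bullet> u = 0" for u
  proof -
    have "lw * u $ 1 = 0" "lw * u $ 2 = 0"
      using that(2,3) unfolding lw_def inner_2 p by algebra+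
    with that(1) show ?thesis by (simp add: vec_eq_2)
  qed
  have mk: "\<exists>k. m $ 1 = - k * w $ 2 \<and> m $ 2 = k * w $ 1" if "mw = 0"
  proof (cases "w $ 1 = 0")
    case True
    with that w0 show ?thesis by (intro exI[of _ "- m $ 1 / w $ 2"]) (auto simp: mw_def)
  next
    case False
    with that show ?thesis
      by (intro exI[of _ "m $ 2 / w $ 1"]) (auto simp: mw_def field_simps add_eq_0_iff)
  qed
  have lk: "C11 a0 a1 a2 = 0 \<and> (\<exists>k. k \<noteq> 0 \<and> l = k *\<^sub>R p)" if "lw = 0"
  proof -
    have "\<exists>k. l $ 1 = - k * w $ 2 \<and> l $ 2 = k * w $ 1"
    proof (cases "w $ 1 = 0")
      case True
      with that w0 show ?thesis by (intro exI[of _ "- l $ 1 / w $ 2"]) (auto simp: lw_def)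
    next
      case False
      with that show ?thesis
        by (intro exI[of _ "l $ 2 / w $ 1"]) (auto simp: lw_def field_simps add_eq_0_iff)
    qed
    then obtain k where k: "l $ 1 = - k * w $ 2" "l $ 2 = k * w $ 1" by blast
    then have "l = k *\<^sub>R p" by (simp add: vec_eq_2 p)
    moreover from this l0 have "k \<noteq> 0" by auto
    ultimately show ?thesis using C11_rank_one_eigenvector[OF a2 l a1 a0 k] by blast
  qed
  have ml: "\<exists>k. m = k *\<^sub>R l" if "al = 0"
  proof (cases "l $ 1 = 0")
    case True
    then have "l $ 2 \<noteq> 0" using l0 by (simp add: vec_eq_2)
    with True that show ?thesis by (intro exI[of _ "m $ 2 / l $ 2"]) (auto simp: vec_eq_2 al_def)
  next
    case False
    with that show ?thesis by (intro exI[of _ "m $ 1 / l $ 1"]) (auto simp: vec_eq_2 al_def field_simps)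
  qed
  \<comment> \<open>If l(w) = 0, then p is a left eigenvector of \<open>A\<close> with a real
    eigenvalue k. With trace zero this gives k^2 + d = 0, impossible for d > 0.\<close>
  have lw_pos: "lw \<noteq> 0" if "\<tau> = 0" "d > 0"
  proof
    assume "lw = 0"
    then obtain k where k: "l = k *\<^sub>R p" using lk by blast
    have A22: "A $ 2 $ 2 = - A $ 1 $ 1" using that(1) by (simp add: \<tau>_def)
    have "l $ 1 = - k * w $ 2" "l $ 2 = k * w $ 1" using k by (simp_all add: p)
    then have "(k\<^sup>2 + d) * w $ 1 = 0" "(k\<^sup>2 + d) * w $ 2 = 0"
      using A22 unfolding l d_def by algebra+
    with w0 have "k\<^sup>2 + d = 0" by auto
    with that(2) show False using zero_le_power2[of k] by linarith
  qed
  \<comment> \<open>\<open>e1\<close>, \<open>e2\<close> is the basis dual to p, l; w lies on the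
    second axis because p annihilates it.\<close>
  have frame: "\<exists>e1 e2. (\<forall>u v. u *\<^sub>R e1 + v *\<^sub>R e2 = 0 \<longrightarrow> u = 0
      \<and> v = 0) \<and>
     (\<forall>u v. p \<bullet> (u *\<^sub>R e1 + v *\<^sub>R e2) = u \<and> l \<bullet> (u *\<^sub>R e1 +
         v *\<^sub>R e2) = v)" if "lw \<noteq> 0"
  proof -
    define e1 e2 :: "real ^ 2" where "e1 = vector [- l $ 2 / lw, l $ 1 / lw]" and "e2 = (1 / lw) *\<^sub>R w"
    have pl: "p \<bullet> (u *\<^sub>R e1 + v *\<^sub>R e2) = u" "l \<bullet> (u *\<^sub>R e1 + v *\<^sub>R
        e2) = v" for u v
    proof -
      have "p \<bullet> e1 = 1" "p \<bullet> e2 = 0" "l \<bullet> e1 = 0" "l \<bullet> e2 = 1"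
        using that by (simp_all add: e1_def e2_def inner_2 p add_divide_distrib[symmetric]) (simp_all add:
            lw_def algebra_simps)
      then show "p \<bullet> (u *\<^sub>R e1 + v *\<^sub>R e2) = u" "l \<bullet> (u *\<^sub>R e1 + v
          *\<^sub>R e2) = v"
        by (simp_all add: inner_add_right)
    qed
    moreover have "u = 0 \<and> v = 0" if "u *\<^sub>R e1 + v *\<^sub>R e2 = 0" for u v
      using pl[of u v] unfolding that by simp
    ultimately show ?thesis by blast
  qed
  have f_frame: "?f (z + y *\<^sub>R e1 + v *\<^sub>R e2) = v *\<^sub>R e1 + (\<tau> * v - d * y + v * (al
      * y + mw * v)) *\<^sub>R e2"
    if "lw \<noteq> 0" and e: "\<forall>u v. p \<bullet> (u *\<^sub>R e1 + v *\<^sub>R e2) = u \<and> l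
        \<bullet> (u *\<^sub>R e1 + v *\<^sub>R e2) = v" for y v e1 e2
  proof -
    let ?x = "z + y *\<^sub>R e1 + v *\<^sub>R e2"
    have x: "?x - z = y *\<^sub>R e1 + v *\<^sub>R e2" by simp
    have "?f ?x - (v *\<^sub>R e1 + (\<tau> * v - d * y + v * (al * y + mw * v)) *\<^sub>R e2) = 0"
      by (rule indep[OF that(1)]) (simp_all only: inner_diff_right f1 f2 x e diff_self)
    then show ?thesis by simp
  qed
  show ?thesis
  proof
    assume "\<exists>z. is_center ?f z"
    then have center: "is_center ?f z" using unique by blast
    \<comment> \<open>If l is a multiple of p, then y = p . (x - z) obeys y' = k y, and no center
      exists.\<close>
    have lw: "lw \<noteq> 0"
    proof
      assume "lw = 0"
      then obtain k where k: "k \<noteq> 0" "l = k *\<^sub>R p" using lk by blast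
      have "p \<bullet> ?f x = k * (p \<bullet> (x - z))" for x unfolding f1 unfolding k(2) by simp
      then show False using not_center_eigenvector[OF p0 _ k(1)] center by blast
    qed
    have "\<not> d < 0"
      using not_center_saddle[of p l ?f z \<tau> d al mw] p0 l0 indep[OF lw] f1 f2 center by blast
    with d have dpos: "d > 0" by simp
    have \<tau>: "\<tau> = 0"
      using not_center_trace[of p l ?f z \<tau> d al mw] p0 l0 indep[OF lw] f1 f2 center dpos by blast
    show "(N_tilde a2 \<noteq> 0 \<and> C3 a0 a1 a2 = 0 \<and> C10 a0 a1 a2 = 0 \<and> C11 a0 a1 a2 < 0) \<or>
      (N_tilde a2 = 0 \<and> J2 a0 a1 a2 = 0 \<and> J1 a1 > 0)"
    proof (cases "al = 0")
      case True
      then obtain k where "m = k *\<^sub>R l" using ml by blast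
      from J2_rank_one[OF this] J1_rank_one True N \<tau> dpos show ?thesis
        by (simp add: al_def d_def \<tau>_def)
    next
      case False
      have f2': "l \<bullet> ?f x = - d * (p \<bullet> (x - z)) + (l \<bullet> (x - z)) * (al * (p
          \<bullet> (x - z)) + mw * (l \<bullet> (x - z)))" for x
        unfolding f2 \<tau> by simp
      have mw: "mw = 0"
        using not_center_focal[of p l ?f z d al mw] p0 l0 indep[OF lw] f1 f2' center dpos False by blast
      then obtain k where k: "m $ 1 = - k * w $ 2" "m $ 2 = k * w $ 1" using mk by blast
      have "k \<noteq> 0" using m0 k by (auto simp: vec_eq_2)
      then have "k ^ 4 * lw ^ 6 * d > 0" using lw dpos by (simp add: zero_less_mult_iff zero_less_power_eq)
      then have "C11 a0 a1 a2 < 0"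
        unfolding C11_rank_one[OF a2 l a1 a0 k] lw_def d_def by simp
      moreover have "C10 a0 a1 a2 = 0"
        using \<tau> unfolding C10_rank_one[OF a2 l a1 a0 k] \<tau>_def by simp
      ultimately show ?thesis using N False C3 mw by simp
    qed
  next
    assume "(N_tilde a2 \<noteq> 0 \<and> C3 a0 a1 a2 = 0 \<and> C10 a0 a1 a2 = 0 \<and> C11 a0 a1 a2 < 0) \<or>
      (N_tilde a2 = 0 \<and> J2 a0 a1 a2 = 0 \<and> J1 a1 > 0)"
    then show "\<exists>z. is_center ?f z"
    proof (elim disjE conjE)
      assume h: "N_tilde a2 \<noteq> 0" "C3 a0 a1 a2 = 0" "C10 a0 a1 a2 = 0" "C11 a0 a1 a2 < 0"
      have lw: "lw \<noteq> 0" using lk h(4) by auto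
      have mw: "mw = 0" using h(1,2) lw d unfolding N C3 by simp
      then obtain k where k: "m $ 1 = - k * w $ 2" "m $ 2 = k * w $ 1" using mk by blast
      have k0: "k \<noteq> 0" using m0 k by (auto simp: vec_eq_2)
      have \<tau>: "\<tau> = 0"
        using h(3) k0 lw d unfolding C10_rank_one[OF a2 l a1 a0 k] lw_def[symmetric] d_def[symmetric]
            \<tau>_def[symmetric] by simp
      have pos: "k ^ 4 * lw ^ 6 * d > 0"
        using h(4) unfolding C11_rank_one[OF a2 l a1 a0 k] lw_def[symmetric] d_def[symmetric] by simp
      have "k ^ 4 * lw ^ 6 \<ge> 0" by (intro mult_nonneg_nonneg zero_le_even_power) auto
      then have dpos: "d > 0" using pos mult_nonneg_nonpos[of "k ^ 4 * lw ^ 6" d] by linarith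
      obtain e1 e2 where e: "\<forall>u v. u *\<^sub>R e1 + v *\<^sub>R e2 = 0 \<longrightarrow> u = 0 \<and> v = 0"
        "\<forall>u v. p \<bullet> (u *\<^sub>R e1 + v *\<^sub>R e2) = u \<and> l \<bullet> (u *\<^sub>R e1
            + v *\<^sub>R e2) = v"
        using frame[OF lw] by blast
      have "is_center ?f z"
        by (rule is_center_product_damping[OF dpos e(1), of _ _ al])
           (subst f_frame[OF lw e(2)], simp add: \<tau> mw algebra_simps)
      then show ?thesis ..
    next
      assume h: "N_tilde a2 = 0" "J2 a0 a1 a2 = 0" "0 < J1 a1"
      have al: "al = 0" using h(1) N by simp
      then obtain k where "m = k *\<^sub>R l" using ml by blast
      from J2_rank_one[OF this] h(2) d have \<tau>: "\<tau> = 0" by (simp add: \<tau>_def d_def)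
      have dpos: "d > 0" using J1_rank_one h(3) al by (simp add: al_def d_def)
      have lw: "lw \<noteq> 0" using lw_pos[OF \<tau> dpos] .
      obtain e1 e2 where e: "\<forall>u v. u *\<^sub>R e1 + v *\<^sub>R e2 = 0 \<longrightarrow> u = 0 \<and> v = 0"
        "\<forall>u v. p \<bullet> (u *\<^sub>R e1 + v *\<^sub>R e2) = u \<and> l \<bullet> (u *\<^sub>R e1
            + v *\<^sub>R e2) = v"
        using frame[OF lw] by blast
      have "is_center ?f z"
        by (rule is_center_square_damping[OF dpos e(1), of _ _ mw])
           (subst f_frame[OF lw e(2)], simp add: \<tau> al algebra_simps power2_eq_square)
      then show ?thesis ..
    qed
  qed
qed

end
end

section \<open>The criterion, by the alternative \<open>B3\<close> = 0 or \<open>B3\<close> \<noteq>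
  0\<close>

theorem theorem9:
  fixes a0 :: "real ^ 2" and a1 :: "real ^ 2 ^ 2" and a2 :: "real ^ 2 ^ 2 ^ 2"
  assumes sym: "\<And>j \<alpha> \<beta>. a2 $ j $ \<alpha> $ \<beta> = a2 $ j $ \<beta> $ \<alpha>"
    and "comitant_mu a2 = 0" and "comitant_H a1 a2 = 0" and "comitant_G a0 a1 a2 = 0"
    and "comitant_F a0 a1 a2 \<noteq> 0"
  shows "(\<exists>z. is_center (vector_field a0 a1 a2) z) \<longleftrightarrow>
      (N_tilde a2 \<noteq> 0 \<and> C3 a0 a1 a2 = 0 \<and> C10 a0 a1 a2 = 0 \<and> C11 a0 a1 a2 < 0) \<or>
      (N_tilde a2 = 0 \<and> J2 a0 a1 a2 = 0 \<and> J1 a1 > 0)"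
proof (cases "B3 a2 = 0")
  case True
  obtain w l m z :: "real ^ 2" and A :: "real ^ 2 ^ 2" where *:
    "\<And>j \<alpha> \<beta>. a2 $ j $ \<alpha> $ \<beta> = w $ j * ((l $ \<alpha> * m $ \<beta> + l $ \<beta> * m $ \<alpha>) / 2)"
    "\<And>\<alpha>. l $ \<alpha> = w $ 1 * A $ 2 $ \<alpha> - w $ 2 * A $ 1 $ \<alpha>"
    "\<And>j \<alpha>. a1 $ j $ \<alpha> = A $ j $ \<alpha> - 2 * (a2 $ j $ \<alpha> $ 1 * z $ 1 + a2 $ j $ \<alpha> $ 2 * z $ 2)"
    "\<And>j. a0 $ j = a2 $ j $ 1 $ 1 * (z $ 1)\<^sup>2 + 2 * a2 $ j $ 1 $ 2 * z $ 1 * z $ 2 + a2 $ j $ 2 $ 2 * (z $ 2)\<^sup>2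
       - (A $ j $ 1 * z $ 1 + A $ j $ 2 * z $ 2)"
    "A $ 1 $ 1 * A $ 2 $ 2 - A $ 1 $ 2 * A $ 2 $ 1 \<noteq> 0" "l \<noteq> 0" "m \<noteq> 0"
    using normal_form_rank_one[OF sym True assms(4,5)] by metis
  show ?thesis by (rule criterion_rank_one[OF *])
next
  case False
  obtain g h \<xi> \<eta> :: "real ^ 2" and \<beta> \<gamma> s c where *:
    "\<And>j i k. a2 $ j $ i $ k = g $ j * \<xi> $ i * \<xi> $ k + h $ j * ((\<xi> $ i * \<eta> $ k + \<xi> $ k * \<eta> $ i) / 2)"
    "\<And>j i. a1 $ j $ i = (\<beta> * g $ j + \<gamma> * h $ j) * \<xi> $ i + s * h $ j * \<eta> $ i"
    "\<And>j. a0 $ j = s * (\<beta> - s) * g $ j + c * h $ j"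
    "cross \<xi> \<eta> = 1" "cross g h \<noteq> 0" and nz: "\<beta> \<noteq> 2 * s" "s * \<gamma> \<noteq> c"
    using normal_form_common_factor[OF sym assms(2-5) False] by metis
  have "\<not> is_center (vector_field a0 a1 a2) z" for z by (rule no_center_common_factor[OF * nz])
  moreover have "N_tilde a2 \<noteq> 0" "C3 a0 a1 a2 = 0 \<Longrightarrow> C11 a0 a1 a2 = 0"
    using criterion_common_factor[OF * nz(2)] by blast+
  ultimately show ?thesis by auto
qed

end
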